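(* Let $\gamma_1>1/3$, $\gamma_2>1/2$, and let $x\in\mathcal P_{1,1}^{\gamma_1,\gamma_2}$ admit a geometric rough sheet $\mathbb X$ above it (as defined in the context). Let $\varphi\in C_b^5(\mathbb R)$, $y=\varphi(x)$, and $y^{(i)}=\varphi^{(i)}(x)$ for $i\ge1$. Then: (i) The rectangular increment of $y$ decomposes as $$\delta y=\int_1\int_2 y^{(1)}\,d_{12}x+\int_1\int_2 y^{(2)}\,d_{\hat1\hat2}x,$$ where the two integrals are the well-defined increments $$\int_1\int_2 y^{(1)}d_{12}x:=[\mathrm{id}-\Lambda_1\delta_1][\mathrm{id}-\Lambda_2\delta_2]\bigl(y^{(1)}\mathbf x^{1;2}+y^{(2)}\mathbf x^{11;0\cdot2}\bigr),$$ $$\int_1\int_2 y^{(2)}d_{\hat1\hat2}x:=[\mathrm{id}-\Lambda_1\delta_1][\mathrm{id}-\Lambda_2\delta_2]\bigl(y^{(2)}\mathbf x^{\hat1;\hat2}+y^{(3)}\mathbf x^{1\hat1;0\cdot\hat2}\bigr).$$ (ii) For $s_1<s_2$, $t_1<t_2$ and any sequences $(\pi_n^1)$, $(\pi_n^2)$ of partitions $\{\sigma_i\}$ of $[s_1,s_2]$ and $\{\tau_j\}$ of $[t_1,t_2]$ whose meshes go to $0$ as $n\to\infty$, $$\delta y_{s_1s_2;t_1t_2}=\lim_{n\to\infty}\Bigl(\sum_{\pi_n^1,\pi_n^2}\bigl[y^{(1)}_{\sigma_i;\tau_j}\mathbf x^{1;2}_{\sigma_i\sigma_{i+1};\tau_j\tau_{j+1}}+y^{(2)}_{\sigma_i;\tau_j}\mathbf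 x^{11;0\cdot2}_{\sigma_i\sigma_{i+1};\tau_j\tau_{j+1}}\bigr]+\sum_{\pi_n^1,\pi_n^2}\bigl[y^{(2)}_{\sigma_i;\tau_j}\mathbf x^{\hat1;\hat2}_{\sigma_i\sigma_{i+1};\tau_j\tau_{j+1}}+y^{(3)}_{\sigma_i;\tau_j}\mathbf x^{1\hat1;0\cdot\hat2}_{\sigma_i\sigma_{i+1};\tau_j\tau_{j+1}}\bigr]\Bigr).$$
   Context: Fix $T>0$. **Increments.** $\mathcal P_{k,l}$ is the set of continuous $f:[0,T]^k\times[0,T]^l\to\mathbb R$, written $f_{s_1\cdots s_k;t_1\cdots t_l}$, vanishing whenever $s_i=s_{i+1}$ or $t_j=t_{j+1}$ for some $i$ or $j$. Increments are considered on ordered tuples $s_1\le s_2\le\cdots$, $t_1\le t_2\le\cdots$. The operator $\delta_1:\mathcal P_{k,l}\to\mathcal P_{k+1,l}$ acts on the $s$-variables: for $k=1$, $\delta_1f_{s_1s_2}=f_{s_2}-f_{s_1}$; for $k=2$, $\delta_1f_{s_1s_2s_3}=f_{s_1s_3}-f_{s_1s_2}-f_{s_2s_3}$. $\delta_2$ is the same operator on the $t$-variables, and $\delta=\delta_1\delta_2$; for $f\in\mathcal P_{1,1}$, $\delta f_{s_1s_2;t_1t_2}=f_{s_2;t_2}-f_{s_1;t_2}-f_{s_2;t_1}+f_{s_1;t_1}$. **Norms.** For $k,l\in\{2,3\}$, $f\in\mathcal P_{k,l}$: $\|f\|_{a;b}=\sup |f_{s_1\cdots s_k;t_1\cdots t_l}|/(|s_k-s_1|^a|t_l-t_1|^b)$,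 sup over strictly ordered tuples; $\mathcal P_{k,l}^{a,b}=\{f\in\mathcal P_{k,l}:\|f\|_{a;b}<\infty\}$. An exponent $*$ means that some exponent in $(0,1)$ works. For $f\in\mathcal P_{1,1}$, $\|f\|_{a,b}=\|\delta f\|_{a;b}+\sup_{t,\,s_1<s_2}\frac{|\delta_1f_{s_1s_2;t}|}{|s_2-s_1|^a}+\sup_{s,\,t_1<t_2}\frac{|\delta_2f_{s;t_1t_2}|}{|t_2-t_1|^b}$, and $\mathcal P_{1,1}^{a,b}=\{f\in\mathcal P_{1,1}:\|f\|_{a,b}<\infty\}$. **Products.** For $g\in\mathcal P_{n_1,n_2}$, $h\in\mathcal P_{m_1,m_2}$, $gh\in\mathcal P_{n_1+m_1-1,n_2+m_2-1}$ is $(gh)_{s_1\cdots;t_1\cdots}=g_{s_1\cdots s_{n_1};t_1\cdots t_{n_2}}\,h_{s_{n_1}\cdots s_{n_1+m_1-1};t_{n_2}\cdots t_{n_2+m_2-1}}$. E.g. $(y^{(1)}\mathbf x^{1;2})_{s_1s_2;t_1t_2}=y^{(1)}_{s_1;t_1}\mathbf x^{1;2}_{s_1s_2;t_1t_2}$. **Sewing maps.** In one variable, if $h_{sut}$ lies in the kernel of the one-parameter coboundary operator and $|h_{sut}|\le C|t-s|^\mu$ with $\mu>1$, then there is a unique $\Lambda h$ with $|(\Lambda h)_{st}|\le C'|t-s|^\mu$ and $(\Lambda h)_{st}-(\Lambda h)_{su}-(\Lambda h)_{ut}=h_{sut}$. $\Lambda_1$ (resp. $\Lambda_2$) is this map applied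 in the $s$-variables (resp. $t$-variables) with the other variables frozen, and $\Lambda=\Lambda_1\Lambda_2$. For $g\in\mathcal P_{2,2}$, the increment $[\mathrm{id}-\Lambda_1\delta_1][\mathrm{id}-\Lambda_2\delta_2]g=g-\Lambda_1\delta_1g-\Lambda_2\delta_2g+\Lambda\delta g$ is well defined as soon as $\delta_1g\in\mathcal P_{3,2}^{a,*}$, $\delta_2g\in\mathcal P_{2,3}^{*,b}$, $\delta g\in\mathcal P_{3,3}^{a,b}$ for some $a,b>1$. **Geometric rough sheet.** For smooth $x$ write $\partial_1x,\partial_2x,\partial_{12}x$ for its partial derivatives and define, for $s_1<s_2$, $t_1<t_2(<t_3)$ (with required regularity in brackets): - $\mathbf x^{1;0}=\delta_1x$ $[(\gamma_1,0)]$; $\mathbf x^{0;2}=\delta_2x$ $[(0,\gamma_2)]$; $\mathbf x^{11;00}=\frac12(\delta_1x)^2$ $[(2\gamma_1,0)]$; $\mathbf x^{00;22}=\frac12(\delta_2x)^2$ $[(0,2\gamma_2)]$; $\mathbf x^{1;2}=\delta x$ $[(\gamma_1,\gamma_2)]$; $\mathbf x^{\hat1;\hat2}_{s_1s_2;t_1t_2}=\int_{s_1}^{s_2}\int_{t_1}^{t_2}\partial_1x_{\sigma;\tau}\partial_2x_{\sigma;\tau}\,d\tau d\sigma$ $[(\gamma_1,\gamma_2)]$. - Writing $D^{12}x=\partial_{12}x$ and $D^{\hat1\hat2}x=\partial_1x\,\partial_2x$, for $(i,j)=(1,2)$ and $(i,j)=(\hat1,\hat2)$: $\mathbf x^{1i;0j}_{s_1s_2;t_1t_2}=\int_{s_1}^{s_2}\int_{t_1}^{t_2}\delta_1x_{s_1\sigma;\tau}\,D^{ij}x_{\sigma;\tau}\,d\tau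 d\sigma$ $[(2\gamma_1,\gamma_2)]$; $\mathbf x^{1i;0\cdot j}_{s_1s_2;t_1t_2}=\int_{s_1}^{s_2}\int_{t_1}^{t_2}\delta_1x_{s_1\sigma;t_1}\,D^{ij}x_{\sigma;\tau}\,d\tau d\sigma$ $[(2\gamma_1,\gamma_2)]$; $\mathbf x^{1i;2j}_{s_1s_2;t_1t_2}=\int_{s_1}^{s_2}\int_{t_1}^{t_2}\delta x_{s_1\sigma;t_1\tau}\,D^{ij}x_{\sigma;\tau}\,d\tau d\sigma$ $[(2\gamma_1,2\gamma_2)]$; $\mathbf x^{1i;2\cdot j}_{s_1s_2;t_1t_2t_3}=\int_{s_1}^{s_2}\int_{t_2}^{t_3}\delta x_{s_1\sigma;t_1t_2}\,D^{ij}x_{\sigma;\tau}\,d\tau d\sigma$ $[(2\gamma_1,2\gamma_2)$, an element of $\mathcal P_{2,3}]$. A field $x\in\mathcal P_{1,1}^{\gamma_1,\gamma_2}$ admits a geometric rough sheet $\mathbb X$ if there are smooth $x^n$ with $\|x-x^n\|_{\gamma_1,\gamma_2}\to0$ such that the increments $\mathbf x^{1;0}$, $\mathbf x^{0;2}$, $\mathbf x^{11;00}$, $\mathbf x^{00;22}$, $\mathbf x^{1;2}$, $\mathbf x^{\hat1;\hat2}$ and, for both $(i,j)=(1,2)$ and $(i,j)=(\hat1,\hat2)$, $\mathbf x^{1i;0j}$, $\mathbf x^{1i;0\cdot j}$, $\mathbf x^{1i;2j}$, $\mathbf x^{1i;2\cdot j}$, all built from $x^n$ in place of $x$, converge, each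 in the Hölder norm of its indicated regularity (an exponent $0$ meaning a supremum over the corresponding single variable); $\mathbb X$ is the collection of the limits, denoted by the same symbols. *)

theory Defs
  imports "HOL-Analysis.Analysis"
begin

section \<open>Increments\<close>

text \<open>
  A tuple of time points is a list, so that \<open>f\<close> with \<open>k\<close> variables in the first and \<open>l\<close> variables
  in the second direction is written \<open>f [s1, \<dots>, sk] [t1, \<dots>, tl]\<close>.  The numbers \<open>k\<close>, \<open>l\<close> are
  passed explicitly wherever they matter.  Values outside the ordered tuples in \<open>[0, T]\<close> are irrelevant.
\<close>

type_synonym incr = "real list \<Rightarrow> real list \<Rightarrow> real"

definition ordered_tuples :: "real \<Rightarrow> nat \<Rightarrow> real list set" where
  "ordered_tuples T k = {s. length s = k \<and> sorted_wrt (\<le>) s \<and> set s \<subseteq> {0..T}}"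

definition strict_tuples :: "real \<Rightarrow> nat \<Rightarrow> real list set" where
  "strict_tuples T k = {s. length s = k \<and> sorted_wrt (<) s \<and> set s \<subseteq> {0..T}}"

text \<open>
  Lists carry no topology: continuity in \<open>(s\<^sub>1,\<dots>,s\<^sub>k;t\<^sub>1,\<dots>,t\<^sub>l)\<close> is continuity in the first \<open>k\<close>,
  respectively \<open>l\<close>, coordinates of a pair of sequences, for the product topology on \<open>nat \<Rightarrow> real\<close>.
\<close>

definition incr_space :: "real \<Rightarrow> nat \<Rightarrow> nat \<Rightarrow> incr set" where
  "incr_space T k l = {f.
     continuous_on
       {p :: (nat \<Rightarrow> real) \<times> (nat \<Rightarrow> real).
          map (fst p) [0..<k] \<in> ordered_tuples T k \<and> map (snd p) [0..<l] \<in> ordered_tuples T l}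
       (\<lambda>p. f (map (fst p) [0..<k]) (map (snd p) [0..<l])) \<and>
     (\<forall>s\<in>ordered_tuples T k. \<forall>t\<in>ordered_tuples T l.
        (\<exists>i. Suc i < k \<and> s ! i = s ! Suc i) \<or> (\<exists>j. Suc j < l \<and> t ! j = t ! Suc j) \<longrightarrow> f s t = 0)}"

fun delta1 :: "incr \<Rightarrow> incr" where
  "delta1 f [s1, s2] t = f [s2] t - f [s1] t"
| "delta1 f [s1, s2, s3] t = f [s1, s3] t - f [s1, s2] t - f [s2, s3] t"
| "delta1 f _ t = 0"

definition delta2 :: "incr \<Rightarrow> incr" where
  "delta2 f s t = delta1 (\<lambda>t s. f s t) t s"

definition delta :: "incr \<Rightarrow> incr" where
  "delta f = delta1 (delta2 f)"

text \<open>Product \<open>g h\<close> for \<open>g\<close> with \<open>n1\<close> and \<open>n2\<close> variables: the last variables of \<open>g\<close> are shared with \<open>h\<close>.\<close>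

definition incr_mult :: "nat \<Rightarrow> nat \<Rightarrow> incr \<Rightarrow> incr \<Rightarrow> incr" where
  "incr_mult n1 n2 g h s t = g (take n1 s) (take n2 t) * h (drop (n1 - 1) s) (drop (n2 - 1) t)"

section \<open>Hoelder norms\<close>

text \<open>
  The norms take values in \<open>[0, \<infinity>]\<close>.  For a direction with a single variable (where the exponent is
  always \<open>0\<close>) the weight is \<open>1\<close>, i.e. one takes a plain supremum; note that \<open>0 powr 0 = 0\<close>.
\<close>

definition holder_weight :: "real \<Rightarrow> real list \<Rightarrow> real" where
  "holder_weight a s = (if length s = 1 then 1 else \<bar>last s - hd s\<bar> powr a)"

definition holder_norm :: "real \<Rightarrow> nat \<Rightarrow> nat \<Rightarrow> real \<Rightarrow> real \<Rightarrow> incr \<Rightarrow> ennreal" where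
  "holder_norm T k l a b f =
     (SUP (s, t) \<in> strict_tuples T k \<times> strict_tuples T l.
        ennreal (\<bar>f s t\<bar> / (holder_weight a s * holder_weight b t)))"

definition holder_space :: "real \<Rightarrow> nat \<Rightarrow> nat \<Rightarrow> real \<Rightarrow> real \<Rightarrow> incr set" where
  "holder_space T k l a b = {f \<in> incr_space T k l. holder_norm T k l a b f < \<infinity>}"

definition field_norm :: "real \<Rightarrow> real \<Rightarrow> real \<Rightarrow> incr \<Rightarrow> ennreal" where
  "field_norm T a b f =
     holder_norm T 2 2 a b (delta f) + holder_norm T 2 1 a 0 (delta1 f) + holder_norm T 1 2 0 b (delta2 f)"

definition field_space :: "real \<Rightarrow> real \<Rightarrow> real \<Rightarrow> incr set" where
  "field_space T a b = {f \<in> incr_space T 1 1. field_norm T a b f < \<infinity>}"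

definition holder_tendsto ::
  "real \<Rightarrow> nat \<Rightarrow> nat \<Rightarrow> real \<Rightarrow> real \<Rightarrow> (nat \<Rightarrow> incr) \<Rightarrow> incr \<Rightarrow> bool" where
  "holder_tendsto T k l a b F f \<longleftrightarrow>
     f \<in> holder_space T k l a b \<and>
     (\<lambda>n. holder_norm T k l a b (\<lambda>s t. F n s t - f s t)) \<longlonglongrightarrow> 0"

section \<open>Sewing maps\<close>

text \<open>
  \<open>sew T h\<close> is the unique \<open>g\<close> with coboundary \<open>h\<close> and \<open>|g\<^sub>s\<^sub>t| \<le> C |t - s|\<^sup>\<mu>\<close> for some \<open>\<mu> > 1\<close>.  The exponent
  need not be fixed: two candidates with exponents \<open>\<mu>\<close> and \<open>\<mu>'\<close> differ by an additive function
  of order \<open>min \<mu> \<mu>' > 1\<close>, which vanishes.  Candidates are extended by zero off \<open>0 \<le> s \<le> t \<le> T\<close>.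
\<close>

definition sew :: "real \<Rightarrow> (real \<Rightarrow> real \<Rightarrow> real \<Rightarrow> real) \<Rightarrow> real \<Rightarrow> real \<Rightarrow> real" where
  "sew T h = (THE g.
     (\<exists>\<mu>>1. \<exists>C. \<forall>s t. 0 \<le> s \<and> s \<le> t \<and> t \<le> T \<longrightarrow> \<bar>g s t\<bar> \<le> C * \<bar>t - s\<bar> powr \<mu>) \<and>
     (\<forall>s u t. 0 \<le> s \<and> s \<le> u \<and> u \<le> t \<and> t \<le> T \<longrightarrow> g s t - g s u - g u t = h s u t) \<and>
     (\<forall>s t. \<not> (0 \<le> s \<and> s \<le> t \<and> t \<le> T) \<longrightarrow> g s t = 0))"

definition Lambda1 :: "real \<Rightarrow> incr \<Rightarrow> incr" where
  "Lambda1 T h s t = sew T (\<lambda>s1 s2 s3. h [s1, s2, s3] t) (s ! 0) (s ! 1)"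

definition Lambda2 :: "real \<Rightarrow> incr \<Rightarrow> incr" where
  "Lambda2 T h s t = sew T (\<lambda>t1 t2 t3. h s [t1, t2, t3]) (t ! 0) (t ! 1)"

definition Lambda :: "real \<Rightarrow> incr \<Rightarrow> incr" where
  "Lambda T h = Lambda1 T (Lambda2 T h)"

text \<open>The increment \<open>[id - \<Lambda>\<^sub>1 \<delta>\<^sub>1] [id - \<Lambda>\<^sub>2 \<delta>\<^sub>2] g\<close> and the condition under which it is well defined.\<close>

definition rough_integral :: "real \<Rightarrow> incr \<Rightarrow> incr" where
  "rough_integral T g s t =
     g s t - Lambda1 T (delta1 g) s t - Lambda2 T (delta2 g) s t + Lambda T (delta g) s t"

definition rough_integrable :: "real \<Rightarrow> incr \<Rightarrow> bool" where
  "rough_integrable T g \<longleftrightarrow>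
     g \<in> incr_space T 2 2 \<and>
     (\<exists>a>1. \<exists>b>1.
        (\<exists>c. 0 < c \<and> c < 1 \<and> delta1 g \<in> holder_space T 3 2 a c) \<and>
        (\<exists>c. 0 < c \<and> c < 1 \<and> delta2 g \<in> holder_space T 2 3 c b) \<and>
        delta g \<in> holder_space T 3 3 a b)"

section \<open>Geometric rough sheets\<close>

text \<open>
  Smoothness on the closed square \<open>[0, T]\<^sup>2\<close>, with one-sided derivatives at the boundary:
  \<open>D i j\<close> is the partial derivative of order \<open>i\<close> in the first and \<open>j\<close> in the second variable.
\<close>

definition smooth_field :: "real \<Rightarrow> incr \<Rightarrow> bool" where
  "smooth_field T f \<longleftrightarrow>
     (\<exists>D :: nat \<Rightarrow> nat \<Rightarrow> real \<Rightarrow> real \<Rightarrow> real.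
        (\<forall>s\<in>{0..T}. \<forall>t\<in>{0..T}. D 0 0 s t = f [s] [t]) \<and>
        (\<forall>i j. continuous_on ({0..T} \<times> {0..T}) (\<lambda>(s, t). D i j s t)) \<and>
        (\<forall>i j. \<forall>s\<in>{0..T}. \<forall>t\<in>{0..T}.
           ((\<lambda>\<sigma>. D i j \<sigma> t) has_real_derivative D (Suc i) j s t) (at s within {0..T}) \<and>
           ((\<lambda>\<tau>. D i j s \<tau>) has_real_derivative D i (Suc j) s t) (at t within {0..T})))"

definition partial1 :: "real \<Rightarrow> incr \<Rightarrow> incr" where
  "partial1 T f s t = vector_derivative (\<lambda>\<sigma>. f [\<sigma>] t) (at (hd s) within {0..T})"

definition partial2 :: "real \<Rightarrow> incr \<Rightarrow> incr" where
  "partial2 T f s t = vector_derivative (\<lambda>\<tau>. f s [\<tau>]) (at (hd t) within {0..T})"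

definition D12 :: "real \<Rightarrow> incr \<Rightarrow> incr" where
  "D12 T x = partial1 T (partial2 T x)"

definition Dhat12 :: "real \<Rightarrow> incr \<Rightarrow> incr" where
  "Dhat12 T x s t = partial1 T x s t * partial2 T x s t"

text \<open>
  The components \<open>x\<^sup>1\<^sup>i\<^sup>;\<^sup>0\<^sup>j\<close>, \<open>x\<^sup>1\<^sup>i\<^sup>;\<^sup>0\<^sup>\<cdot>\<^sup>j\<close>, \<open>x\<^sup>1\<^sup>i\<^sup>;\<^sup>2\<^sup>j\<close>, \<open>x\<^sup>1\<^sup>i\<^sup>;\<^sup>2\<^sup>\<cdot>\<^sup>j\<close> over a smooth \<open>x\<close>, where \<open>d\<close> stands
  for \<open>D\<^sup>i\<^sup>jx\<close>.
\<close>

definition lift_0 :: "incr \<Rightarrow> incr \<Rightarrow> incr" where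
  "lift_0 x d s t =
     integral {s ! 0..s ! 1} (\<lambda>\<sigma>. integral {t ! 0..t ! 1} (\<lambda>\<tau>.
       delta1 x [s ! 0, \<sigma>] [\<tau>] * d [\<sigma>] [\<tau>]))"

definition lift_0dot :: "incr \<Rightarrow> incr \<Rightarrow> incr" where
  "lift_0dot x d s t =
     integral {s ! 0..s ! 1} (\<lambda>\<sigma>. integral {t ! 0..t ! 1} (\<lambda>\<tau>.
       delta1 x [s ! 0, \<sigma>] [t ! 0] * d [\<sigma>] [\<tau>]))"

definition lift_2 :: "incr \<Rightarrow> incr \<Rightarrow> incr" where
  "lift_2 x d s t =
     integral {s ! 0..s ! 1} (\<lambda>\<sigma>. integral {t ! 0..t ! 1} (\<lambda>\<tau>.
       delta x [s ! 0, \<sigma>] [t ! 0, \<tau>] * d [\<sigma>] [\<tau>]))"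

definition lift_2dot :: "incr \<Rightarrow> incr \<Rightarrow> incr" where
  "lift_2dot x d s t =
     integral {s ! 0..s ! 1} (\<lambda>\<sigma>. integral {t ! 1..t ! 2} (\<lambda>\<tau>.
       delta x [s ! 0, \<sigma>] [t ! 0, t ! 1] * d [\<sigma>] [\<tau>]))"

text \<open>
  In the field names \<open>h\<close> marks a hat on the following digit and \<open>d\<close> stands for the dot, e.g.
  \<open>x_1h1_0dh2\<close> is \<open>x\<close> with superscript \<open>1 hat-1; 0 . hat-2\<close>.
\<close>

record rough_sheet =
  x_1_0 :: incr
  x_0_2 :: incr
  x_11_00 :: incr
  x_00_22 :: incr
  x_1_2 :: incr
  x_h1_h2 :: incr
  x_11_02 :: incr
  x_11_0d2 :: incr
  x_11_22 :: incr
  x_11_2d2 :: incr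
  x_1h1_0h2 :: incr
  x_1h1_0dh2 :: incr
  x_1h1_2h2 :: incr
  x_1h1_2dh2 :: incr

definition smooth_lift :: "real \<Rightarrow> incr \<Rightarrow> rough_sheet" where
  "smooth_lift T x = \<lparr>
     x_1_0 = delta1 x,
     x_0_2 = delta2 x,
     x_11_00 = (\<lambda>s t. 1 / 2 * (delta1 x s t)\<^sup>2),
     x_00_22 = (\<lambda>s t. 1 / 2 * (delta2 x s t)\<^sup>2),
     x_1_2 = delta x,
     x_h1_h2 = (\<lambda>s t. integral {s ! 0..s ! 1} (\<lambda>\<sigma>. integral {t ! 0..t ! 1} (\<lambda>\<tau>.
                  partial1 T x [\<sigma>] [\<tau>] * partial2 T x [\<sigma>] [\<tau>]))),
     x_11_02 = lift_0 x (D12 T x),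
     x_11_0d2 = lift_0dot x (D12 T x),
     x_11_22 = lift_2 x (D12 T x),
     x_11_2d2 = lift_2dot x (D12 T x),
     x_1h1_0h2 = lift_0 x (Dhat12 T x),
     x_1h1_0dh2 = lift_0dot x (Dhat12 T x),
     x_1h1_2h2 = lift_2 x (Dhat12 T x),
     x_1h1_2dh2 = lift_2dot x (Dhat12 T x)\<rparr>"

definition sheet_tendsto ::
  "real \<Rightarrow> real \<Rightarrow> real \<Rightarrow> (nat \<Rightarrow> rough_sheet) \<Rightarrow> rough_sheet \<Rightarrow> bool" where
  "sheet_tendsto T \<gamma>1 \<gamma>2 Z X \<longleftrightarrow>
     holder_tendsto T 2 1 \<gamma>1 0 (\<lambda>n. x_1_0 (Z n)) (x_1_0 X) \<and>
     holder_tendsto T 1 2 0 \<gamma>2 (\<lambda>n. x_0_2 (Z n)) (x_0_2 X) \<and>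
     holder_tendsto T 2 1 (2 * \<gamma>1) 0 (\<lambda>n. x_11_00 (Z n)) (x_11_00 X) \<and>
     holder_tendsto T 1 2 0 (2 * \<gamma>2) (\<lambda>n. x_00_22 (Z n)) (x_00_22 X) \<and>
     holder_tendsto T 2 2 \<gamma>1 \<gamma>2 (\<lambda>n. x_1_2 (Z n)) (x_1_2 X) \<and>
     holder_tendsto T 2 2 \<gamma>1 \<gamma>2 (\<lambda>n. x_h1_h2 (Z n)) (x_h1_h2 X) \<and>
     holder_tendsto T 2 2 (2 * \<gamma>1) \<gamma>2 (\<lambda>n. x_11_02 (Z n)) (x_11_02 X) \<and>
     holder_tendsto T 2 2 (2 * \<gamma>1) \<gamma>2 (\<lambda>n. x_11_0d2 (Z n)) (x_11_0d2 X) \<and>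
     holder_tendsto T 2 2 (2 * \<gamma>1) (2 * \<gamma>2) (\<lambda>n. x_11_22 (Z n)) (x_11_22 X) \<and>
     holder_tendsto T 2 3 (2 * \<gamma>1) (2 * \<gamma>2) (\<lambda>n. x_11_2d2 (Z n)) (x_11_2d2 X) \<and>
     holder_tendsto T 2 2 (2 * \<gamma>1) \<gamma>2 (\<lambda>n. x_1h1_0h2 (Z n)) (x_1h1_0h2 X) \<and>
     holder_tendsto T 2 2 (2 * \<gamma>1) \<gamma>2 (\<lambda>n. x_1h1_0dh2 (Z n)) (x_1h1_0dh2 X) \<and>
     holder_tendsto T 2 2 (2 * \<gamma>1) (2 * \<gamma>2) (\<lambda>n. x_1h1_2h2 (Z n)) (x_1h1_2h2 X) \<and>
     holder_tendsto T 2 3 (2 * \<gamma>1) (2 * \<gamma>2) (\<lambda>n. x_1h1_2dh2 (Z n)) (x_1h1_2dh2 X)"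

definition geometric_rough_sheet :: "real \<Rightarrow> real \<Rightarrow> real \<Rightarrow> incr \<Rightarrow> rough_sheet \<Rightarrow> bool" where
  "geometric_rough_sheet T \<gamma>1 \<gamma>2 x X \<longleftrightarrow>
     (\<exists>xn :: nat \<Rightarrow> incr.
        (\<forall>n. smooth_field T (xn n)) \<and>
        (\<lambda>n. field_norm T \<gamma>1 \<gamma>2 (\<lambda>s t. x s t - xn n s t)) \<longlonglongrightarrow> 0 \<and>
        sheet_tendsto T \<gamma>1 \<gamma>2 (\<lambda>n. smooth_lift T (xn n)) X)"

section \<open>Test functions and partitions\<close>

definition Cb :: "nat \<Rightarrow> (real \<Rightarrow> real) \<Rightarrow> bool" where
  "Cb m \<phi> \<longleftrightarrow>
     (\<forall>i<m. \<forall>u. (deriv ^^ i) \<phi> field_differentiable at u) \<and>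
     (\<forall>i\<le>m. continuous_on UNIV ((deriv ^^ i) \<phi>) \<and> bounded (range ((deriv ^^ i) \<phi>)))"

definition is_partition :: "real \<Rightarrow> real \<Rightarrow> real list \<Rightarrow> bool" where
  "is_partition a b p \<longleftrightarrow> p \<noteq> [] \<and> sorted_wrt (<) p \<and> hd p = a \<and> last p = b"

definition mesh :: "real list \<Rightarrow> real" where
  "mesh p = Max ((\<lambda>i. p ! Suc i - p ! i) ` {..<length p - 1})"

end

theory Submission
  imports Defs
begin

text \<open>
  Both integrals of the theorem have the form \<open>[id - \<Lambda>\<^sub>1 \<delta>\<^sub>1] [id - \<Lambda>\<^sub>2 \<delta>\<^sub>2] g\<close> with
  \<open>g = \<psi>(x) w + \<psi>'(x) z\<close>.  For the first, \<open>\<psi> = \<phi>'\<close>, and \<open>w\<close>, \<open>z\<close> are \<open>\<integral>\<integral> d\<^sub>1\<^sub>2x\<close> and \<open>\<integral>\<integral> \<delta>\<^sub>1x d\<^sub>1\<^sub>2x\<close>; for the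
  second, \<open>\<psi> = \<phi>''\<close> and \<open>\<partial>\<^sub>1x \<partial>\<^sub>2x\<close> takes the place of \<open>\<partial>\<^sub>1\<^sub>2x\<close>.  They are treated together in the locale
  \<open>sheet_component\<close>, which records the additivity of \<open>w\<close>, the relations \<open>\<delta>\<^sub>1 z = \<delta>\<^sub>1x w\<close> and \<open>\<delta>\<^sub>2 z = - v\<close>,
  and Hoelder bounds with one constant \<open>M\<close>.

  The relations and Taylor expansion show that \<open>\<delta>\<^sub>1 g\<close>, \<open>\<delta>\<^sub>2 g\<close> and \<open>\<delta> g\<close> are of order \<open>3 \<gamma>1 > 1\<close> in \<open>s\<close>,
  of order \<open>2 \<gamma>2 > 1\<close> in \<open>t\<close>, and of both orders, respectively, with constants that depend on \<open>M\<close> and \<open>T\<close> only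
  (\<open>integrand_delta1_bound\<close> and its companions).  A two-parameter form of the sewing lemma,
  \<open>riemann_sum_rough_integral\<close>, then bounds the distance of any Riemann sum of \<open>g\<close> from its rough integral
  by these constants times powers of the meshes.  It rests on the one-parameter lemma \<open>sewing\<close> and on
  the fact that sewing in one direction commutes with the coboundary in the other.

  For a smooth field the rough integrals are ordinary integrals, and their sum is \<open>\<delta> \<phi>(x)\<close> by the
  chain rule (\<open>smooth_rough_decomposition\<close>).  Hence \<open>\<delta> \<phi>(x\<^sub>n)\<close> differs from the Riemann sums over
  \<open>x\<^sub>n\<close> by an error that is small with the meshes, uniformly in \<open>n\<close>.  For fixed partitions the sums converge
  as \<open>n \<rightarrow> \<infinity>\<close>, so the same error bound holds for \<open>x\<close> itself (\<open>rough_riemann_sum_estimate\<close>).  This is the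
  second claim, and comparison with the Riemann sums of the two rough integrals yields the first.
\<close>

section \<open>The one-parameter sewing lemma\<close>

text \<open>The constant of the sewing bound: the fixed point of \<open>C \<mapsto> 2\<^bsup>1 - \<mu>\<^esup> C + 2\<close>.\<close>
definition sew_const :: "real \<Rightarrow> real" where
  "sew_const \<mu> = 2 / (1 - 2 powr (1 - \<mu>))"

lemma sew_const_denominator:
  fixes \<mu> :: real
  assumes "\<mu> > 1"
  shows "1 - 2 powr (1 - \<mu>) > 0"
proof -
  have "2 powr (1 - \<mu>) < 2 powr (0::real)"
    using assms by (intro powr_less_mono) auto
  then show ?thesis by simp
qed

lemma sew_const_fixpoint:
  assumes "\<mu> > 1"
  shows "sew_const \<mu> * 2 powr (1 - \<mu>) + 2 = sew_const \<mu>"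
proof -
  have "2 / (1 - r) * r + 2 = 2 / (1 - r)" if "1 - r > 0" for r :: real
    using that by (simp add: divide_simps)
  from this[OF sew_const_denominator[OF assms]] show ?thesis by (simp add: sew_const_def)
qed

lemma sew_const_pos:
  assumes "\<mu> > 1"
  shows "sew_const \<mu> > 0"
  using sew_const_denominator[OF assms] by (simp add: sew_const_def)

lemma almost_additive_diag:
  fixes F :: "real \<Rightarrow> real \<Rightarrow> real"
  assumes "\<And>s u t. \<lbrakk>a \<le> s; s \<le> u; u \<le> t; t \<le> b\<rbrakk> \<Longrightarrow>
      \<bar>F s t - F s u - F u t\<bar> \<le> K * (t - s) powr \<mu>"
    and "a \<le> s" "s \<le> b"
  shows "F s s = 0"
  using assms(1)[of s s s] assms(2,3) by auto

lemma crossing_index: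
  fixes p :: "nat \<Rightarrow> real"
  assumes "i < j" "p i \<le> c" "c \<le> p j"
  shows "\<exists>k. i \<le> k \<and> k < j \<and> p k \<le> c \<and> c \<le> p (Suc k)"
  using assms
proof (induction j)
  case (Suc j)
  show ?case
  proof (cases "i < j \<and> c \<le> p j")
    case True
    then show ?thesis using Suc by (metis less_SucI)
  next
    case False
    then show ?thesis using Suc.prems by (metis less_Suc_eq less_Suc_eq_le nle_le)
  qed
qed simp

lemma mono_chain:
  fixes p :: "nat \<Rightarrow> real"
  assumes "\<And>k. k < n \<Longrightarrow> p k \<le> p (Suc k)" "i \<le> j" "j \<le> n"
  shows "p i \<le> p j"
  using assms(2,3)
proof (induction j rule: dec_induct)
  case (step j)
  then show ?case using assms(1)[of j] by fastforce
qed simp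

lemma cell_range:
  fixes p :: "nat \<Rightarrow> real"
  assumes p: "\<And>k. k < n \<Longrightarrow> p k \<le> p (Suc k)" "a \<le> p 0" "p n \<le> b"
  shows "i < n \<Longrightarrow> a \<le> p i" "i < n \<Longrightarrow> p i \<le> p (Suc i)" "i < n \<Longrightarrow> p (Suc i) \<le> b" "p 0 \<le> p n"
  using mono_chain[of n p 0 i, OF p(1)] mono_chain[of n p "Suc i" n, OF p(1)] mono_chain[of n p 0 n, OF p(1)] p
  by auto

text \<open>
  Bisection: cut a partition at the cell that contains the midpoint.  Both remaining parts have at
  most half the length, so that the bound reproduces itself because \<open>\<mu> > 1\<close>.
\<close>
lemma partition_sum_bound:
  fixes F :: "real \<Rightarrow> real \<Rightarrow> real" and p :: "nat \<Rightarrow> real"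
  assumes \<mu>: "\<mu> > 1" and K: "K \<ge> 0"
    and F: "\<And>s u t. \<lbrakk>a \<le> s; s \<le> u; u \<le> t; t \<le> b\<rbrakk> \<Longrightarrow>
      \<bar>F s t - F s u - F u t\<bar> \<le> K * (t - s) powr \<mu>"
    and p: "\<And>k. k < n \<Longrightarrow> p k \<le> p (Suc k)" and a: "a \<le> p 0" and b: "p n \<le> b"
    and ij: "i \<le> j" "j \<le> n"
  shows "\<bar>F (p i) (p j) - (\<Sum>k=i..<j. F (p k) (p (Suc k)))\<bar> \<le> sew_const \<mu> * K * (p j - p i) powr \<mu>"
  using ij
proof (induction "j - i" arbitrary: i j rule: less_induct)
  case less
  have pm: "p k \<le> p l" if "k \<le> l" "l \<le> n" for k l
    using mono_chain[of n p, OF p that] .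
  have rng: "a \<le> p k" "p k \<le> b" if "k \<le> n" for k
    using pm[of 0 k] pm[of k n] a b that by auto
  show ?case
  proof (cases "i = j")
    case True
    then show ?thesis using almost_additive_diag[of a b F K \<mu>, OF F] rng less.prems by simp
  next
    case False
    then have "i < j" using less.prems by simp
    define L where "L = p j - p i"
    have L0: "L \<ge> 0" using pm[of i j] less.prems by (simp add: L_def)
    obtain k where k: "i \<le> k" "k < j" "p k \<le> p i + L / 2" "p i + L / 2 \<le> p (Suc k)"
      using crossing_index[of i j p "p i + L / 2"] \<open>i < j\<close> L0 by (auto simp: L_def field_simps)
    have le: "p i \<le> p k" "p k \<le> p (Suc k)" "p (Suc k) \<le> p j" "Suc k \<le> n" "k \<le> n" "i \<le> n"
      using pm k less.prems by auto
    have halves: "(p k - p i) powr \<mu> \<le> (L / 2) powr \<mu>" "(p j - p (Suc k)) powr \<mu> \<le> (L / 2) powr \<mu>"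
      using k le \<mu> by (auto intro!: powr_mono2 simp: L_def field_simps)
    have C0: "sew_const \<mu> * K \<ge> 0" using sew_const_pos[OF \<mu>] K by simp
    have I1: "\<bar>F (p i) (p k) - (\<Sum>l=i..<k. F (p l) (p (Suc l)))\<bar> \<le> sew_const \<mu> * K * (L / 2) powr \<mu>"
      by (rule order_trans[OF less.hyps mult_left_mono[OF halves(1) C0]]) (use k less.prems in auto)
    have I2: "\<bar>F (p (Suc k)) (p j) - (\<Sum>l=Suc k..<j. F (p l) (p (Suc l)))\<bar> \<le> sew_const \<mu> * K * (L / 2) powr \<mu>"
      by (rule order_trans[OF less.hyps mult_left_mono[OF halves(2) C0]]) (use k less.prems in auto)
    have D1: "\<bar>F (p i) (p j) - F (p i) (p (Suc k)) - F (p (Suc k)) (p j)\<bar> \<le> K * L powr \<mu>"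
      unfolding L_def by (intro F) (use rng le less.prems in auto)
    have "\<bar>F (p i) (p (Suc k)) - F (p i) (p k) - F (p k) (p (Suc k))\<bar> \<le> K * (p (Suc k) - p i) powr \<mu>"
      by (intro F) (use rng le less.prems in auto)
    also have "\<dots> \<le> K * L powr \<mu>"
      using le K \<mu> by (intro mult_left_mono powr_mono2) (auto simp: L_def)
    finally have D2: "\<bar>F (p i) (p (Suc k)) - F (p i) (p k) - F (p k) (p (Suc k))\<bar> \<le> K * L powr \<mu>" .
    have split: "(\<Sum>l=i..<j. F (p l) (p (Suc l))) = (\<Sum>l=i..<k. F (p l) (p (Suc l))) + F (p k) (p (Suc k))
        + (\<Sum>l=Suc k..<j. F (p l) (p (Suc l)))"
      using sum.atLeastLessThan_concat[of i k j "\<lambda>l. F (p l) (p (Suc l))"] k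
        sum.atLeast_Suc_lessThan[of k j "\<lambda>l. F (p l) (p (Suc l))"] by simp
    have half: "(L / 2) powr \<mu> * 2 = L powr \<mu> * 2 powr (1 - \<mu>)"
      using L0 by (simp add: powr_divide powr_diff)
    have "\<bar>F (p i) (p j) - (\<Sum>k=i..<j. F (p k) (p (Suc k)))\<bar>
        \<le> sew_const \<mu> * K * (L / 2) powr \<mu> + sew_const \<mu> * K * (L / 2) powr \<mu> + K * L powr \<mu> + K * L powr \<mu>"
      using I1 I2 D1 D2 unfolding split by linarith
    also have "\<dots> = K * (sew_const \<mu> * ((L / 2) powr \<mu> * 2) + 2 * L powr \<mu>)" by (simp add: algebra_simps)
    also have "\<dots> = K * L powr \<mu> * (sew_const \<mu> * 2 powr (1 - \<mu>) + 2)"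
      unfolding half by (simp add: algebra_simps)
    finally show ?thesis unfolding sew_const_fixpoint[OF \<mu>] by (simp add: L_def mult_ac)
  qed
qed

lemma sum_lessThan_double:
  fixes f :: "nat \<Rightarrow> real"
  shows "(\<Sum>i<2 * m. f i) = (\<Sum>i<m. f (2 * i) + f (Suc (2 * i)))"
  by (induction m) auto

text \<open>
  The increments of the limit \<open>A\<close> of the Riemann sums along the dyadic points of \<open>[0, T]\<close>, cut off
  at \<open>t\<close>, are the additive function close to \<open>F\<close>.
\<close>
lemma sewing:
  fixes F :: "real \<Rightarrow> real \<Rightarrow> real"
  assumes \<mu>: "\<mu> > 1" and K: "K \<ge> 0" and T: "T \<ge> 0"
    and F: "\<And>s u t. \<lbrakk>0 \<le> s; s \<le> u; u \<le> t; t \<le> T\<rbrakk> \<Longrightarrow>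
      \<bar>F s t - F s u - F u t\<bar> \<le> K * (t - s) powr \<mu>"
  shows "\<exists>A. \<forall>s t. 0 \<le> s \<and> s \<le> t \<and> t \<le> T \<longrightarrow> \<bar>F s t - (A t - A s)\<bar> \<le> sew_const \<mu> * K * (t - s) powr \<mu>"
proof -
  define d where "d n i = T * (real i / 2 ^ n)" for n i :: nat
  define S where "S n t = (\<Sum>i<2 ^ n. F (min t (d n i)) (min t (d n (Suc i))))" for n t
  define r where "r = 2 powr (1 - \<mu>)"
  have r: "0 < r" "r < 1" using sew_const_denominator[OF \<mu>] by (auto simp: r_def)
  have rn: "2 ^ n * (K * (T / 2 ^ n) powr \<mu>) = K * T powr \<mu> * r ^ n" for n :: nat
  proof -
    have "(2::real) ^ n = 2 powr n" by (simp add: powr_realpow)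
    moreover have "r ^ n = 2 powr (n * (1 - \<mu>))"
      unfolding r_def by (simp add: powr_realpow[symmetric] powr_powr mult.commute)
    ultimately show ?thesis using T
      by (simp add: powr_divide powr_powr powr_diff field_simps powr_add[symmetric])
  qed
  have d0: "d n i \<ge> 0" "d n i \<le> d n (Suc i)" "d n (Suc i) - d n i = T / 2 ^ n" for n i
    using T by (auto simp: d_def field_simps)
  have dT: "d n (2 ^ n) = T" for n by (simp add: d_def)
  have cell: "\<bar>F s t - F s u - F u t\<bar> \<le> K * (T / 2 ^ n) powr \<mu>"
    if "0 \<le> s" "s \<le> u" "u \<le> t" "t \<le> T" "t - s \<le> T / 2 ^ n" for s u t and n :: nat
    using F[OF that(1-4)] mult_left_mono[OF powr_mono2[OF _ _ that(5), of \<mu>] K] that \<mu> by linarith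
  have step: "\<bar>S (Suc n) t - S n t\<bar> \<le> K * T powr \<mu> * r ^ n" if t: "0 \<le> t" "t \<le> T" for n t
  proof -
    have dd: "d (Suc n) (2 * i) = d n i" "d (Suc n) (Suc (Suc (2 * i))) = d n (Suc i)" for i
      by (auto simp: d_def field_simps)
    have "S n t - S (Suc n) t = (\<Sum>i<2 ^ n. F (min t (d n i)) (min t (d n (Suc i)))
        - F (min t (d n i)) (min t (d (Suc n) (Suc (2 * i))))
        - F (min t (d (Suc n) (Suc (2 * i)))) (min t (d n (Suc i))))"
      by (simp add: S_def sum_lessThan_double sum_subtractf dd sum.distrib)
    also have "\<bar>\<dots>\<bar> \<le> (\<Sum>i<(2::nat) ^ n. K * (T / 2 ^ n) powr \<mu>)"
    proof (intro order_trans[OF sum_abs] sum_mono cell)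
      fix i :: nat
      show "0 \<le> min t (d n i)" "min t (d n (Suc i)) \<le> T" using d0 t by auto
      show "min t (d n i) \<le> min t (d (Suc n) (Suc (2 * i)))"
        "min t (d (Suc n) (Suc (2 * i))) \<le> min t (d n (Suc i))"
        using d0(2)[of "Suc n" "2 * i"] d0(2)[of "Suc n" "Suc (2 * i)"] by (auto simp: dd)
      show "min t (d n (Suc i)) - min t (d n i) \<le> T / 2 ^ n"
        using d0(2,3)[of n i] by linarith
    qed
    also have "\<dots> = K * T powr \<mu> * r ^ n" using rn[of n] by simp
    finally show ?thesis by (simp add: abs_minus_commute)
  qed
  have conv: "convergent (\<lambda>n. S n t)" if t: "0 \<le> t" "t \<le> T" for t
  proof -
    have "summable (\<lambda>n. S (Suc n) t - S n t)"
      by (rule summable_comparison_test'[where g = "\<lambda>n. K * T powr \<mu> * r ^ n" and N = 0])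
        (use step[OF t] r in \<open>auto intro!: summable_mult summable_geometric\<close>)
    then have "convergent (\<lambda>n. (\<Sum>i<n. S (Suc i) t - S i t))"
      by (simp add: summable_iff_convergent)
    then have "convergent (\<lambda>n. (S n t - S 0 t) + S 0 t)"
      unfolding sum_lessThan_telescope[of "\<lambda>i. S i t"] by (intro convergent_add convergent_const)
    then show ?thesis by simp
  qed
  define A where "A t = lim (\<lambda>n. S n t)" for t
  have lim: "(\<lambda>n. S n t) \<longlonglongrightarrow> A t" if "0 \<le> t" "t \<le> T" for t
    using conv[OF that] by (simp add: A_def convergent_LIMSEQ_iff)
  have "\<bar>F s t - (A t - A s)\<bar> \<le> sew_const \<mu> * K * (t - s) powr \<mu>" if st: "0 \<le> s" "s \<le> t" "t \<le> T" for s t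
  proof -
    have diag: "F u u = 0" if "0 \<le> u" "u \<le> T" for u
      using almost_additive_diag[of 0 T F K \<mu>, OF F] that by simp
    have bnd: "\<bar>F s t - (S n t - S n s)\<bar> \<le> sew_const \<mu> * K * (t - s) powr \<mu> + K * T powr \<mu> * r ^ n" for n
    proof -
      define c where "c i = max s (min t (d n i))" for i
      have c: "c 0 = s" "c (2 ^ n) = t" using st by (auto simp: c_def d_def)
      have "\<bar>F (c 0) (c (2 ^ n)) - (\<Sum>k=0..<2 ^ n. F (c k) (c (Suc k)))\<bar> \<le> sew_const \<mu> * K * (c (2 ^ n) - c 0) powr \<mu>"
      proof (rule partition_sum_bound[OF \<mu> K F])
        show "c k \<le> c (Suc k)" if "k < 2 ^ n" for k using d0(2)[of n k] by (auto simp: c_def)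
      qed (use c st in auto)
      then have 1: "\<bar>F s t - (\<Sum>k<2 ^ n. F (c k) (c (Suc k)))\<bar> \<le> sew_const \<mu> * K * (t - s) powr \<mu>"
        by (simp add: c atLeast0LessThan)
      have "S n t - S n s - (\<Sum>k<2 ^ n. F (c k) (c (Suc k))) =
         (\<Sum>k<2 ^ n. F (min t (d n k)) (min t (d n (Suc k))) - F (min s (d n k)) (min s (d n (Suc k))) - F (c k) (c (Suc k)))"
        by (simp add: S_def sum_subtractf)
      also have "\<bar>\<dots>\<bar> \<le> (\<Sum>i<(2::nat) ^ n. K * (T / 2 ^ n) powr \<mu>)"
      proof (intro order_trans[OF sum_abs] sum_mono)
        fix k :: nat
        have nn: "K * (T / 2 ^ n) powr \<mu> \<ge> 0" using K by simp
        consider "d n (Suc k) \<le> s" | "s \<le> d n k" | "d n k < s" "s < d n (Suc k)" by linarith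
        then show "\<bar>F (min t (d n k)) (min t (d n (Suc k))) - F (min s (d n k)) (min s (d n (Suc k))) - F (c k) (c (Suc k))\<bar>
            \<le> K * (T / 2 ^ n) powr \<mu>"
        proof cases
          case 1
          then have "min t (d n k) = d n k" "min s (d n k) = d n k" "min t (d n (Suc k)) = d n (Suc k)"
            "min s (d n (Suc k)) = d n (Suc k)" "c k = s" "c (Suc k) = s"
            using st d0(2)[of n k] by (auto simp: c_def)
          then show ?thesis using diag[of s] st nn by simp
        next
          case 2
          then have "min s (d n k) = s" "min s (d n (Suc k)) = s" "c k = min t (d n k)" "c (Suc k) = min t (d n (Suc k))"
            using st d0(2)[of n k] by (auto simp: c_def)
          then show ?thesis using diag[of s] st nn by simp
        next
          case 3
          then have e: "min t (d n k) = d n k" "min s (d n k) = d n k" "min s (d n (Suc k)) = s"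
            "c k = s" "c (Suc k) = min t (d n (Suc k))"
            using st by (auto simp: c_def)
          show ?thesis unfolding e
            by (rule cell) (use 3 st d0[of n k] in auto)
        qed
      qed
      also have "\<dots> = K * T powr \<mu> * r ^ n" using rn[of n] by simp
      finally show ?thesis using 1 by linarith
    qed
    have "(\<lambda>n. \<bar>F s t - (S n t - S n s)\<bar>) \<longlonglongrightarrow> \<bar>F s t - (A t - A s)\<bar>"
      by (intro tendsto_intros lim) (use st in auto)
    moreover have "(\<lambda>n. sew_const \<mu> * K * (t - s) powr \<mu> + K * T powr \<mu> * r ^ n)
        \<longlonglongrightarrow> sew_const \<mu> * K * (t - s) powr \<mu> + K * T powr \<mu> * 0"
      by (intro tendsto_intros LIMSEQ_power_zero) (use r in auto)
    ultimately show ?thesis using bnd by (auto intro: LIMSEQ_le)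
  qed
  then show ?thesis by blast
qed

lemma additive_sum:
  fixes f :: "real \<Rightarrow> real \<Rightarrow> real" and p :: "nat \<Rightarrow> real"
  assumes f: "\<And>s u t. \<lbrakk>0 \<le> s; s \<le> u; u \<le> t; t \<le> T\<rbrakk> \<Longrightarrow> f s t = f s u + f u t"
    and p: "\<And>k. k < n \<Longrightarrow> p k \<le> p (Suc k)" and b: "0 \<le> p 0" "p n \<le> T"
  shows "(\<Sum>k<n. f (p k) (p (Suc k))) = f (p 0) (p n)"
  using p b(2)
proof (induction n)
  case 0
  then show ?case using f[of "p 0" "p 0" "p 0"] b(1) by simp
next
  case (Suc n)
  have *: "p 0 \<le> p n" using mono_chain[of n p 0 n] Suc.prems(1) by simp
  then have "(\<Sum>k<n. f (p k) (p (Suc k))) = f (p 0) (p n)"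
    using Suc.IH Suc.prems(1) order_trans[OF Suc.prems(1)[of n] Suc.prems(2)] by simp
  then show ?case using f[of "p 0" "p n" "p (Suc n)"] Suc.prems(1)[of n] Suc.prems * b(1) by simp
qed

text \<open>The \<open>k\<close>-th, counted from 0, of the \<open>n + 2\<close> equidistant points from \<open>a\<close> to \<open>b\<close>, which bound \<open>n + 1\<close> cells.\<close>
definition uniform_partition :: "real \<Rightarrow> real \<Rightarrow> nat \<Rightarrow> nat \<Rightarrow> real" where
  "uniform_partition a b n k = a + (b - a) * (real k / real (Suc n))"

lemma uniform_partition:
  assumes "a \<le> b"
  shows "uniform_partition a b n 0 = a" "uniform_partition a b n (Suc n) = b"
    "uniform_partition a b n (Suc k) - uniform_partition a b n k = (b - a) / real (Suc n)"
    "uniform_partition a b n k \<le> uniform_partition a b n (Suc k)"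
proof -
  show "uniform_partition a b n 0 = a" "uniform_partition a b n (Suc n) = b"
    by (simp_all add: uniform_partition_def del: of_nat_Suc)
  have "uniform_partition a b n (Suc k) - uniform_partition a b n k = (b - a) * ((real (Suc k) - real k) / real (Suc n))"
    unfolding uniform_partition_def diff_divide_distrib by (simp add: right_diff_distrib del: of_nat_Suc)
  then show gap: "uniform_partition a b n (Suc k) - uniform_partition a b n k = (b - a) / real (Suc n)"
    by simp
  have "(b - a) / real (Suc n) \<ge> 0" using assms by simp
  with gap show "uniform_partition a b n k \<le> uniform_partition a b n (Suc k)" by (metis diff_ge_0_iff_ge)
qed

text \<open>
  The uniqueness of the sewing map: cut \<open>[s, t]\<close> into equal parts and let their number tend to infinity.
\<close>
lemma additive_superlinear_zero:
  fixes f :: "real \<Rightarrow> real \<Rightarrow> real"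
  assumes \<mu>: "\<mu> > 1"
    and f: "\<And>s u t. \<lbrakk>0 \<le> s; s \<le> u; u \<le> t; t \<le> T\<rbrakk> \<Longrightarrow> f s t = f s u + f u t"
    and bound: "\<And>s t. \<lbrakk>0 \<le> s; s \<le> t; t \<le> T\<rbrakk> \<Longrightarrow> \<bar>f s t\<bar> \<le> C * (t - s) powr \<mu>"
    and st: "0 \<le> s" "s \<le> t" "t \<le> T"
  shows "f s t = 0"
proof -
  have bnd: "\<bar>f s t\<bar> \<le> C * (t - s) powr \<mu> * real (Suc n) powr (1 - \<mu>)" for n
  proof -
    define p where "p = uniform_partition s t n"
    note p = uniform_partition(1,2)[OF st(2), of n, folded p_def]
      and gap = uniform_partition(3)[OF st(2), of n, folded p_def]
      and le = uniform_partition(4)[OF st(2), of n, folded p_def]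
    have rng: "s \<le> p k" "p k \<le> t" if "k \<le> Suc n" for k
      using mono_chain[of "Suc n" p 0 k] mono_chain[of "Suc n" p k "Suc n"] p le that by auto
    have "f s t = (\<Sum>k<Suc n. f (p k) (p (Suc k)))"
      using additive_sum[of T f "Suc n" p, OF f le] p st by simp
    also have "\<bar>\<dots>\<bar> \<le> (\<Sum>k<Suc n. C * ((t - s) / real (Suc n)) powr \<mu>)"
    proof (intro order_trans[OF sum_abs] sum_mono)
      fix k assume "k \<in> {..<Suc n}"
      then have "\<bar>f (p k) (p (Suc k))\<bar> \<le> C * (p (Suc k) - p k) powr \<mu>"
        using rng[of k] rng[of "Suc k"] st le[of k] by (intro bound) auto
      then show "\<bar>f (p k) (p (Suc k))\<bar> \<le> C * ((t - s) / real (Suc n)) powr \<mu>"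
        unfolding gap .
    qed
    also have "\<dots> = real (Suc n) * (C * ((t - s) / real (Suc n)) powr \<mu>)" by simp
    also have "\<dots> = C * (t - s) powr \<mu> * real (Suc n) powr (1 - \<mu>)"
      using st by (simp add: powr_divide powr_diff del: of_nat_Suc)
    finally show ?thesis .
  qed
  have "(\<lambda>n. C * (t - s) powr \<mu> * real (Suc n) powr (1 - \<mu>)) \<longlonglongrightarrow> C * (t - s) powr \<mu> * 0"
    by (intro tendsto_intros tendsto_neg_powr filterlim_compose[OF filterlim_real_sequentially filterlim_Suc])
      (use \<mu> in auto)
  then have "\<bar>f s t\<bar> \<le> 0"
    using bnd by (intro LIMSEQ_le_const[of _ 0]) auto
  then show ?thesis by simp
qed

lemma powr_exponent_lower:
  fixes r T :: real
  assumes "0 \<le> r" "r \<le> T" "\<nu> \<le> \<mu>"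
  shows "r powr \<mu> \<le> T powr (\<mu> - \<nu>) * r powr \<nu>"
proof (cases "r = 0")
  case False
  have "r powr \<mu> = r powr (\<mu> - \<nu>) * r powr \<nu>" by (simp add: powr_add[symmetric])
  also have "\<dots> \<le> T powr (\<mu> - \<nu>) * r powr \<nu>"
    using assms by (intro mult_right_mono powr_mono2) auto
  finally show ?thesis .
qed simp

text \<open>
  Any superlinearly small function with coboundary \<open>h\<close> is the value of the sewing map; the exponents
  of two candidates may differ, and the smaller one serves for their difference.
\<close>
lemma sew_eqI:
  fixes g :: "real \<Rightarrow> real \<Rightarrow> real"
  assumes \<mu>: "\<mu> > 1"
    and bound: "\<And>s t. \<lbrakk>0 \<le> s; s \<le> t; t \<le> T\<rbrakk> \<Longrightarrow> \<bar>g s t\<bar> \<le> C * (t - s) powr \<mu>"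
    and h: "\<And>s u t. \<lbrakk>0 \<le> s; s \<le> u; u \<le> t; t \<le> T\<rbrakk> \<Longrightarrow> g s t - g s u - g u t = h s u t"
    and st: "0 \<le> s" "s \<le> t" "t \<le> T"
  shows "sew T h s t = g s t"
proof -
  define g0 where "g0 = (\<lambda>s t. if 0 \<le> s \<and> s \<le> t \<and> t \<le> T then g s t else 0)"
  have "sew T h = g0" unfolding sew_def
  proof (rule the_equality, intro conjI)
    show "\<exists>\<mu>>1. \<exists>C. \<forall>s t. 0 \<le> s \<and> s \<le> t \<and> t \<le> T \<longrightarrow> \<bar>g0 s t\<bar> \<le> C * \<bar>t - s\<bar> powr \<mu>"
      using \<mu> bound by (intro exI[of _ \<mu>] conjI exI[of _ C]) (auto simp: g0_def)
    show "\<forall>s u t. 0 \<le> s \<and> s \<le> u \<and> u \<le> t \<and> t \<le> T \<longrightarrow> g0 s t - g0 s u - g0 u t = h s u t"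
      using h by (auto simp: g0_def)
    show "\<forall>s t. \<not> (0 \<le> s \<and> s \<le> t \<and> t \<le> T) \<longrightarrow> g0 s t = 0" by (auto simp: g0_def)
  next
    fix k
    assume k: "(\<exists>\<mu>>1. \<exists>C. \<forall>s t. 0 \<le> s \<and> s \<le> t \<and> t \<le> T \<longrightarrow> \<bar>k s t\<bar> \<le> C * \<bar>t - s\<bar> powr \<mu>) \<and>
      (\<forall>s u t. 0 \<le> s \<and> s \<le> u \<and> u \<le> t \<and> t \<le> T \<longrightarrow> k s t - k s u - k u t = h s u t) \<and>
      (\<forall>s t. \<not> (0 \<le> s \<and> s \<le> t \<and> t \<le> T) \<longrightarrow> k s t = 0)"
    obtain \<nu> B where \<nu>: "\<nu> > 1"
      and kB': "\<forall>s t. 0 \<le> s \<and> s \<le> t \<and> t \<le> T \<longrightarrow> \<bar>k s t\<bar> \<le> B * \<bar>t - s\<bar> powr \<nu>"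
      using conjunct1[OF k] by blast
    have kB: "\<bar>k s t\<bar> \<le> B * (t - s) powr \<nu>" if "0 \<le> s" "s \<le> t" "t \<le> T" for s t
      using kB'[rule_format, of s t] that by simp
    define m where "m = min \<mu> \<nu>"
    have low: "\<bar>v\<bar> \<le> \<bar>c\<bar> * T powr (e - m) * (t - s) powr m"
      if "\<bar>v\<bar> \<le> c * (t - s) powr e" "m \<le> e" "0 \<le> s" "s \<le> t" "t \<le> T" for v c e s t :: real
    proof -
      have "c * (t - s) powr e \<le> \<bar>c\<bar> * (t - s) powr e" by (intro mult_right_mono) auto
      also have "\<dots> \<le> \<bar>c\<bar> * (T powr (e - m) * (t - s) powr m)"
        using that by (intro mult_left_mono powr_exponent_lower) auto
      finally show ?thesis using that(1) by (simp add: mult.assoc)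
    qed
    have z: "k s t - g s t = 0" if "0 \<le> s" "s \<le> t" "t \<le> T" for s t
    proof (rule additive_superlinear_zero[of m T "\<lambda>s t. k s t - g s t"
          "\<bar>B\<bar> * T powr (\<nu> - m) + \<bar>C\<bar> * T powr (\<mu> - m)"])
      show "m > 1" using \<mu> \<nu> by (simp add: m_def)
      show "k s t - g s t = (k s u - g s u) + (k u t - g u t)"
        if a: "0 \<le> s" "s \<le> u" "u \<le> t" "t \<le> T" for s u t
      proof -
        have "k s t - k s u - k u t = h s u t" using k a by blast
        then show ?thesis using h[OF a] by linarith
      qed
      show "\<bar>k s t - g s t\<bar> \<le> (\<bar>B\<bar> * T powr (\<nu> - m) + \<bar>C\<bar> * T powr (\<mu> - m)) * (t - s) powr m"
        if a: "0 \<le> s" "s \<le> t" "t \<le> T" for s t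
        using low[OF kB[OF a] _ a] low[OF bound[OF a] _ a] unfolding distrib_right m_def
        by (smt (verit, best))
    qed (use that in auto)
    show "k = g0"
    proof (intro ext)
      fix s t show "k s t = g0 s t"
        using z[of s t] k by (cases "0 \<le> s \<and> s \<le> t \<and> t \<le> T") (auto simp: g0_def)
    qed
  qed
  then show ?thesis using st by (simp add: g0_def)
qed

lemma sew_coboundary:
  fixes F :: "real \<Rightarrow> real \<Rightarrow> real"
  assumes \<mu>: "\<mu> > 1" and K: "K \<ge> 0"
    and h: "\<And>s u t. \<lbrakk>0 \<le> s; s \<le> u; u \<le> t; t \<le> T\<rbrakk> \<Longrightarrow> h s u t = F s t - F s u - F u t"
    and F: "\<And>s u t. \<lbrakk>0 \<le> s; s \<le> u; u \<le> t; t \<le> T\<rbrakk> \<Longrightarrow> \<bar>h s u t\<bar> \<le> K * (t - s) powr \<mu>"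
  shows "\<lbrakk>0 \<le> s; s \<le> t; t \<le> T\<rbrakk> \<Longrightarrow> \<bar>sew T h s t\<bar> \<le> sew_const \<mu> * K * (t - s) powr \<mu>"
    and "\<lbrakk>0 \<le> s; s \<le> u; u \<le> t; t \<le> T\<rbrakk> \<Longrightarrow> sew T h s t - sew T h s u - sew T h u t = h s u t"
proof -
  have F': "\<bar>F s t - F s u - F u t\<bar> \<le> K * (t - s) powr \<mu>"
    if "0 \<le> s" "s \<le> u" "u \<le> t" "t \<le> T" for s u t
    using F[OF that] h[OF that] by simp
  have ex: "\<exists>A. \<forall>s t. 0 \<le> s \<and> s \<le> t \<and> t \<le> T \<longrightarrow> sew T h s t = F s t - (A t - A s) \<and>
      \<bar>F s t - (A t - A s)\<bar> \<le> sew_const \<mu> * K * (t - s) powr \<mu>" if T: "T \<ge> 0"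
  proof -
    obtain A where A: "\<And>s t. \<lbrakk>0 \<le> s; s \<le> t; t \<le> T\<rbrakk> \<Longrightarrow> \<bar>F s t - (A t - A s)\<bar> \<le> sew_const \<mu> * K * (t - s) powr \<mu>"
      using sewing[OF \<mu> K T F'] by blast
    have "sew T h s t = F s t - (A t - A s)" if "0 \<le> s" "s \<le> t" "t \<le> T" for s t
      by (rule sew_eqI[OF \<mu> A]) (use that h in auto)
    then show ?thesis using A by blast
  qed
  show "\<bar>sew T h s t\<bar> \<le> sew_const \<mu> * K * (t - s) powr \<mu>" if "0 \<le> s" "s \<le> t" "t \<le> T"
    using ex that by fastforce
  show "sew T h s t - sew T h s u - sew T h u t = h s u t" if st: "0 \<le> s" "s \<le> u" "u \<le> t" "t \<le> T"
  proof -
    obtain A where A: "\<And>s t. \<lbrakk>0 \<le> s; s \<le> t; t \<le> T\<rbrakk> \<Longrightarrow> sew T h s t = F s t - (A t - A s)"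
      using ex st by fastforce
    show ?thesis using A[of s t] A[of s u] A[of u t] h[OF st] st by auto
  qed
qed

section \<open>Two-parameter sewing and Riemann sums\<close>

text \<open>
  The Riemann sum of \<open>g\<close> over the grid with the points \<open>p 0 \<le> \<dots> \<le> p n\<close> and \<open>q 0 \<le> \<dots> \<le> q m\<close>.
  Partitions are sequences of points together with the number of cells.
\<close>
definition riemann_sum :: "incr \<Rightarrow> (nat \<Rightarrow> real) \<Rightarrow> nat \<Rightarrow> (nat \<Rightarrow> real) \<Rightarrow> nat \<Rightarrow> real" where
  "riemann_sum g p n q m = (\<Sum>i<n. \<Sum>j<m. g [p i, p (Suc i)] [q j, q (Suc j)])"

text \<open>
  Bounds under which the increment \<open>g\<close> can be sewn in both directions.  The exponents of the
  variables that do not take part in the coboundary play no role for the convergence of Riemann sums.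
\<close>
definition sewable :: "real \<Rightarrow> real \<Rightarrow> real \<Rightarrow> real \<Rightarrow> incr \<Rightarrow> bool" where
  "sewable T a b K g \<longleftrightarrow> a > 1 \<and> b > 1 \<and> K \<ge> 0 \<and>
     (\<forall>s1 s2 s3 t1 t2. 0 \<le> s1 \<longrightarrow> s1 \<le> s2 \<longrightarrow> s2 \<le> s3 \<longrightarrow> s3 \<le> T \<longrightarrow> 0 \<le> t1 \<longrightarrow> t1 \<le> t2 \<longrightarrow> t2 \<le> T \<longrightarrow>
        \<bar>delta1 g [s1, s2, s3] [t1, t2]\<bar> \<le> K * (s3 - s1) powr a) \<and>
     (\<forall>s1 s2 t1 t2 t3. 0 \<le> s1 \<longrightarrow> s1 \<le> s2 \<longrightarrow> s2 \<le> T \<longrightarrow> 0 \<le> t1 \<longrightarrow> t1 \<le> t2 \<longrightarrow> t2 \<le> t3 \<longrightarrow> t3 \<le> T \<longrightarrow>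
        \<bar>delta2 g [s1, s2] [t1, t2, t3]\<bar> \<le> K * (t3 - t1) powr b) \<and>
     (\<forall>s1 s2 s3 t1 t2 t3. 0 \<le> s1 \<longrightarrow> s1 \<le> s2 \<longrightarrow> s2 \<le> s3 \<longrightarrow> s3 \<le> T \<longrightarrow>
        0 \<le> t1 \<longrightarrow> t1 \<le> t2 \<longrightarrow> t2 \<le> t3 \<longrightarrow> t3 \<le> T \<longrightarrow>
        \<bar>delta g [s1, s2, s3] [t1, t2, t3]\<bar> \<le> K * (s3 - s1) powr a * (t3 - t1) powr b)"

text \<open>
  The error of a Riemann sum is at most \<open>K\<close> times this factor times powers of the meshes.  Since the
  factor depends on \<open>T\<close>, \<open>a\<close> and \<open>b\<close> only, the convergence is uniform over increments with a common \<open>K\<close>.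
\<close>
definition riemann_const :: "real \<Rightarrow> real \<Rightarrow> real \<Rightarrow> real" where
  "riemann_const T a b = T * (sew_const a * (1 + 2 * sew_const b * T powr b) + sew_const b * (1 + sew_const a * T powr a))"

lemma delta2_eqs [simp]:
  "delta2 f s [t1, t2] = f s [t2] - f s [t1]"
  "delta2 f s [t1, t2, t3] = f s [t1, t3] - f s [t1, t2] - f s [t2, t3]"
  by (auto simp: delta2_def)

lemma sum_powr_gaps:
  fixes p :: "nat \<Rightarrow> real"
  assumes \<mu>: "\<mu> \<ge> 1" and p: "\<And>k. k < n \<Longrightarrow> p k \<le> p (Suc k)"
    and r: "\<And>k. k < n \<Longrightarrow> p (Suc k) - p k \<le> r" and T: "p n - p 0 \<le> T"
  shows "(\<Sum>k<n. (p (Suc k) - p k) powr \<mu>) \<le> T * r powr (\<mu> - 1)"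
proof -
  have "(\<Sum>k<n. (p (Suc k) - p k) powr \<mu>) \<le> (\<Sum>k<n. r powr (\<mu> - 1) * (p (Suc k) - p k))"
  proof (rule sum_mono)
    fix k assume "k \<in> {..<n}"
    then show "(p (Suc k) - p k) powr \<mu> \<le> r powr (\<mu> - 1) * (p (Suc k) - p k)"
      using powr_exponent_lower[of "p (Suc k) - p k" r 1 \<mu>] p[of k] r[of k] \<mu> by simp
  qed
  also have "\<dots> = r powr (\<mu> - 1) * (p n - p 0)"
    by (simp add: sum_distrib_left[symmetric] sum_lessThan_telescope)
  also have "\<dots> \<le> r powr (\<mu> - 1) * T" using T by (intro mult_left_mono) auto
  finally show ?thesis by (simp add: mult.commute)
qed

text \<open>
  The sum of \<open>L\<close> over the partition in the second direction exceeds \<open>L\<close> itself by a constant factor only,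
  because \<open>b > 1\<close>, and the superlinear bound in the first direction then makes the double sum small.
  No relation between the meshes of the two partitions is needed.
\<close>
lemma superlinear_double_sum:
  fixes L :: "real \<Rightarrow> real \<Rightarrow> real \<Rightarrow> real \<Rightarrow> real" and p q :: "nat \<Rightarrow> real"
  assumes a: "a > 1" and b: "b > 1" and C: "C \<ge> 0"
    and L: "\<And>s1 s2 t1 t2. \<lbrakk>0 \<le> s1; s1 \<le> s2; s2 \<le> T; 0 \<le> t1; t1 \<le> t2; t2 \<le> T\<rbrakk> \<Longrightarrow>
      \<bar>L s1 s2 t1 t2\<bar> \<le> C * (s2 - s1) powr a"
    and L': "\<And>s1 s2 t1 t2 t3. \<lbrakk>0 \<le> s1; s1 \<le> s2; s2 \<le> T; 0 \<le> t1; t1 \<le> t2; t2 \<le> t3; t3 \<le> T\<rbrakk> \<Longrightarrow>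
      \<bar>L s1 s2 t1 t3 - L s1 s2 t1 t2 - L s1 s2 t2 t3\<bar> \<le> C * (s2 - s1) powr a * (t3 - t1) powr b"
    and p: "\<And>k. k < n \<Longrightarrow> p k \<le> p (Suc k)" "0 \<le> p 0" "p n \<le> T" "\<And>k. k < n \<Longrightarrow> p (Suc k) - p k \<le> r"
    and q: "\<And>k. k < m \<Longrightarrow> q k \<le> q (Suc k)" "0 \<le> q 0" "q m \<le> T"
  shows "\<bar>\<Sum>i<n. \<Sum>j<m. L (p i) (p (Suc i)) (q j) (q (Suc j))\<bar> \<le> C * (1 + sew_const b * T powr b) * (T * r powr (a - 1))"
proof -
  have qm: "q 0 \<le> q m" using mono_chain[of m q 0 m, OF q(1)] by simp
  have inner: "\<bar>\<Sum>j<m. L (p i) (p (Suc i)) (q j) (q (Suc j))\<bar>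
      \<le> C * (1 + sew_const b * T powr b) * (p (Suc i) - p i) powr a" if i: "i < n" for i
  proof -
    have pi: "0 \<le> p i" "p i \<le> p (Suc i)" "p (Suc i) \<le> T"
      using cell_range[of n p 0 T, OF p(1-3)] i by auto
    have C': "C * (p (Suc i) - p i) powr a \<ge> 0" using C by simp
    have "\<bar>L (p i) (p (Suc i)) (q 0) (q m) - (\<Sum>j=0..<m. L (p i) (p (Suc i)) (q j) (q (Suc j)))\<bar>
        \<le> sew_const b * (C * (p (Suc i) - p i) powr a) * (q m - q 0) powr b"
      by (rule partition_sum_bound[OF b C']) (use q L' pi in auto)
    also have "\<dots> \<le> sew_const b * (C * (p (Suc i) - p i) powr a) * T powr b"
      using sew_const_pos[OF b] C' qm q b by (intro mult_left_mono powr_mono2) auto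
    finally show ?thesis
      using L[OF pi q(2) qm q(3)] by (simp add: atLeast0LessThan algebra_simps)
  qed
  have "\<bar>\<Sum>i<n. \<Sum>j<m. L (p i) (p (Suc i)) (q j) (q (Suc j))\<bar>
      \<le> (\<Sum>i<n. C * (1 + sew_const b * T powr b) * (p (Suc i) - p i) powr a)"
    by (rule order_trans[OF sum_abs], rule sum_mono, rule inner) simp
  also have "\<dots> = C * (1 + sew_const b * T powr b) * (\<Sum>i<n. (p (Suc i) - p i) powr a)"
    by (simp add: sum_distrib_left)
  also have "\<dots> \<le> C * (1 + sew_const b * T powr b) * (T * r powr (a - 1))"
    using a sew_const_pos[OF b] C p by (intro mult_left_mono sum_powr_gaps) auto
  finally show ?thesis .
qed

text \<open>
  The terms of \<open>rough_integral\<close>: the corrections \<open>\<Lambda>\<^sub>1 \<delta>\<^sub>1 g\<close> and \<open>\<Lambda>\<^sub>2 \<delta>\<^sub>2 g\<close> are superlinear in one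
  direction, and so are their coboundaries in the other direction, uniformly.
\<close>
context
  fixes T a b K :: real and g :: incr
  assumes g: "sewable T a b K g"
begin

abbreviation L1 where "L1 s1 s2 t1 t2 \<equiv> Lambda1 T (delta1 g) [s1, s2] [t1, t2]"
abbreviation L2 where "L2 s1 s2 t1 t2 \<equiv> Lambda2 T (delta2 g) [s1, s2] [t1, t2]"
abbreviation L12 where "L12 s1 s2 t1 t2 \<equiv> Lambda T (delta g) [s1, s2] [t1, t2]"

lemma sewable_params: "a > 1" "b > 1" "K \<ge> 0" "sew_const a * K \<ge> 0" "sew_const b * K \<ge> 0"
  using g sew_const_pos[of a] sew_const_pos[of b] by (auto simp: sewable_def)

lemmas sewa = sew_coboundary[OF sewable_params(1), where T = T]
  and sewb = sew_coboundary[OF sewable_params(2), where T = T]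

lemma delta12_bound:
  assumes "0 \<le> s1" "s1 \<le> s2" "s2 \<le> s3" "s3 \<le> T" "0 \<le> t1" "t1 \<le> t2" "t2 \<le> t3" "t3 \<le> T"
  shows "\<bar>delta g [s1, s2, s3] [t1, t2, t3]\<bar> \<le> K * (s3 - s1) powr a * (t3 - t1) powr b"
  using g assms unfolding sewable_def by blast

lemma L1_sew:
  assumes "0 \<le> t1" "t1 \<le> t2" "t2 \<le> T"
  shows "\<lbrakk>0 \<le> s1; s1 \<le> s2; s2 \<le> T\<rbrakk> \<Longrightarrow> \<bar>L1 s1 s2 t1 t2\<bar> \<le> sew_const a * K * (s2 - s1) powr a"
    and "\<lbrakk>0 \<le> s1; s1 \<le> s2; s2 \<le> s3; s3 \<le> T\<rbrakk> \<Longrightarrow>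
      L1 s1 s3 t1 t2 - L1 s1 s2 t1 t2 - L1 s2 s3 t1 t2 = delta1 g [s1, s2, s3] [t1, t2]"
proof -
  have B: "\<bar>delta1 g [s1, s2, s3] [t1, t2]\<bar> \<le> K * (s3 - s1) powr a" if "0 \<le> s1" "s1 \<le> s2" "s2 \<le> s3" "s3 \<le> T" for s1 s2 s3
    using g that assms unfolding sewable_def by blast
  note F = sewa[OF sewable_params(3), of "\<lambda>s1 s2 s3. delta1 g [s1, s2, s3] [t1, t2]" "\<lambda>s1 s2. g [s1, s2] [t1, t2]", OF delta1.simps(2) B]
  show "\<bar>L1 s1 s2 t1 t2\<bar> \<le> sew_const a * K * (s2 - s1) powr a" if "0 \<le> s1" "s1 \<le> s2" "s2 \<le> T"
    using F(1)[OF _ _ _ _ that] by (simp add: Lambda1_def)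
  show "L1 s1 s3 t1 t2 - L1 s1 s2 t1 t2 - L1 s2 s3 t1 t2 = delta1 g [s1, s2, s3] [t1, t2]" if "0 \<le> s1" "s1 \<le> s2" "s2 \<le> s3" "s3 \<le> T"
    using F(2)[OF _ _ _ _ that] by (simp add: Lambda1_def)
qed

lemma L2_sew:
  assumes "0 \<le> s1" "s1 \<le> s2" "s2 \<le> T"
  shows "\<lbrakk>0 \<le> t1; t1 \<le> t2; t2 \<le> T\<rbrakk> \<Longrightarrow> \<bar>L2 s1 s2 t1 t2\<bar> \<le> sew_const b * K * (t2 - t1) powr b"
    and "\<lbrakk>0 \<le> t1; t1 \<le> t2; t2 \<le> t3; t3 \<le> T\<rbrakk> \<Longrightarrow>
      L2 s1 s2 t1 t3 - L2 s1 s2 t1 t2 - L2 s1 s2 t2 t3 = delta2 g [s1, s2] [t1, t2, t3]"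
proof -
  have B: "\<bar>delta2 g [s1, s2] [t1, t2, t3]\<bar> \<le> K * (t3 - t1) powr b" if "0 \<le> t1" "t1 \<le> t2" "t2 \<le> t3" "t3 \<le> T" for t1 t2 t3
    using g that assms unfolding sewable_def by blast
  note F = sewb[OF sewable_params(3), of "\<lambda>t1 t2 t3. delta2 g [s1, s2] [t1, t2, t3]" "\<lambda>t1 t2. g [s1, s2] [t1, t2]", OF delta2_eqs(2) B]
  show "\<bar>L2 s1 s2 t1 t2\<bar> \<le> sew_const b * K * (t2 - t1) powr b" if "0 \<le> t1" "t1 \<le> t2" "t2 \<le> T"
    using F(1)[OF _ _ _ _ that] by (simp add: Lambda2_def)
  show "L2 s1 s2 t1 t3 - L2 s1 s2 t1 t2 - L2 s1 s2 t2 t3 = delta2 g [s1, s2] [t1, t2, t3]" if "0 \<le> t1" "t1 \<le> t2" "t2 \<le> t3" "t3 \<le> T"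
    using F(2)[OF _ _ _ _ that] by (simp add: Lambda2_def)
qed

text \<open>By uniqueness, sewing in one direction commutes with the coboundary in the other.\<close>
lemma sew_delta1:
  assumes st: "0 \<le> s1" "s1 \<le> s2" "s2 \<le> T" "0 \<le> t1" "t1 \<le> t2" "t2 \<le> t3" "t3 \<le> T"
  shows "sew T (\<lambda>s1 s2 s3. delta g [s1, s2, s3] [t1, t2, t3]) s1 s2 = L1 s1 s2 t1 t3 - L1 s1 s2 t1 t2 - L1 s1 s2 t2 t3"
proof (rule sew_eqI[OF sewable_params(1), where C = "3 * (sew_const a * K)"
      and g = "\<lambda>s1 s2. L1 s1 s2 t1 t3 - L1 s1 s2 t1 t2 - L1 s1 s2 t2 t3"])
  fix s u assume "0 \<le> s" "s \<le> u" "u \<le> T"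
  then show "\<bar>L1 s u t1 t3 - L1 s u t1 t2 - L1 s u t2 t3\<bar> \<le> 3 * (sew_const a * K) * (u - s) powr a"
    using L1_sew(1)[of t1 t3 s u] L1_sew(1)[of t1 t2 s u] L1_sew(1)[of t2 t3 s u] st by linarith
next
  fix s u v assume "0 \<le> s" "s \<le> u" "u \<le> v" "v \<le> T"
  then show "L1 s v t1 t3 - L1 s v t1 t2 - L1 s v t2 t3 - (L1 s u t1 t3 - L1 s u t1 t2 - L1 s u t2 t3)
      - (L1 u v t1 t3 - L1 u v t1 t2 - L1 u v t2 t3) = delta g [s, u, v] [t1, t2, t3]"
    using L1_sew(2)[of t1 t3 s u v] L1_sew(2)[of t1 t2 s u v] L1_sew(2)[of t2 t3 s u v] st
    by (simp add: delta_def)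
qed (use st in auto)

lemma sew_delta2:
  assumes st: "0 \<le> s1" "s1 \<le> s2" "s2 \<le> s3" "s3 \<le> T" "0 \<le> t1" "t1 \<le> t2" "t2 \<le> T"
  shows "sew T (\<lambda>t1 t2 t3. delta g [s1, s2, s3] [t1, t2, t3]) t1 t2 = L2 s1 s3 t1 t2 - L2 s1 s2 t1 t2 - L2 s2 s3 t1 t2"
proof (rule sew_eqI[OF sewable_params(2), where C = "3 * (sew_const b * K)"
      and g = "\<lambda>t1 t2. L2 s1 s3 t1 t2 - L2 s1 s2 t1 t2 - L2 s2 s3 t1 t2"])
  fix t u assume "0 \<le> t" "t \<le> u" "u \<le> T"
  then show "\<bar>L2 s1 s3 t u - L2 s1 s2 t u - L2 s2 s3 t u\<bar> \<le> 3 * (sew_const b * K) * (u - t) powr b"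
    using L2_sew(1)[of s1 s3 t u] L2_sew(1)[of s1 s2 t u] L2_sew(1)[of s2 s3 t u] st by linarith
next
  fix t u v assume "0 \<le> t" "t \<le> u" "u \<le> v" "v \<le> T"
  then show "L2 s1 s3 t v - L2 s1 s2 t v - L2 s2 s3 t v - (L2 s1 s3 t u - L2 s1 s2 t u - L2 s2 s3 t u)
      - (L2 s1 s3 u v - L2 s1 s2 u v - L2 s2 s3 u v) = delta g [s1, s2, s3] [t, u, v]"
    using L2_sew(2)[of s1 s3 t u v] L2_sew(2)[of s1 s2 t u v] L2_sew(2)[of s2 s3 t u v] st
    by (simp add: delta_def)
qed (use st in auto)

lemma L1_delta2:
  assumes st: "0 \<le> s1" "s1 \<le> s2" "s2 \<le> T" "0 \<le> t1" "t1 \<le> t2" "t2 \<le> t3" "t3 \<le> T"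
  shows "\<bar>L1 s1 s2 t1 t3 - L1 s1 s2 t1 t2 - L1 s1 s2 t2 t3\<bar> \<le> sew_const a * K * (s2 - s1) powr a * (t3 - t1) powr b"
proof -
  have nn: "K * (t3 - t1) powr b \<ge> 0" using sewable_params(3) by simp
  have "\<bar>sew T (\<lambda>s1 s2 s3. delta g [s1, s2, s3] [t1, t2, t3]) s1 s2\<bar> \<le> sew_const a * (K * (t3 - t1) powr b) * (s2 - s1) powr a"
  proof (rule sewa(1)[OF nn, where F = "\<lambda>s1 s2. delta2 g [s1, s2] [t1, t2, t3]"])
    fix s u v assume "0 \<le> s" "s \<le> u" "u \<le> v" "v \<le> T"
    then show "\<bar>delta g [s, u, v] [t1, t2, t3]\<bar> \<le> K * (t3 - t1) powr b * (v - s) powr a"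
      using delta12_bound[of s u v t1 t2 t3] st by (simp only: mult_ac)
  qed (use st in \<open>auto simp: delta_def\<close>)
  then show ?thesis unfolding sew_delta1[OF st] by (simp add: mult_ac)
qed

lemma L2_delta1:
  assumes st: "0 \<le> s1" "s1 \<le> s2" "s2 \<le> s3" "s3 \<le> T" "0 \<le> t1" "t1 \<le> t2" "t2 \<le> T"
  shows "\<bar>L2 s1 s3 t1 t2 - L2 s1 s2 t1 t2 - L2 s2 s3 t1 t2\<bar> \<le> sew_const b * K * (s3 - s1) powr a * (t2 - t1) powr b"
proof -
  have nn: "K * (s3 - s1) powr a \<ge> 0" using sewable_params(3) by simp
  have "\<bar>sew T (\<lambda>t1 t2 t3. delta g [s1, s2, s3] [t1, t2, t3]) t1 t2\<bar> \<le> sew_const b * (K * (s3 - s1) powr a) * (t2 - t1) powr b"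
  proof (rule sewb(1)[OF nn, where F = "\<lambda>t1 t2. delta1 g [s1, s2, s3] [t1, t2]"])
    fix t u v assume "0 \<le> t" "t \<le> u" "u \<le> v" "v \<le> T"
    then show "\<bar>delta g [s1, s2, s3] [t, u, v]\<bar> \<le> K * (s3 - s1) powr a * (v - t) powr b"
      using delta12_bound[of s1 s2 s3 t u v] st by simp
  qed (use st in \<open>auto simp: delta_def\<close>)
  then show ?thesis unfolding sew_delta2[OF st] by (simp add: mult_ac)
qed

lemma L12_sew:
  assumes t: "0 \<le> t1" "t1 \<le> t2" "t2 \<le> T"
  shows "\<lbrakk>0 \<le> s1; s1 \<le> s2; s2 \<le> T\<rbrakk> \<Longrightarrow>
      \<bar>L12 s1 s2 t1 t2\<bar> \<le> sew_const a * sew_const b * K * (s2 - s1) powr a * (t2 - t1) powr b"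
    and "\<lbrakk>0 \<le> s1; s1 \<le> s2; s2 \<le> s3; s3 \<le> T\<rbrakk> \<Longrightarrow>
      L12 s1 s3 t1 t2 - L12 s1 s2 t1 t2 - L12 s2 s3 t1 t2 = L2 s1 s3 t1 t2 - L2 s1 s2 t1 t2 - L2 s2 s3 t1 t2"
proof -
  let ?M = "\<lambda>s1 s2 s3. sew T (\<lambda>t1 t2 t3. delta g [s1, s2, s3] [t1, t2, t3]) t1 t2"
  have L12: "L12 s1 s2 t1 t2 = sew T ?M s1 s2" for s1 s2
    by (simp add: Lambda_def Lambda1_def Lambda2_def)
  have nn: "sew_const b * K * (t2 - t1) powr b \<ge> 0" using sewable_params(5) by simp
  have B: "\<bar>?M s1 s2 s3\<bar> \<le> sew_const b * K * (t2 - t1) powr b * (s3 - s1) powr a" if "0 \<le> s1" "s1 \<le> s2" "s2 \<le> s3" "s3 \<le> T" for s1 s2 s3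
    using L2_delta1[OF that t] sew_delta2[OF that t] by (simp add: mult_ac)
  note F = sewa[OF nn, of ?M "\<lambda>s1 s2. L2 s1 s2 t1 t2", OF sew_delta2[OF _ _ _ _ t] B]
  show "\<bar>L12 s1 s2 t1 t2\<bar> \<le> sew_const a * sew_const b * K * (s2 - s1) powr a * (t2 - t1) powr b" if "0 \<le> s1" "s1 \<le> s2" "s2 \<le> T"
    using F(1)[OF _ _ _ _ _ _ _ _ that] unfolding L12 by (simp add: mult_ac)
  show "L12 s1 s3 t1 t2 - L12 s1 s2 t1 t2 - L12 s2 s3 t1 t2 = L2 s1 s3 t1 t2 - L2 s1 s2 t1 t2 - L2 s2 s3 t1 t2" if "0 \<le> s1" "s1 \<le> s2" "s2 \<le> s3" "s3 \<le> T"
    using F(2)[OF _ _ _ _ _ _ _ _ that] unfolding L12 sew_delta2[OF that t] by simp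
qed

lemma L12_delta2:
  assumes st: "0 \<le> s1" "s1 \<le> s2" "s2 \<le> T" "0 \<le> t1" "t1 \<le> t2" "t2 \<le> t3" "t3 \<le> T"
  shows "L12 s1 s2 t1 t3 - L12 s1 s2 t1 t2 - L12 s1 s2 t2 t3 = L1 s1 s2 t1 t3 - L1 s1 s2 t1 t2 - L1 s1 s2 t2 t3"
  unfolding sew_delta1[OF st, symmetric]
proof (rule sew_eqI[OF sewable_params(1), symmetric, where C = "3 * (sew_const a * sew_const b * K * T powr b)"
      and g = "\<lambda>s1 s2. L12 s1 s2 t1 t3 - L12 s1 s2 t1 t2 - L12 s1 s2 t2 t3"])
  fix s u assume su: "0 \<le> s" "s \<le> u" "u \<le> T"
  have "\<bar>L12 s u t t'\<bar> \<le> sew_const a * sew_const b * K * T powr b * (u - s) powr a"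
    if t: "0 \<le> t" "t \<le> t'" "t' \<le> T" for t t'
  proof -
    have "sew_const a * sew_const b * K * (u - s) powr a * (t' - t) powr b \<le> sew_const a * sew_const b * K * (u - s) powr a * T powr b"
      using sewable_params sew_const_pos[of a] sew_const_pos[of b] t by (intro mult_left_mono powr_mono2) auto
    then show ?thesis using L12_sew(1)[OF t su] by (simp add: mult_ac)
  qed
  from this[of t1 t3] this[of t1 t2] this[of t2 t3]
  show "\<bar>L12 s u t1 t3 - L12 s u t1 t2 - L12 s u t2 t3\<bar> \<le> 3 * (sew_const a * sew_const b * K * T powr b) * (u - s) powr a"
    using st by linarith
next
  fix s u v assume "0 \<le> s" "s \<le> u" "u \<le> v" "v \<le> T"
  then show "L12 s v t1 t3 - L12 s v t1 t2 - L12 s v t2 t3 - (L12 s u t1 t3 - L12 s u t1 t2 - L12 s u t2 t3)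
      - (L12 u v t1 t3 - L12 u v t1 t2 - L12 u v t2 t3) = delta g [s, u, v] [t1, t2, t3]"
    using L12_sew(2)[of t1 t3 s u v] L12_sew(2)[of t1 t2 s u v] L12_sew(2)[of t2 t3 s u v] st
      L2_sew(2)[of s v t1 t2 t3] L2_sew(2)[of s u t1 t2 t3] L2_sew(2)[of u v t1 t2 t3]
    by (simp add: delta_def)
qed (use st in auto)

end

lemma riemann_sum_rough_integral:
  assumes g: "sewable T a b K g"
    and p: "\<And>k. k < n \<Longrightarrow> p k \<le> p (Suc k)" "0 \<le> p 0" "p n \<le> T" "\<And>k. k < n \<Longrightarrow> p (Suc k) - p k \<le> r"
    and q: "\<And>k. k < m \<Longrightarrow> q k \<le> q (Suc k)" "0 \<le> q 0" "q m \<le> T" "\<And>k. k < m \<Longrightarrow> q (Suc k) - q k \<le> r'"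
  shows "\<bar>riemann_sum g p n q m - rough_integral T g [p 0, p n] [q 0, q m]\<bar>
    \<le> K * riemann_const T a b * (r powr (a - 1) + r' powr (b - 1))"
proof -
  have a: "a > 1" and b: "b > 1" and K: "K \<ge> 0" using g by (auto simp: sewable_def)
  let ?L1 = "\<lambda>s1 s2 t1 t2. Lambda1 T (delta1 g) [s1, s2] [t1, t2]"
    and ?L2 = "\<lambda>s1 s2 t1 t2. Lambda2 T (delta2 g) [s1, s2] [t1, t2]"
    and ?L12 = "\<lambda>s1 s2 t1 t2. Lambda T (delta g) [s1, s2] [t1, t2]"
  define J where "J = (\<lambda>s1 s2 t1 t2. rough_integral T g [s1, s2] [t1, t2])"
  have J: "J s1 s2 t1 t2 = g [s1, s2] [t1, t2] - ?L1 s1 s2 t1 t2 - ?L2 s1 s2 t1 t2 + ?L12 s1 s2 t1 t2" for s1 s2 t1 t2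
    by (simp add: J_def rough_integral_def)
  have J1: "J s1 s3 t1 t2 = J s1 s2 t1 t2 + J s2 s3 t1 t2"
    if s: "0 \<le> s1" "s1 \<le> s2" "s2 \<le> s3" "s3 \<le> T" and t: "0 \<le> t1" "t1 \<le> t2" "t2 \<le> T" for s1 s2 s3 t1 t2
    using L1_sew(2)[OF g t s] L12_sew(2)[OF g t s] by (simp add: J)
  have J2: "J s1 s2 t1 t3 = J s1 s2 t1 t2 + J s1 s2 t2 t3"
    if s: "0 \<le> s1" "s1 \<le> s2" "s2 \<le> T" and t: "0 \<le> t1" "t1 \<le> t2" "t2 \<le> t3" "t3 \<le> T" for s1 s2 t1 t2 t3
    using L2_sew(2)[OF g s t] L12_delta2[OF g s t] by (simp add: J)
  have pr: "0 \<le> p i" "p i \<le> p (Suc i)" "p (Suc i) \<le> T" if "i < n" for i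
    using cell_range(1-3)[of n p 0 T] p(1-3) that by auto
  have qr: "0 \<le> q i" "q i \<le> q (Suc i)" "q (Suc i) \<le> T" if "i < m" for i
    using cell_range(1-3)[of m q 0 T] q(1-3) that by auto
  have pe: "p 0 \<le> p n" and qe: "q 0 \<le> q m"
    using cell_range(4)[of n p 0 T, OF p(1-3)] cell_range(4)[of m q 0 T, OF q(1-3)] by auto
  have T: "T \<ge> 0" using pe p(2,3) by simp
  have "(\<Sum>i<n. \<Sum>j<m. J (p i) (p (Suc i)) (q j) (q (Suc j))) = (\<Sum>i<n. J (p i) (p (Suc i)) (q 0) (q m))"
  proof (rule sum.cong[OF refl])
    fix i assume "i \<in> {..<n}"
    then have i: "0 \<le> p i" "p i \<le> p (Suc i)" "p (Suc i) \<le> T" using pr[of i] by auto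
    show "(\<Sum>j<m. J (p i) (p (Suc i)) (q j) (q (Suc j))) = J (p i) (p (Suc i)) (q 0) (q m)"
      by (rule additive_sum[where T = T, OF J2[OF i]]) (use q in auto)
  qed
  also have "\<dots> = J (p 0) (p n) (q 0) (q m)"
    by (rule additive_sum[where T = T and f = "\<lambda>s s'. J s s' (q 0) (q m)", OF J1])
      (use p q qe in auto)
  finally have sumJ: "(\<Sum>i<n. \<Sum>j<m. J (p i) (p (Suc i)) (q j) (q (Suc j))) = J (p 0) (p n) (q 0) (q m)" .
  have split: "riemann_sum g p n q m - J (p 0) (p n) (q 0) (q m)
      = (\<Sum>i<n. \<Sum>j<m. ?L1 (p i) (p (Suc i)) (q j) (q (Suc j)))
      + (\<Sum>j<m. \<Sum>i<n. ?L2 (p i) (p (Suc i)) (q j) (q (Suc j)))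
      - (\<Sum>i<n. \<Sum>j<m. ?L12 (p i) (p (Suc i)) (q j) (q (Suc j)))"
    unfolding sumJ[symmetric] riemann_sum_def
      sum.swap[of "\<lambda>j i. ?L2 (p i) (p (Suc i)) (q j) (q (Suc j))" "{..<n}" "{..<m}"]
    by (simp add: J sum_subtractf sum.distrib)
  note posa = sew_const_pos[OF a] and posb = sew_const_pos[OF b]
  have S1: "\<bar>\<Sum>i<n. \<Sum>j<m. ?L1 (p i) (p (Suc i)) (q j) (q (Suc j))\<bar>
      \<le> sew_const a * K * (1 + sew_const b * T powr b) * (T * r powr (a - 1))"
    by (rule superlinear_double_sum[OF a b _ L1_sew(1)[OF g] L1_delta2[OF g]]) (use posa K p q in auto)
  have S2: "\<bar>\<Sum>j<m. \<Sum>i<n. ?L2 (p i) (p (Suc i)) (q j) (q (Suc j))\<bar>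
      \<le> sew_const b * K * (1 + sew_const a * T powr a) * (T * r' powr (b - 1))"
  proof (rule superlinear_double_sum[OF b a, where L = "\<lambda>t1 t2 s1 s2. ?L2 s1 s2 t1 t2"])
    fix t1 t2 s1 s2 s3 assume "0 \<le> t1" "t1 \<le> t2" "t2 \<le> T" "0 \<le> s1" "s1 \<le> s2" "s2 \<le> s3" "s3 \<le> T"
    then show "\<bar>?L2 s1 s3 t1 t2 - ?L2 s1 s2 t1 t2 - ?L2 s2 s3 t1 t2\<bar> \<le> sew_const b * K * (t2 - t1) powr b * (s3 - s1) powr a"
      using L2_delta1[OF g, of s1 s2 s3 t1 t2] by (simp only: mult_ac)
  qed (use posb K L2_sew(1)[OF g] p q in auto)
  have S12: "\<bar>\<Sum>i<n. \<Sum>j<m. ?L12 (p i) (p (Suc i)) (q j) (q (Suc j))\<bar>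
      \<le> sew_const a * sew_const b * K * ((T * r powr (a - 1)) * T powr b)"
  proof -
    have s1: "(\<Sum>i<n. (p (Suc i) - p i) powr a) \<le> T * r powr (a - 1)"
      by (rule sum_powr_gaps) (use a p in auto)
    have s2: "(\<Sum>j<m. (q (Suc j) - q j) powr b) \<le> T * T powr (b - 1)"
    proof (rule sum_powr_gaps)
      show "q (Suc k) - q k \<le> T" if "k < m" for k using qr[OF that] by linarith
    qed (use b q in auto)
    have "\<bar>\<Sum>i<n. \<Sum>j<m. ?L12 (p i) (p (Suc i)) (q j) (q (Suc j))\<bar>
        \<le> (\<Sum>i<n. \<Sum>j<m. sew_const a * sew_const b * K * (p (Suc i) - p i) powr a * (q (Suc j) - q j) powr b)"
    proof (rule order_trans[OF sum_abs], rule sum_mono, rule order_trans[OF sum_abs], rule sum_mono)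
      fix i j assume "i \<in> {..<n}" "j \<in> {..<m}"
      then show "\<bar>?L12 (p i) (p (Suc i)) (q j) (q (Suc j))\<bar>
          \<le> sew_const a * sew_const b * K * (p (Suc i) - p i) powr a * (q (Suc j) - q j) powr b"
        using pr[of i] qr[of j] by (intro L12_sew(1)[OF g]) auto
    qed
    also have "\<dots> = sew_const a * sew_const b * K * ((\<Sum>i<n. (p (Suc i) - p i) powr a) * (\<Sum>j<m. (q (Suc j) - q j) powr b))"
      unfolding sum_product by (simp add: sum_distrib_left mult.assoc)
    also have "\<dots> \<le> sew_const a * sew_const b * K * ((T * r powr (a - 1)) * (T * T powr (b - 1)))"
    proof (rule mult_left_mono[OF mult_mono[OF s1 s2]])
      show "0 \<le> T * r powr (a - 1)" using T by simp
      show "0 \<le> (\<Sum>j<m. (q (Suc j) - q j) powr b)" by (intro sum_nonneg) simp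
      show "0 \<le> sew_const a * sew_const b * K" using posa posb K by simp
    qed
    also have "T * T powr (b - 1) = T powr b"
      using T by (cases "T = 0") (simp_all add: powr_diff)
    finally show ?thesis .
  qed
  define A where "A = K * T * r powr (a - 1)"
  define B where "B = K * T * r' powr (b - 1)"
  have AB: "A \<ge> 0" "B \<ge> 0" using K T by (auto simp: A_def B_def)
  have "\<bar>riemann_sum g p n q m - J (p 0) (p n) (q 0) (q m)\<bar> \<le>
      sew_const a * (1 + 2 * sew_const b * T powr b) * A + sew_const b * (1 + sew_const a * T powr a) * B"
    using S1 S2 S12 unfolding split A_def B_def by (simp add: algebra_simps)
  also have "\<dots> \<le> (sew_const a * (1 + 2 * sew_const b * T powr b) + sew_const b * (1 + sew_const a * T powr a)) * (A + B)"
    using AB posa posb by (simp add: algebra_simps)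
  also have "\<dots> = K * riemann_const T a b * (r powr (a - 1) + r' powr (b - 1))"
    by (simp add: riemann_const_def A_def B_def algebra_simps)
  finally show ?thesis by (simp add: J_def)
qed

section \<open>Hoelder norms and pointwise bounds\<close>

text \<open>The second defining condition of \<open>incr_space\<close>, separated from continuity.\<close>
definition vanishes_on_diagonals :: "real \<Rightarrow> nat \<Rightarrow> nat \<Rightarrow> incr \<Rightarrow> bool" where
  "vanishes_on_diagonals T k l f \<longleftrightarrow> (\<forall>s\<in>ordered_tuples T k. \<forall>t\<in>ordered_tuples T l.
     (\<exists>i. Suc i < k \<and> s ! i = s ! Suc i) \<or> (\<exists>j. Suc j < l \<and> t ! j = t ! Suc j) \<longrightarrow> f s t = 0)"

lemma tuple_simps [simp]:
  "[s1] \<in> ordered_tuples T (Suc 0) \<longleftrightarrow> 0 \<le> s1 \<and> s1 \<le> T"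
  "[s1, s2] \<in> ordered_tuples T 2 \<longleftrightarrow> 0 \<le> s1 \<and> s1 \<le> s2 \<and> s2 \<le> T"
  "[s1, s2, s3] \<in> ordered_tuples T 3 \<longleftrightarrow> 0 \<le> s1 \<and> s1 \<le> s2 \<and> s2 \<le> s3 \<and> s3 \<le> T"
  by (auto simp: ordered_tuples_def)

lemma tuple_cases:
  "s \<in> ordered_tuples T (Suc 0) \<Longrightarrow> \<exists>s1. s = [s1] \<and> 0 \<le> s1 \<and> s1 \<le> T"
  "s \<in> ordered_tuples T 2 \<Longrightarrow> \<exists>s1 s2. s = [s1, s2] \<and> 0 \<le> s1 \<and> s1 \<le> s2 \<and> s2 \<le> T"
  "s \<in> ordered_tuples T 3 \<Longrightarrow> \<exists>s1 s2 s3. s = [s1, s2, s3] \<and> 0 \<le> s1 \<and> s1 \<le> s2 \<and> s2 \<le> s3 \<and> s3 \<le> T"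
  by (auto simp: ordered_tuples_def numeral_2_eq_2 numeral_3_eq_3 length_Suc_conv)

lemma strict_tuples_ordered: "s \<in> strict_tuples T k \<Longrightarrow> s \<in> ordered_tuples T k"
  by (auto simp: strict_tuples_def ordered_tuples_def intro: sorted_wrt_mono_rel[of _ "(<)"])

lemma ordered_not_strict:
  assumes "s \<in> ordered_tuples T k" "s \<notin> strict_tuples T k"
  shows "\<exists>i. Suc i < k \<and> s ! i = s ! Suc i"
proof -
  have "\<not> sorted_wrt (<) s" using assms by (auto simp: strict_tuples_def ordered_tuples_def)
  then obtain i where i: "Suc i < length s" "\<not> s ! i < s ! Suc i"
    by (auto simp: sorted_wrt_iff_nth_Suc_transp)
  moreover have "s ! i \<le> s ! Suc i"
    using assms(1) i by (auto simp: ordered_tuples_def sorted_wrt_iff_nth_less)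
  ultimately show ?thesis using assms(1) by (intro exI[of _ i]) (auto simp: ordered_tuples_def)
qed

lemma holder_weight_simps [simp]:
  "holder_weight a [s1] = 1" "holder_weight a [s1, s2] = \<bar>s2 - s1\<bar> powr a" "holder_weight a [s1, s2, s3] = \<bar>s3 - s1\<bar> powr a"
  by (simp_all add: holder_weight_def)

lemma holder_weight_nonneg: "holder_weight a s \<ge> 0"
  by (simp add: holder_weight_def)

lemma strict_tuple_gap:
  assumes "s \<in> strict_tuples T k" "k > 1"
  shows "hd s < last s" "last s - hd s \<le> T"
proof -
  obtain a b r where s: "s = a # b # r"
    using assms by (cases s; cases "tl s") (auto simp: strict_tuples_def)
  have "last (b # r) \<in> set (b # r)" by (rule last_in_set) simp
  with assms(1) have "a < last (b # r)" "0 \<le> a" "last (b # r) \<le> T"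
    unfolding s strict_tuples_def by (auto simp del: last.simps)
  then show "hd s < last s" "last s - hd s \<le> T"
    by (auto simp: s)
qed

lemma holder_weight_pos:
  assumes "s \<in> strict_tuples T k" "k \<ge> 1"
  shows "holder_weight a s > 0"
  using strict_tuple_gap[OF assms(1)] assms by (cases "k = 1") (auto simp: holder_weight_def strict_tuples_def)

lemma holder_weight_exponent_lower:
  assumes "s \<in> strict_tuples T k" "k \<ge> 1" "a' \<le> a"
  shows "holder_weight a s \<le> max 1 (T powr (a - a')) * holder_weight a' s"
proof (cases "k = 1")
  case True
  then show ?thesis using assms by (simp add: holder_weight_def strict_tuples_def)
next
  case False
  then have "length s \<noteq> 1" "k > 1" using assms by (auto simp: strict_tuples_def)
  then show ?thesis
    using powr_exponent_lower[of "last s - hd s" T a' a] strict_tuple_gap[OF assms(1)] assms(3)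
    by (auto simp: holder_weight_def intro: order_trans mult_right_mono)
qed

lemma holder_norm_cong:
  assumes "\<And>s t. \<lbrakk>s \<in> ordered_tuples T k; t \<in> ordered_tuples T l\<rbrakk> \<Longrightarrow> \<bar>f s t\<bar> = \<bar>g s t\<bar>"
  shows "holder_norm T k l a b f = holder_norm T k l a b g"
  unfolding holder_norm_def by (intro SUP_cong refl) (use assms strict_tuples_ordered in auto)

lemma holder_norm_pointwise:
  assumes "holder_norm T k l a b f \<le> ennreal C" "C \<ge> 0"
    and s: "s \<in> strict_tuples T k" "k \<ge> 1" and t: "t \<in> strict_tuples T l" "l \<ge> 1"
  shows "\<bar>f s t\<bar> \<le> C * (holder_weight a s * holder_weight b t)"
proof -
  have "ennreal (\<bar>f s t\<bar> / (holder_weight a s * holder_weight b t)) \<le> holder_norm T k l a b f"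
    unfolding holder_norm_def using s t by (intro SUP_upper2[of "(s, t)"]) auto
  then have "\<bar>f s t\<bar> / (holder_weight a s * holder_weight b t) \<le> C"
    using assms(1,2) by (meson ennreal_le_iff order_trans)
  then show ?thesis
    using holder_weight_pos[OF s] holder_weight_pos[OF t] by (simp add: pos_divide_le_eq)
qed

text \<open>The pointwise form of \<open>holder_norm T k l a b f \<le> C\<close>, imposed on degenerate tuples as well.\<close>
definition holder_bounded :: "real \<Rightarrow> nat \<Rightarrow> nat \<Rightarrow> real \<Rightarrow> real \<Rightarrow> real \<Rightarrow> incr \<Rightarrow> bool" where
  "holder_bounded T k l a b C f \<longleftrightarrow> (\<forall>s\<in>ordered_tuples T k. \<forall>t\<in>ordered_tuples T l.
     \<bar>f s t\<bar> \<le> C * (holder_weight a s * holder_weight b t))"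

lemma holder_boundedD:
  "\<lbrakk>holder_bounded T k l a b C f; s \<in> ordered_tuples T k; t \<in> ordered_tuples T l\<rbrakk> \<Longrightarrow>
    \<bar>f s t\<bar> \<le> C * (holder_weight a s * holder_weight b t)"
  by (simp add: holder_bounded_def)

lemma holder_bounded_mono:
  assumes "holder_bounded T k l a b C f" "C \<le> C'"
  shows "holder_bounded T k l a b C' f"
  unfolding holder_bounded_def
proof (intro ballI)
  fix s t assume "s \<in> ordered_tuples T k" "t \<in> ordered_tuples T l"
  then have "\<bar>f s t\<bar> \<le> C * (holder_weight a s * holder_weight b t)"
    using assms(1) by (simp add: holder_bounded_def)
  also have "\<dots> \<le> C' * (holder_weight a s * holder_weight b t)"
    using assms(2) by (intro mult_right_mono) (simp_all add: holder_weight_nonneg)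
  finally show "\<bar>f s t\<bar> \<le> C' * (holder_weight a s * holder_weight b t)" .
qed

text \<open>What remains of convergence in a Hoelder norm: uniform bounds and pointwise convergence.\<close>
definition holder_limit :: "real \<Rightarrow> nat \<Rightarrow> nat \<Rightarrow> real \<Rightarrow> real \<Rightarrow> real \<Rightarrow> (nat \<Rightarrow> incr) \<Rightarrow> incr \<Rightarrow> bool" where
  "holder_limit T k l a b C F f \<longleftrightarrow> holder_bounded T k l a b C f \<and>
     (\<forall>\<^sub>F n in sequentially. holder_bounded T k l a b C (F n)) \<and>
     (\<forall>s\<in>ordered_tuples T k. \<forall>t\<in>ordered_tuples T l. (\<lambda>n. F n s t) \<longlonglongrightarrow> f s t)"

lemma holder_norm_finite:
  assumes "holder_bounded T k l a b C f" and "C \<ge> 0"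
  shows "holder_norm T k l a b f < \<infinity>"
proof -
  have "holder_norm T k l a b f \<le> ennreal C"
    unfolding holder_norm_def
  proof (rule SUP_least, clarify)
    fix s t assume "s \<in> strict_tuples T k" "t \<in> strict_tuples T l"
    then have "\<bar>f s t\<bar> \<le> C * (holder_weight a s * holder_weight b t)"
      using assms(1) strict_tuples_ordered by (auto simp: holder_bounded_def)
    moreover have "holder_weight a s * holder_weight b t \<ge> 0" by (simp add: holder_weight_nonneg)
    ultimately have "\<bar>f s t\<bar> / (holder_weight a s * holder_weight b t) \<le> C"
      using assms(2) by (cases "holder_weight a s * holder_weight b t = 0") (auto simp: divide_le_eq)
    then show "ennreal (\<bar>f s t\<bar> / (holder_weight a s * holder_weight b t)) \<le> ennreal C"
      by (rule ennreal_leI)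
  qed
  then show ?thesis by (rule le_less_trans) simp
qed

text \<open>
  Convergence in a Hoelder norm yields pointwise convergence, and bounds that are uniform in the
  sequence, with any smaller exponents.
\<close>
lemma holder_convergence:
  assumes fin: "holder_norm T k l a b f < \<infinity>"
    and lim: "(\<lambda>n. holder_norm T k l a b (\<lambda>s t. F n s t - f s t)) \<longlonglongrightarrow> 0"
    and f0: "vanishes_on_diagonals T k l f" and F0: "\<And>n. vanishes_on_diagonals T k l (F n)"
    and kl: "k \<ge> 1" "l \<ge> 1" and ab: "a' \<le> a" "b' \<le> b"
  shows "\<exists>C. holder_limit T k l a' b' C F f"
proof -
  obtain A where A: "A \<ge> 0" "holder_norm T k l a b f = ennreal A"
    using fin by (cases "holder_norm T k l a b f") auto
  define E where "E = max 1 (T powr (a - a')) * max 1 (T powr (b - b'))"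
  have E: "E \<ge> 0" by (simp add: E_def)
  have W: "holder_weight a s * holder_weight b t \<le> E * (holder_weight a' s * holder_weight b' t)"
    if "s \<in> strict_tuples T k" "t \<in> strict_tuples T l" for s t
    using mult_mono[OF holder_weight_exponent_lower[OF that(1) kl(1) ab(1)] holder_weight_exponent_lower[OF that(2) kl(2) ab(2)]]
    by (simp add: E_def holder_weight_nonneg mult_ac)
  have zero: "f s t = 0 \<and> (\<forall>n. F n s t = 0)"
    if "s \<in> ordered_tuples T k" "t \<in> ordered_tuples T l" "\<not> (s \<in> strict_tuples T k \<and> t \<in> strict_tuples T l)" for s t
    using that f0 F0 ordered_not_strict unfolding vanishes_on_diagonals_def by meson
  have small: "\<forall>\<^sub>F n in sequentially. holder_norm T k l a b (\<lambda>s t. F n s t - f s t) \<le> ennreal e" if "e > 0" for e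
    using order_tendstoD(2)[OF lim, of "ennreal e"] that by (auto elim: eventually_mono)
  show ?thesis unfolding holder_limit_def holder_bounded_def
  proof (intro exI[of _ "(A + 1) * E"] conjI ballI)
    have le: "c * (holder_weight a s * holder_weight b t) \<le> (A + 1) * E * (holder_weight a' s * holder_weight b' t)"
      if "s \<in> strict_tuples T k" "t \<in> strict_tuples T l" "c \<le> A + 1" for s t c
      using mult_mono[OF that(3) W[OF that(1,2)]] A by (simp add: holder_weight_nonneg mult_ac)
    have nn: "(A + 1) * E * (holder_weight a' s * holder_weight b' t) \<ge> 0" for s t
      using A E by (simp add: holder_weight_nonneg)
    have fb: "\<bar>f s t\<bar> \<le> A * (holder_weight a s * holder_weight b t)" if "s \<in> strict_tuples T k" "t \<in> strict_tuples T l" for s t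
      using A that kl by (intro holder_norm_pointwise[where k = k and l = l]) auto
    show "\<bar>f s t\<bar> \<le> (A + 1) * E * (holder_weight a' s * holder_weight b' t)"
      if st: "s \<in> ordered_tuples T k" "t \<in> ordered_tuples T l" for s t
    proof (cases "s \<in> strict_tuples T k \<and> t \<in> strict_tuples T l")
      case True
      then show ?thesis using order_trans[OF fb le[of s t A]] by simp
    next
      case False
      then show ?thesis using zero[OF st] nn by simp
    qed
    show "\<forall>\<^sub>F n in sequentially. \<forall>s\<in>ordered_tuples T k. \<forall>t\<in>ordered_tuples T l. \<bar>F n s t\<bar> \<le> (A + 1) * E * (holder_weight a' s * holder_weight b' t)"
      using small[of 1, OF zero_less_one]
    proof (rule eventually_mono, intro ballI)
      fix n s t
      assume n: "holder_norm T k l a b (\<lambda>s t. F n s t - f s t) \<le> ennreal 1" and st: "s \<in> ordered_tuples T k" "t \<in> ordered_tuples T l"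
      show "\<bar>F n s t\<bar> \<le> (A + 1) * E * (holder_weight a' s * holder_weight b' t)"
      proof (cases "s \<in> strict_tuples T k \<and> t \<in> strict_tuples T l")
        case True
        then have "\<bar>F n s t - f s t\<bar> \<le> 1 * (holder_weight a s * holder_weight b t)"
          using kl by (intro holder_norm_pointwise[OF n]) auto
        then have "\<bar>F n s t\<bar> \<le> (A + 1) * (holder_weight a s * holder_weight b t)"
          using fb[of s t] True by (simp add: distrib_right)
        then show ?thesis using le[of s t "A + 1"] True by simp
      next
        case False
        then show ?thesis using zero[OF st] nn by simp
      qed
    qed
    show "(\<lambda>n. F n s t) \<longlonglongrightarrow> f s t" if st: "s \<in> ordered_tuples T k" "t \<in> ordered_tuples T l" for s t
    proof (cases "s \<in> strict_tuples T k \<and> t \<in> strict_tuples T l")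
      case True
      define w where "w = holder_weight a s * holder_weight b t"
      have w: "w > 0" using True kl holder_weight_pos by (auto simp: w_def)
      show ?thesis
      proof (rule tendstoI)
        fix e :: real assume "e > 0"
        then have "e / (2 * w) > 0" using w by simp
        from small[OF this] show "\<forall>\<^sub>F n in sequentially. dist (F n s t) (f s t) < e"
        proof (rule eventually_mono)
          fix n assume "holder_norm T k l a b (\<lambda>s t. F n s t - f s t) \<le> ennreal (e / (2 * w))"
          then have "\<bar>F n s t - f s t\<bar> \<le> e / (2 * w) * w"
            unfolding w_def using True kl \<open>e / (2 * w) > 0\<close>
            by (intro holder_norm_pointwise[where k = k and l = l]) (auto simp: w_def)
          then show "dist (F n s t) (f s t) < e" using w \<open>e > 0\<close> by (simp add: dist_real_def)
        qed
      qed
    next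
      case False
      then show ?thesis using zero[OF st] by simp
    qed
  qed
qed

section \<open>Taylor estimates\<close>

text \<open>
  For \<open>i \<le> N\<close>, \<open>\<psi> i\<close> is the \<open>i\<close>-th derivative of \<open>\<psi> 0\<close>, and it is bounded by \<open>M\<close>.  The whole family is
  carried along, so that passing to a derivative is a shift of the index.
\<close>
definition bounded_derivs :: "real \<Rightarrow> (nat \<Rightarrow> real \<Rightarrow> real) \<Rightarrow> nat \<Rightarrow> bool" where
  "bounded_derivs M \<psi> N \<longleftrightarrow> (\<forall>i<N. \<forall>u. (\<psi> i has_real_derivative \<psi> (Suc i) u) (at u)) \<and>
     (\<forall>i\<le>N. \<forall>u. \<bar>\<psi> i u\<bar> \<le> M)"

lemma bounded_derivs_Suc:
  "bounded_derivs M \<psi> (Suc N) \<Longrightarrow> bounded_derivs M (\<lambda>i. \<psi> (Suc i)) N"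
  by (auto simp: bounded_derivs_def)

lemma bounded_derivs_mono:
  "\<lbrakk>bounded_derivs M \<psi> N; n \<le> N\<rbrakk> \<Longrightarrow> bounded_derivs M \<psi> n"
  by (auto simp: bounded_derivs_def)

lemma bounded_derivs_nonneg: "bounded_derivs M \<psi> N \<Longrightarrow> M \<ge> 0"
  unfolding bounded_derivs_def by (metis abs_ge_zero le0 order_trans)

lemma abs_mult_le:
  fixes a b :: real
  assumes "\<bar>a\<bar> \<le> A" "\<bar>b\<bar> \<le> B"
  shows "\<bar>a * b\<bar> \<le> A * B"
  using assms by (simp add: abs_mult mult_mono')

lemma abs_add_le:
  fixes a b :: real
  assumes "\<bar>a\<bar> \<le> A" "\<bar>b\<bar> \<le> B"
  shows "\<bar>a + b\<bar> \<le> A + B"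
  using assms by linarith

lemma lipschitz_bound:
  assumes "bounded_derivs M \<psi> (Suc N)"
  shows "\<bar>\<psi> 0 q - \<psi> 0 p\<bar> \<le> M * \<bar>q - p\<bar>"
proof -
  have "norm (\<psi> 0 q - \<psi> 0 p) \<le> M * norm (q - p)"
    by (rule field_differentiable_bound[of UNIV "\<psi> 0" "\<psi> 1"])
      (use assms in \<open>auto simp: bounded_derivs_def\<close>)
  then show ?thesis by simp
qed

lemma taylor_bound:
  assumes "bounded_derivs M \<psi> (Suc (Suc N))"
  shows "\<bar>\<psi> 0 q - \<psi> 0 p - \<psi> 1 p * (q - p)\<bar> \<le> M * \<bar>q - p\<bar>\<^sup>2"
proof -
  have "norm ((\<psi> 0 q - \<psi> 1 p * q) - (\<psi> 0 p - \<psi> 1 p * p)) \<le> (M * \<bar>q - p\<bar>) * norm (q - p)"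
  proof (rule field_differentiable_bound[of "closed_segment p q"])
    fix u assume u: "u \<in> closed_segment p q"
    show "((\<lambda>u. \<psi> 0 u - \<psi> 1 p * u) has_real_derivative \<psi> 1 u - \<psi> 1 p) (at u within closed_segment p q)"
    proof (rule has_field_derivative_at_within)
      have "(\<psi> 0 has_real_derivative \<psi> 1 u) (at u)" using assms by (auto simp: bounded_derivs_def)
      then show "((\<lambda>u. \<psi> 0 u - \<psi> 1 p * u) has_real_derivative \<psi> 1 u - \<psi> 1 p) (at u)"
        by (auto intro!: derivative_eq_intros)
    qed
    have "\<bar>\<psi> 1 u - \<psi> 1 p\<bar> \<le> M * \<bar>u - p\<bar>"
      using lipschitz_bound[OF bounded_derivs_Suc[OF assms]] by simp
    also have "\<dots> \<le> M * \<bar>q - p\<bar>"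
      using u bounded_derivs_nonneg[OF assms] by (intro mult_left_mono) (auto simp: closed_segment_eq_real_ivl split: if_splits)
    finally show "norm (\<psi> 1 u - \<psi> 1 p) \<le> M * \<bar>q - p\<bar>" by simp
  qed auto
  then show ?thesis by (simp add: power2_eq_square algebra_simps)
qed

text \<open>
  The dependence of an increment, and of a Taylor remainder, on its two end points: both estimates
  come from differentiating along the segment from \<open>(p, q)\<close> to \<open>(p', q')\<close>.
\<close>
lemma increment_difference_bound:
  assumes \<psi>: "bounded_derivs M \<psi> (Suc (Suc N))"
    and "\<bar>q - p\<bar> \<le> \<epsilon>" "\<bar>q' - p'\<bar> \<le> \<epsilon>" and \<eta>: "\<bar>q' - q\<bar> \<le> \<eta>" and \<theta>: "\<bar>q' - p' - q + p\<bar> \<le> \<theta>"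
  shows "\<bar>(\<psi> 0 q' - \<psi> 0 p') - (\<psi> 0 q - \<psi> 0 p)\<bar> \<le> M * \<epsilon> * \<eta> + M * \<theta>"
proof -
  have M: "\<bar>\<psi> 1 u\<bar> \<le> M" for u using \<psi> by (auto simp: bounded_derivs_def)
  have D: "(\<psi> 0 has_real_derivative \<psi> 1 u) (at u)" for u
    using \<psi> by (auto simp: bounded_derivs_def)
  define P where "P r = p + r * (p' - p)" for r
  define Q where "Q r = q + r * (q' - q)" for r
  have "\<exists>r::real. 0 < r \<and> r < 1 \<and> (\<psi> 0 (Q 1) - \<psi> 0 (P 1)) - (\<psi> 0 (Q 0) - \<psi> 0 (P 0))
      = (1 - 0) * (\<psi> 1 (Q r) * (q' - q) - \<psi> 1 (P r) * (p' - p))"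
    by (intro MVT2) (auto simp: P_def Q_def intro!: derivative_eq_intros DERIV_chain2[OF D])
  then obtain r :: real where r: "0 < r" "r < 1" and eq: "(\<psi> 0 q' - \<psi> 0 p') - (\<psi> 0 q - \<psi> 0 p)
      = \<psi> 1 (Q r) * (q' - q) - \<psi> 1 (P r) * (p' - p)"
    by (auto simp: P_def Q_def)
  have "Q r - P r = (1 - r) * (q - p) + r * (q' - p')" by (simp add: P_def Q_def algebra_simps)
  also have "\<bar>\<dots>\<bar> \<le> (1 - r) * \<epsilon> + r * \<epsilon>"
    using r assms(2,3) by (intro abs_add_le) (auto simp: abs_mult)
  finally have QP: "\<bar>Q r - P r\<bar> \<le> \<epsilon>" by (simp add: algebra_simps)
  have "\<bar>\<psi> 1 (Q r) - \<psi> 1 (P r)\<bar> \<le> M * \<epsilon>"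
    using lipschitz_bound[OF bounded_derivs_Suc[OF \<psi>], of "Q r" "P r"] mult_left_mono[OF QP bounded_derivs_nonneg[OF \<psi>]]
    by simp
  then have "\<bar>(\<psi> 1 (Q r) - \<psi> 1 (P r)) * (q' - q) + \<psi> 1 (P r) * (q' - p' - q + p)\<bar> \<le> M * \<epsilon> * \<eta> + M * \<theta>"
    using \<eta> \<theta> M by (intro abs_add_le abs_mult_le) auto
  then show ?thesis unfolding eq by (simp add: algebra_simps)
qed

lemma remainder_difference_bound:
  assumes \<psi>: "bounded_derivs M \<psi> (Suc (Suc (Suc N)))"
    and "\<bar>q - p\<bar> \<le> \<epsilon>" "\<bar>q' - p'\<bar> \<le> \<epsilon>" and \<eta>: "\<bar>q' - q\<bar> \<le> \<eta>" and \<theta>: "\<bar>q' - p' - q + p\<bar> \<le> \<theta>"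
  shows "\<bar>(\<psi> 0 q' - \<psi> 0 p' - \<psi> 1 p' * (q' - p')) - (\<psi> 0 q - \<psi> 0 p - \<psi> 1 p * (q - p))\<bar> \<le> M * \<epsilon>\<^sup>2 * \<eta> + M * \<epsilon> * \<theta>"
proof -
  have D: "(\<psi> 0 has_real_derivative \<psi> 1 u) (at u)" "(\<psi> 1 has_real_derivative \<psi> 2 u) (at u)" for u
    using \<psi> by (auto simp: bounded_derivs_def numeral_2_eq_2)
  define P where "P r = p + r * (p' - p)" for r
  define Q where "Q r = q + r * (q' - q)" for r
  have PQ: "P 0 = p" "P 1 = p'" "Q 0 = q" "Q 1 = q'" by (auto simp: P_def Q_def)
  have dP: "(P has_real_derivative p' - p) (at r)" and dQ: "(Q has_real_derivative q' - q) (at r)" for r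
    unfolding P_def Q_def by (auto intro!: derivative_eq_intros)
  have "\<exists>r::real. 0 < r \<and> r < 1 \<and> (\<psi> 0 (Q 1) - \<psi> 0 (P 1) - \<psi> 1 (P 1) * (Q 1 - P 1)) - (\<psi> 0 (Q 0) - \<psi> 0 (P 0) - \<psi> 1 (P 0) * (Q 0 - P 0))
      = (1 - 0) * (\<psi> 1 (Q r) * (q' - q) - \<psi> 1 (P r) * (p' - p)
         - (\<psi> 1 (P r) * (q' - q - (p' - p)) + \<psi> 2 (P r) * (p' - p) * (Q r - P r)))"
  proof (intro MVT2)
    fix r :: real
    note c = DERIV_chain2[OF D(1) dQ, of r] DERIV_chain2[OF D(1) dP, of r] DERIV_chain2[OF D(2) dP, of r]
    have "((\<lambda>r. \<psi> 0 (Q r) - \<psi> 0 (P r) - \<psi> 1 (P r) * (Q r - P r)) has_real_derivative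
        \<psi> 1 (Q r) * (q' - q) - \<psi> 1 (P r) * (p' - p)
         - (\<psi> 2 (P r) * (p' - p) * (Q r - P r) + (q' - q - (p' - p)) * \<psi> 1 (P r))) (at r)"
      by (intro DERIV_diff DERIV_mult c dP dQ)
    then show "((\<lambda>r. \<psi> 0 (Q r) - \<psi> 0 (P r) - \<psi> 1 (P r) * (Q r - P r)) has_real_derivative
        \<psi> 1 (Q r) * (q' - q) - \<psi> 1 (P r) * (p' - p)
         - (\<psi> 1 (P r) * (q' - q - (p' - p)) + \<psi> 2 (P r) * (p' - p) * (Q r - P r))) (at r)"
      by (simp only: add.commute mult.commute)
  qed simp
  then obtain r where r: "0 < r" "r < 1" and eq: "(\<psi> 0 q' - \<psi> 0 p' - \<psi> 1 p' * (q' - p')) - (\<psi> 0 q - \<psi> 0 p - \<psi> 1 p * (q - p))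
      = \<psi> 1 (Q r) * (q' - q) - \<psi> 1 (P r) * (p' - p)
         - (\<psi> 1 (P r) * (q' - q - (p' - p)) + \<psi> 2 (P r) * (p' - p) * (Q r - P r))"
    unfolding PQ by auto
  have "Q r - P r = (1 - r) * (q - p) + r * (q' - p')" by (simp add: P_def Q_def algebra_simps)
  also have "\<bar>\<dots>\<bar> \<le> (1 - r) * \<epsilon> + r * \<epsilon>"
    using r assms(2,3) by (intro abs_add_le) (auto simp: abs_mult)
  finally have QP: "\<bar>Q r - P r\<bar> \<le> \<epsilon>" by (simp add: algebra_simps)
  have "\<bar>Q r - P r\<bar>\<^sup>2 \<le> \<epsilon>\<^sup>2" using QP by (intro power_mono) auto
  then have 1: "\<bar>\<psi> 1 (Q r) - \<psi> 1 (P r) - \<psi> 2 (P r) * (Q r - P r)\<bar> \<le> M * \<epsilon>\<^sup>2"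
    using taylor_bound[OF bounded_derivs_Suc[OF \<psi>], of "Q r" "P r"] bounded_derivs_nonneg[OF \<psi>]
    by (auto simp: numeral_2_eq_2 intro: order_trans mult_left_mono)
  have 2: "\<bar>\<psi> 2 (P r) * (Q r - P r)\<bar> \<le> M * \<epsilon>"
    using \<psi> QP by (intro abs_mult_le) (auto simp: bounded_derivs_def)
  have "\<bar>(\<psi> 1 (Q r) - \<psi> 1 (P r) - \<psi> 2 (P r) * (Q r - P r)) * (q' - q) + \<psi> 2 (P r) * (Q r - P r) * (q' - p' - q + p)\<bar>
      \<le> M * \<epsilon>\<^sup>2 * \<eta> + M * \<epsilon> * \<theta>"
    by (intro abs_add_le abs_mult_le 1 2 \<eta> \<theta>)
  then show ?thesis unfolding eq by (simp add: algebra_simps)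
qed

section \<open>Controlled integrands\<close>

text \<open>The integrand \<open>\<psi>(x) w + \<psi>'(x) z\<close>, where the family \<open>\<psi>\<close> lists a function and its derivatives.\<close>
definition controlled_integrand :: "(nat \<Rightarrow> real \<Rightarrow> real) \<Rightarrow> incr \<Rightarrow> incr \<Rightarrow> incr \<Rightarrow> incr" where
  "controlled_integrand \<psi> x w z = (\<lambda>s t. incr_mult 1 1 (\<lambda>s t. \<psi> 0 (x s t)) w s t + incr_mult 1 1 (\<lambda>s t. \<psi> 1 (x s t)) z s t)"

lemma controlled_integrand_eq [simp]:
  "controlled_integrand \<psi> x w z [s1, s2] [t1, t2] = \<psi> 0 (x [s1] [t1]) * w [s1, s2] [t1, t2] + \<psi> 1 (x [s1] [t1]) * z [s1, s2] [t1, t2]"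
  by (simp add: controlled_integrand_def incr_mult_def)

text \<open>
  The part of a rough sheet that matters for integration against \<open>w = \<integral>\<integral> D\<^sup>i\<^sup>j x\<close>: the increment \<open>z\<close> is
  \<open>x\<^sup>1\<^sup>i\<^sup>;\<^sup>0\<^sup>\<cdot>\<^sup>j\<close>, and \<open>v\<close> is \<open>x\<^sup>1\<^sup>i\<^sup>;\<^sup>2\<^sup>\<cdot>\<^sup>j\<close>.  All bounds have one common constant \<open>M\<close>.
\<close>
locale sheet_component =
  fixes T \<gamma>1 \<gamma>2 M :: real and x w z v :: incr
  assumes M: "M \<ge> 1" and \<gamma>1: "\<gamma>1 > 1 / 3" and \<gamma>2: "\<gamma>2 > 1 / 2"
    and w_additive1: "\<lbrakk>0 \<le> s1; s1 \<le> s2; s2 \<le> s3; s3 \<le> T; 0 \<le> t1; t1 \<le> t2; t2 \<le> T\<rbrakk> \<Longrightarrow>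
      delta1 w [s1, s2, s3] [t1, t2] = 0"
    and w_additive2: "\<lbrakk>0 \<le> s1; s1 \<le> s2; s2 \<le> T; 0 \<le> t1; t1 \<le> t2; t2 \<le> t3; t3 \<le> T\<rbrakk> \<Longrightarrow>
      delta2 w [s1, s2] [t1, t2, t3] = 0"
    and z_delta1: "\<lbrakk>0 \<le> s1; s1 \<le> s2; s2 \<le> s3; s3 \<le> T; 0 \<le> t1; t1 \<le> t2; t2 \<le> T\<rbrakk> \<Longrightarrow>
      delta1 z [s1, s2, s3] [t1, t2] = delta1 x [s1, s2] [t1] * w [s2, s3] [t1, t2]"
    and z_delta2: "\<lbrakk>0 \<le> s1; s1 \<le> s2; s2 \<le> T; 0 \<le> t1; t1 \<le> t2; t2 \<le> t3; t3 \<le> T\<rbrakk> \<Longrightarrow>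
      delta2 z [s1, s2] [t1, t2, t3] = - v [s1, s2] [t1, t2, t3]"
    and bounds: "holder_bounded T 2 1 \<gamma>1 0 M (delta1 x)" "holder_bounded T 1 2 0 \<gamma>2 M (delta2 x)"
      "holder_bounded T 2 2 \<gamma>1 \<gamma>2 M (delta x)" "holder_bounded T 2 2 \<gamma>1 \<gamma>2 M w"
      "holder_bounded T 2 2 (2 * \<gamma>1) \<gamma>2 M z" "holder_bounded T 2 3 (2 * \<gamma>1) (2 * \<gamma>2) M v"
begin

lemma x_bounds:
  assumes "0 \<le> s1" "s1 \<le> s2" "s2 \<le> T" "0 \<le> t1" "t1 \<le> t2" "t2 \<le> T"
  shows "\<bar>delta1 x [s1, s2] [t1]\<bar> \<le> M * (s2 - s1) powr \<gamma>1"
    and "\<bar>delta2 x [s1] [t1, t2]\<bar> \<le> M * (t2 - t1) powr \<gamma>2"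
    and "\<bar>delta x [s1, s2] [t1, t2]\<bar> \<le> M * ((s2 - s1) powr \<gamma>1 * (t2 - t1) powr \<gamma>2)"
  using holder_boundedD[OF bounds(1), of "[s1, s2]" "[t1]"]
    holder_boundedD[OF bounds(2), of "[s1]" "[t1, t2]"]
    holder_boundedD[OF bounds(3), of "[s1, s2]" "[t1, t2]"] assms by simp_all

lemma w_bound: "\<lbrakk>0 \<le> s1; s1 \<le> s2; s2 \<le> T; 0 \<le> t1; t1 \<le> t2; t2 \<le> T\<rbrakk> \<Longrightarrow>
    \<bar>w [s1, s2] [t1, t2]\<bar> \<le> M * ((s2 - s1) powr \<gamma>1 * (t2 - t1) powr \<gamma>2)"
  using holder_boundedD[OF bounds(4), of "[s1, s2]" "[t1, t2]"] by simp

lemma z_bound: "\<lbrakk>0 \<le> s1; s1 \<le> s2; s2 \<le> T; 0 \<le> t1; t1 \<le> t2; t2 \<le> T\<rbrakk> \<Longrightarrow>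
    \<bar>z [s1, s2] [t1, t2]\<bar> \<le> M * ((s2 - s1) powr (2 * \<gamma>1) * (t2 - t1) powr \<gamma>2)"
  using holder_boundedD[OF bounds(5), of "[s1, s2]" "[t1, t2]"] by simp

lemma v_bound: "\<lbrakk>0 \<le> s1; s1 \<le> s2; s2 \<le> T; 0 \<le> t1; t1 \<le> t2; t2 \<le> t3; t3 \<le> T\<rbrakk> \<Longrightarrow>
    \<bar>v [s1, s2] [t1, t2, t3]\<bar> \<le> M * ((s2 - s1) powr (2 * \<gamma>1) * (t3 - t1) powr (2 * \<gamma>2))"
  using holder_boundedD[OF bounds(6), of "[s1, s2]" "[t1, t2, t3]"] by simp

lemma powr_multiples:
  fixes r \<gamma> :: real
  shows "r powr (2 * \<gamma>) = (r powr \<gamma>)\<^sup>2" "r powr (3 * \<gamma>) = (r powr \<gamma>) ^ 3"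
  by (cases "r = 0"; simp add: powr_power)+

lemma powr_chain:
  "\<lbrakk>0 \<le> r; r \<le> r'\<rbrakk> \<Longrightarrow> r powr \<gamma>1 \<le> r' powr \<gamma>1" "\<lbrakk>0 \<le> r; r \<le> r'\<rbrakk> \<Longrightarrow> r powr \<gamma>2 \<le> r' powr \<gamma>2"
  using \<gamma>1 \<gamma>2 by (auto intro: powr_mono2)

lemma scaled_bound: "\<lbrakk>\<bar>a\<bar> \<le> M * b; b \<le> c\<rbrakk> \<Longrightarrow> \<bar>a\<bar> \<le> M * c"
  using M by (meson dual_order.trans mult_left_mono order_trans zero_le_one)

context
  fixes \<psi> :: "nat \<Rightarrow> real \<Rightarrow> real"
  assumes \<psi>: "bounded_derivs M \<psi> 3"
begin

lemma psi_derivs: "bounded_derivs M \<psi> (Suc (Suc (Suc 0)))" "bounded_derivs M (\<lambda>i. \<psi> (Suc i)) (Suc (Suc 0))"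
  using \<psi> bounded_derivs_Suc[of M \<psi> 2] by (auto simp: numeral_3_eq_3 numeral_2_eq_2)

text \<open>
  The coboundaries of the integrand.  The first is a second order Taylor remainder times \<open>w\<close> plus a
  first order increment times \<open>z\<close>, both of order \<open>3 \<gamma>1\<close>: this is what the term \<open>\<psi>'(x) z\<close> is for.
\<close>
lemma integrand_delta1:
  assumes st: "0 \<le> s1" "s1 \<le> s2" "s2 \<le> s3" "s3 \<le> T" "0 \<le> t1" "t1 \<le> t2" "t2 \<le> T"
  shows "delta1 (controlled_integrand \<psi> x w z) [s1, s2, s3] [t1, t2] =
    - (\<psi> 0 (x [s2] [t1]) - \<psi> 0 (x [s1] [t1]) - \<psi> 1 (x [s1] [t1]) * (x [s2] [t1] - x [s1] [t1])) * w [s2, s3] [t1, t2]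
    - (\<psi> 1 (x [s2] [t1]) - \<psi> 1 (x [s1] [t1])) * z [s2, s3] [t1, t2]"
proof -
  have w: "w [s1, s3] [t1, t2] = w [s1, s2] [t1, t2] + w [s2, s3] [t1, t2]"
    using w_additive1[OF st] by simp
  have z: "z [s1, s3] [t1, t2] = z [s1, s2] [t1, t2] + z [s2, s3] [t1, t2] + (x [s2] [t1] - x [s1] [t1]) * w [s2, s3] [t1, t2]"
    using z_delta1[OF st] by simp
  show ?thesis by (simp add: w z algebra_simps)
qed

lemma integrand_delta2:
  assumes st: "0 \<le> s1" "s1 \<le> s2" "s2 \<le> T" "0 \<le> t1" "t1 \<le> t2" "t2 \<le> t3" "t3 \<le> T"
  shows "delta2 (controlled_integrand \<psi> x w z) [s1, s2] [t1, t2, t3] =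
    - (\<psi> 0 (x [s1] [t2]) - \<psi> 0 (x [s1] [t1])) * w [s1, s2] [t2, t3]
    - (\<psi> 1 (x [s1] [t2]) - \<psi> 1 (x [s1] [t1])) * z [s1, s2] [t2, t3]
    - \<psi> 1 (x [s1] [t1]) * v [s1, s2] [t1, t2, t3]"
proof -
  have w: "w [s1, s2] [t1, t3] = w [s1, s2] [t1, t2] + w [s1, s2] [t2, t3]"
    using w_additive2[OF st] by simp
  have z: "z [s1, s2] [t1, t3] = z [s1, s2] [t1, t2] + z [s1, s2] [t2, t3] - v [s1, s2] [t1, t2, t3]"
    using z_delta2[OF st] by simp
  show ?thesis by (simp add: w z algebra_simps)
qed

lemma integrand_delta1_bound:
  assumes st: "0 \<le> s1" "s1 \<le> s2" "s2 \<le> s3" "s3 \<le> T" "0 \<le> t1" "t1 \<le> t2" "t2 \<le> T"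
  shows "\<bar>delta1 (controlled_integrand \<psi> x w z) [s1, s2, s3] [t1, t2]\<bar>
    \<le> 2 * M ^ 4 * ((s3 - s1) powr (3 * \<gamma>1) * (t2 - t1) powr \<gamma>2)"
proof -
  define S R where "S = (s3 - s1) powr \<gamma>1" and "R = (t2 - t1) powr \<gamma>2"
  have SR: "S \<ge> 0" "R \<ge> 0" by (auto simp: S_def R_def)
  have S12: "(s2 - s1) powr \<gamma>1 \<le> S" and S23: "(s3 - s2) powr \<gamma>1 \<le> S"
    using st powr_chain by (auto simp: S_def)
  have x: "\<bar>x [s2] [t1] - x [s1] [t1]\<bar> \<le> M * S"
    using scaled_bound[OF x_bounds(1)[of s1 s2 t1 t1] S12] st by simp
  have w: "\<bar>w [s2, s3] [t1, t2]\<bar> \<le> M * (S * R)"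
    unfolding R_def using st by (intro scaled_bound[OF w_bound] mult_right_mono S23) auto
  have z: "\<bar>z [s2, s3] [t1, t2]\<bar> \<le> M * (S\<^sup>2 * R)"
    unfolding R_def using st S23 by (intro scaled_bound[OF z_bound] mult_right_mono) (auto simp: powr_multiples power_mono)
  have "\<bar>\<psi> 0 (x [s2] [t1]) - \<psi> 0 (x [s1] [t1]) - \<psi> 1 (x [s1] [t1]) * (x [s2] [t1] - x [s1] [t1])\<bar> \<le> M * (M * S)\<^sup>2"
    using M x by (intro order_trans[OF taylor_bound[OF psi_derivs(1)]] mult_left_mono power_mono) auto
  moreover have "\<bar>\<psi> 1 (x [s2] [t1]) - \<psi> 1 (x [s1] [t1])\<bar> \<le> M * (M * S)"
    using lipschitz_bound[OF psi_derivs(2), of "x [s2] [t1]" "x [s1] [t1]"] scaled_bound[OF _ x] by simp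
  ultimately have "\<bar>delta1 (controlled_integrand \<psi> x w z) [s1, s2, s3] [t1, t2]\<bar>
      \<le> M * (M * S)\<^sup>2 * (M * (S * R)) + M * (M * S) * (M * (S\<^sup>2 * R))"
    unfolding integrand_delta1[OF st] diff_conv_add_uminus[of "_ * _" "_ * _"] minus_mult_left[of _ "z _ _"]
    using w z by (intro abs_add_le abs_mult_le) auto
  also have "\<dots> = (M ^ 4 + M ^ 3) * (S ^ 3 * R)" by (simp add: power2_eq_square power3_eq_cube power4_eq_xxxx algebra_simps)
  also have "\<dots> \<le> 2 * M ^ 4 * (S ^ 3 * R)"
    using M SR power_increasing[of 3 4 M] by (intro mult_right_mono) auto
  finally show ?thesis by (simp add: powr_multiples S_def R_def)
qed

lemma integrand_delta2_bound:
  assumes st: "0 \<le> s1" "s1 \<le> s2" "s2 \<le> T" "0 \<le> t1" "t1 \<le> t2" "t2 \<le> t3" "t3 \<le> T"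
  shows "\<bar>delta2 (controlled_integrand \<psi> x w z) [s1, s2] [t1, t2, t3]\<bar>
    \<le> 2 * M ^ 3 * (1 + T powr \<gamma>1) * ((s2 - s1) powr \<gamma>1 * (t3 - t1) powr (2 * \<gamma>2))"
proof -
  define S R where "S = (s2 - s1) powr \<gamma>1" and "R = (t3 - t1) powr \<gamma>2"
  have SR: "S \<ge> 0" "R \<ge> 0" "S \<le> T powr \<gamma>1" using st powr_chain by (auto simp: S_def R_def)
  have R12: "(t2 - t1) powr \<gamma>2 \<le> R" and R23: "(t3 - t2) powr \<gamma>2 \<le> R"
    using st powr_chain by (auto simp: R_def)
  have x: "\<bar>x [s1] [t2] - x [s1] [t1]\<bar> \<le> M * R"
    using scaled_bound[OF x_bounds(2)[of s1 s1 t1 t2] R12] st by simp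
  have w: "\<bar>w [s1, s2] [t2, t3]\<bar> \<le> M * (S * R)"
    unfolding S_def using st by (intro scaled_bound[OF w_bound] mult_left_mono R23) auto
  have z: "\<bar>z [s1, s2] [t2, t3]\<bar> \<le> M * (S\<^sup>2 * R)"
    unfolding S_def powr_multiples[symmetric] using st by (intro scaled_bound[OF z_bound] mult_left_mono R23) auto
  have v: "\<bar>v [s1, s2] [t1, t2, t3]\<bar> \<le> M * (S\<^sup>2 * R\<^sup>2)"
    using v_bound[OF st] by (simp add: powr_multiples S_def R_def)
  have "\<bar>\<psi> 0 (x [s1] [t2]) - \<psi> 0 (x [s1] [t1])\<bar> \<le> M * (M * R)"
    using lipschitz_bound[OF psi_derivs(1), of "x [s1] [t2]" "x [s1] [t1]"] scaled_bound[OF _ x] by simp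
  moreover have "\<bar>\<psi> 1 (x [s1] [t2]) - \<psi> 1 (x [s1] [t1])\<bar> \<le> M * (M * R)"
    using lipschitz_bound[OF psi_derivs(2), of "x [s1] [t2]" "x [s1] [t1]"] scaled_bound[OF _ x] by simp
  moreover have "\<bar>\<psi> 1 (x [s1] [t1])\<bar> \<le> M" using \<psi> by (simp add: bounded_derivs_def)
  ultimately have "\<bar>delta2 (controlled_integrand \<psi> x w z) [s1, s2] [t1, t2, t3]\<bar>
      \<le> M * (M * R) * (M * (S * R)) + M * (M * R) * (M * (S\<^sup>2 * R)) + M * (M * (S\<^sup>2 * R\<^sup>2))"
    unfolding integrand_delta2[OF st] diff_conv_add_uminus[of _ "_ * _"] minus_mult_left[of _ "z _ _"] minus_mult_left[of _ "v _ _"]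
    using w z v by (intro abs_add_le abs_mult_le) auto
  also have "\<dots> = (M ^ 3 + (M ^ 3 + M ^ 2) * S) * (S * R\<^sup>2)" by (simp add: power2_eq_square power3_eq_cube algebra_simps)
  also have "\<dots> \<le> 2 * M ^ 3 * (1 + T powr \<gamma>1) * (S * R\<^sup>2)"
  proof (intro mult_right_mono)
    have "M ^ 2 \<le> M ^ 3" "0 \<le> M ^ 3" using M power_increasing[of 2 3 M] by auto
    then have "(M ^ 3 + M ^ 2) * S \<le> (2 * M ^ 3) * T powr \<gamma>1" using SR by (intro mult_mono) auto
    then show "M ^ 3 + (M ^ 3 + M ^ 2) * S \<le> 2 * M ^ 3 * (1 + T powr \<gamma>1)"
      using \<open>0 \<le> M ^ 3\<close> unfolding distrib_left by linarith
  qed (use SR in auto)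
  finally show ?thesis by (simp add: powr_multiples S_def R_def)
qed

lemma integrand_delta_bound:
  assumes st: "0 \<le> s1" "s1 \<le> s2" "s2 \<le> s3" "s3 \<le> T" "0 \<le> t1" "t1 \<le> t2" "t2 \<le> t3" "t3 \<le> T"
  shows "\<bar>delta (controlled_integrand \<psi> x w z) [s1, s2, s3] [t1, t2, t3]\<bar>
    \<le> 5 * M ^ 5 * ((s3 - s1) powr (3 * \<gamma>1) * (t3 - t1) powr (2 * \<gamma>2))"
proof -
  define S R where "S = (s3 - s1) powr \<gamma>1" and "R = (t3 - t1) powr \<gamma>2"
  have SR: "S \<ge> 0" "R \<ge> 0" by (auto simp: S_def R_def)
  have S12: "(s2 - s1) powr \<gamma>1 \<le> S" and S23: "(s3 - s2) powr \<gamma>1 \<le> S"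
    and R12: "(t2 - t1) powr \<gamma>2 \<le> R" and R23: "(t3 - t2) powr \<gamma>2 \<le> R"
    using st powr_chain by (auto simp: S_def R_def)
  have x1: "\<bar>x [s2] [t] - x [s1] [t]\<bar> \<le> M * S" if "t \<in> {t1, t2}" for t
    using scaled_bound[OF x_bounds(1)[of s1 s2 t t] S12] st that by auto
  have x2: "\<bar>x [s2] [t2] - x [s2] [t1]\<bar> \<le> M * R"
    using scaled_bound[OF x_bounds(2)[of s2 s2 t1 t2] R12] st by simp
  have "\<bar>delta x [s1, s2] [t1, t2]\<bar> \<le> M * (S * R)"
    using st SR by (intro scaled_bound[OF x_bounds(3)] mult_mono S12 R12) auto
  then have x12: "\<bar>x [s2] [t2] - x [s1] [t2] - x [s2] [t1] + x [s1] [t1]\<bar> \<le> M * (S * R)"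
    by (simp add: delta_def algebra_simps)
  have w: "\<bar>w [s2, s3] [t2, t3]\<bar> \<le> M * (S * R)"
    using st SR by (intro scaled_bound[OF w_bound] mult_mono S23 R23) auto
  have z: "\<bar>z [s2, s3] [t2, t3]\<bar> \<le> M * (S\<^sup>2 * R)"
    using st S23 SR by (intro scaled_bound[OF z_bound] mult_mono R23) (auto simp: powr_multiples power_mono)
  have v: "\<bar>v [s2, s3] [t1, t2, t3]\<bar> \<le> M * (S\<^sup>2 * R\<^sup>2)"
    using st S23 SR R_def by (intro scaled_bound[OF v_bound] mult_mono) (auto simp: powr_multiples power_mono)
  define A where "A t = \<psi> 0 (x [s2] [t]) - \<psi> 0 (x [s1] [t]) - \<psi> 1 (x [s1] [t]) * (x [s2] [t] - x [s1] [t])" for t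
  define B where "B t = \<psi> 1 (x [s2] [t]) - \<psi> 1 (x [s1] [t])" for t
  have A: "\<bar>A t2 - A t1\<bar> \<le> M * (M * S)\<^sup>2 * (M * R) + M * (M * S) * (M * (S * R))"
    unfolding A_def by (rule remainder_difference_bound[OF psi_derivs(1)]) (use x1 x2 x12 in auto)
  have B: "\<bar>B t2 - B t1\<bar> \<le> M * (M * S) * (M * R) + M * (M * (S * R))"
    unfolding B_def using increment_difference_bound[OF psi_derivs(2), where p = "x [s1] [t1]" and p' = "x [s1] [t2]"] x1 x2 x12 by simp
  have B1: "\<bar>B t1\<bar> \<le> M * (M * S)"
    unfolding B_def using lipschitz_bound[OF psi_derivs(2), of "x [s2] [t1]" "x [s1] [t1]"] scaled_bound[OF _ x1[of t1]] by simp
  have d1: "delta1 (controlled_integrand \<psi> x w z) [s1, s2, s3] [t, t'] = - A t * w [s2, s3] [t, t'] - B t * z [s2, s3] [t, t']"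
    if "0 \<le> t" "t \<le> t'" "t' \<le> T" for t t'
    using integrand_delta1[OF st(1-4) that] by (simp only: A_def B_def)
  have w2: "w [s2, s3] [t1, t3] = w [s2, s3] [t1, t2] + w [s2, s3] [t2, t3]"
    using w_additive2[of s2 s3 t1 t2 t3] st by simp
  have z2: "z [s2, s3] [t1, t3] = z [s2, s3] [t1, t2] + z [s2, s3] [t2, t3] - v [s2, s3] [t1, t2, t3]"
    using z_delta2[of s2 s3 t1 t2 t3] st by simp
  let ?g = "controlled_integrand \<psi> x w z"
  have "delta ?g [s1, s2, s3] [t1, t2, t3] =
      delta1 ?g [s1, s2, s3] [t1, t3] - delta1 ?g [s1, s2, s3] [t1, t2] - delta1 ?g [s1, s2, s3] [t2, t3]"
    by (simp add: delta_def)
  also have "\<dots> = (A t2 - A t1) * w [s2, s3] [t2, t3] + (B t2 - B t1) * z [s2, s3] [t2, t3] + B t1 * v [s2, s3] [t1, t2, t3]"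
    using d1[of t1 t3] d1[of t1 t2] d1[of t2 t3] st by (simp only: w2 z2 algebra_simps) (simp add: algebra_simps)
  also have "\<bar>\<dots>\<bar> \<le> (M * (M * S)\<^sup>2 * (M * R) + M * (M * S) * (M * (S * R))) * (M * (S * R))
      + (M * (M * S) * (M * R) + M * (M * (S * R))) * (M * (S\<^sup>2 * R)) + M * (M * S) * (M * (S\<^sup>2 * R\<^sup>2))"
    by (intro abs_add_le abs_mult_le A B B1 w z v)
  also have "\<dots> = (M ^ 5 + M ^ 4 + (M ^ 4 + M ^ 3) + M ^ 3) * (S ^ 3 * R\<^sup>2)"
    by (simp add: power2_eq_square power3_eq_cube eval_nat_numeral algebra_simps)
  also have "\<dots> \<le> 5 * M ^ 5 * (S ^ 3 * R\<^sup>2)"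
    using M SR power_increasing[of 3 5 M] power_increasing[of 4 5 M] by (intro mult_right_mono) auto
  finally show ?thesis by (simp add: powr_multiples S_def R_def)
qed

text \<open>
  The weaker bounds of \<open>sewable\<close>, all with one constant: the factors in the direction that is not sewn
  are estimated by powers of \<open>T\<close>.
\<close>
lemma integrand_sewable:
  "sewable T (3 * \<gamma>1) (2 * \<gamma>2) (5 * M ^ 5 * ((1 + T powr \<gamma>1)\<^sup>2 * (1 + T powr \<gamma>2))) (controlled_integrand \<psi> x w z)"
proof -
  define A B where "A = T powr \<gamma>1" and "B = T powr \<gamma>2"
  have AB: "A \<ge> 0" "B \<ge> 0" by (auto simp: A_def B_def)
  define E where "E = (1 + A)\<^sup>2 * (1 + B)"
  have E0: "E = 1 + 2 * A + A\<^sup>2 + B + 2 * (A * B) + A\<^sup>2 * B" by (simp add: E_def power2_eq_square algebra_simps)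
  have nn: "A\<^sup>2 \<ge> 0" "A * B \<ge> 0" "A\<^sup>2 * B \<ge> 0" using AB by auto
  have E: "1 \<le> E" "B \<le> E" "(1 + A) * A \<le> E"
    using E0 nn AB by (auto simp: power2_eq_square algebra_simps)
  have M5: "0 \<le> M ^ 5" "2 * M ^ 3 \<le> 5 * M ^ 5" "2 * M ^ 4 \<le> 5 * M ^ 5"
    using M power_increasing[of 3 5 M] power_increasing[of 4 5 M] zero_le_power[of M 5] by linarith+
  define K where "K = 5 * M ^ 5 * E"
  have "5 * M ^ 5 \<le> K" using mult_left_mono[OF E(1) M5(1)] by (simp add: K_def)
  with M5(1) have K0: "K \<ge> 0" "5 * M ^ 5 \<le> K" by linarith+
  have K1: "2 * M ^ 4 * B \<le> K" unfolding K_def by (rule mult_mono) (use M5 AB E M in auto)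
  have K2: "2 * M ^ 3 * ((1 + A) * A) \<le> K" unfolding K_def by (rule mult_mono) (use M5 AB E M in auto)
  show ?thesis unfolding sewable_def E_def[symmetric] A_def[symmetric] B_def[symmetric] K_def[symmetric]
  proof (intro conjI allI impI)
    fix s1 s2 s3 t1 t2 :: real
    assume st: "0 \<le> s1" "s1 \<le> s2" "s2 \<le> s3" "s3 \<le> T" "0 \<le> t1" "t1 \<le> t2" "t2 \<le> T"
    have "(t2 - t1) powr \<gamma>2 \<le> B" using st powr_chain by (auto simp: B_def)
    then have "2 * M ^ 4 * ((s3 - s1) powr (3 * \<gamma>1) * (t2 - t1) powr \<gamma>2) \<le> 2 * M ^ 4 * ((s3 - s1) powr (3 * \<gamma>1) * B)"
      using M by (intro mult_left_mono) auto
    also have "\<dots> = 2 * M ^ 4 * B * (s3 - s1) powr (3 * \<gamma>1)" by simp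
    also have "\<dots> \<le> K * (s3 - s1) powr (3 * \<gamma>1)" by (intro mult_right_mono K1) simp
    finally show "\<bar>delta1 (controlled_integrand \<psi> x w z) [s1, s2, s3] [t1, t2]\<bar> \<le> K * (s3 - s1) powr (3 * \<gamma>1)"
      using integrand_delta1_bound[OF st] by linarith
  next
    fix s1 s2 t1 t2 t3 :: real
    assume st: "0 \<le> s1" "s1 \<le> s2" "s2 \<le> T" "0 \<le> t1" "t1 \<le> t2" "t2 \<le> t3" "t3 \<le> T"
    have "(s2 - s1) powr \<gamma>1 \<le> A" using st powr_chain by (auto simp: A_def)
    then have "2 * M ^ 3 * (1 + A) * ((s2 - s1) powr \<gamma>1 * (t3 - t1) powr (2 * \<gamma>2)) \<le> 2 * M ^ 3 * (1 + A) * (A * (t3 - t1) powr (2 * \<gamma>2))"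
      using M AB by (intro mult_left_mono mult_right_mono) auto
    also have "\<dots> = 2 * M ^ 3 * ((1 + A) * A) * (t3 - t1) powr (2 * \<gamma>2)" by simp
    also have "\<dots> \<le> K * (t3 - t1) powr (2 * \<gamma>2)" by (intro mult_right_mono K2) simp
    finally show "\<bar>delta2 (controlled_integrand \<psi> x w z) [s1, s2] [t1, t2, t3]\<bar> \<le> K * (t3 - t1) powr (2 * \<gamma>2)"
      using integrand_delta2_bound[OF st] by (simp add: A_def)
  next
    fix s1 s2 s3 t1 t2 t3 :: real
    assume st: "0 \<le> s1" "s1 \<le> s2" "s2 \<le> s3" "s3 \<le> T" "0 \<le> t1" "t1 \<le> t2" "t2 \<le> t3" "t3 \<le> T"
    have "5 * M ^ 5 * ((s3 - s1) powr (3 * \<gamma>1) * (t3 - t1) powr (2 * \<gamma>2)) \<le> K * ((s3 - s1) powr (3 * \<gamma>1) * (t3 - t1) powr (2 * \<gamma>2))"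
      by (intro mult_right_mono K0(2)) simp
    then show "\<bar>delta (controlled_integrand \<psi> x w z) [s1, s2, s3] [t1, t2, t3]\<bar>
        \<le> K * (s3 - s1) powr (3 * \<gamma>1) * (t3 - t1) powr (2 * \<gamma>2)"
      using integrand_delta_bound[OF st] by (simp add: mult.assoc)
  qed (use \<gamma>1 \<gamma>2 K0 in auto)
qed

end

end

section \<open>Iterated integrals and lifts of smooth fields\<close>

text \<open>The iterated integral of \<open>k\<close> over \<open>[s1, s2] \<times> [t1, t2]\<close>.\<close>
definition double_integral :: "(real \<Rightarrow> real \<Rightarrow> real) \<Rightarrow> real \<Rightarrow> real \<Rightarrow> real \<Rightarrow> real \<Rightarrow> real" where
  "double_integral k s1 s2 t1 t2 = integral {s1..s2} (\<lambda>\<sigma>. integral {t1..t2} (\<lambda>\<tau>. k \<sigma> \<tau>))"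

text \<open>Joint continuity on the closed square \<open>[0, T]\<^sup>2\<close>.\<close>
definition continuous_square :: "real \<Rightarrow> (real \<Rightarrow> real \<Rightarrow> real) \<Rightarrow> bool" where
  "continuous_square T k \<longleftrightarrow> continuous_on ({0..T} \<times> {0..T}) (\<lambda>(\<sigma>, \<tau>). k \<sigma> \<tau>)"

lemma continuous_square_compose:
  assumes "continuous_square T k" "continuous_on A f" "continuous_on A g"
    and "f ` A \<subseteq> {0..T}" "g ` A \<subseteq> {0..T}"
  shows "continuous_on A (\<lambda>a. k (f a) (g a))"
proof -
  have "continuous_on A (\<lambda>a. (\<lambda>(\<sigma>, \<tau>). k \<sigma> \<tau>) (f a, g a))"
    by (rule continuous_on_compose2[OF assms(1)[unfolded continuous_square_def]])
      (use assms in \<open>auto intro!: continuous_on_Pair\<close>)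
  then show ?thesis by simp
qed

lemma continuous_square_intros:
  "\<lbrakk>continuous_square T k; continuous_square T l\<rbrakk> \<Longrightarrow> continuous_square T (\<lambda>\<sigma> \<tau>. k \<sigma> \<tau> + l \<sigma> \<tau>)"
  "\<lbrakk>continuous_square T k; continuous_square T l\<rbrakk> \<Longrightarrow> continuous_square T (\<lambda>\<sigma> \<tau>. k \<sigma> \<tau> - l \<sigma> \<tau>)"
  "\<lbrakk>continuous_square T k; continuous_square T l\<rbrakk> \<Longrightarrow> continuous_square T (\<lambda>\<sigma> \<tau>. k \<sigma> \<tau> * l \<sigma> \<tau>)"
  "continuous_square T (\<lambda>\<sigma> \<tau>. c)"
  by (auto simp: continuous_square_def case_prod_beta intro!: continuous_intros)

lemma continuous_square_freeze:
  "\<lbrakk>continuous_square T k; 0 \<le> t; t \<le> T\<rbrakk> \<Longrightarrow> continuous_square T (\<lambda>\<sigma> \<tau>. k \<sigma> t)"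
  unfolding continuous_square_def[of _ "\<lambda>\<sigma> \<tau>. k \<sigma> t"] case_prod_beta
  by (rule continuous_square_compose[of T k]) (auto intro!: continuous_intros)

lemma continuous_square_fun:
  "\<lbrakk>continuous_square T k; continuous_on UNIV \<psi>\<rbrakk> \<Longrightarrow> continuous_square T (\<lambda>\<sigma> \<tau>. \<psi> (k \<sigma> \<tau>))"
  unfolding continuous_square_def case_prod_beta by (rule continuous_on_compose2[of UNIV \<psi>]) auto

lemma continuous_square_cong:
  assumes "\<And>\<sigma> \<tau>. \<lbrakk>0 \<le> \<sigma>; \<sigma> \<le> T; 0 \<le> \<tau>; \<tau> \<le> T\<rbrakk> \<Longrightarrow> k \<sigma> \<tau> = l \<sigma> \<tau>"
  shows "continuous_square T k \<longleftrightarrow> continuous_square T l"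
  unfolding continuous_square_def by (rule continuous_on_cong) (use assms in auto)

lemma continuous_square_bounded:
  assumes "continuous_square T k"
  shows "\<exists>B\<ge>0. \<forall>\<sigma>\<in>{0..T}. \<forall>\<tau>\<in>{0..T}. \<bar>k \<sigma> \<tau>\<bar> \<le> B"
proof -
  have "bounded ((\<lambda>(\<sigma>, \<tau>). k \<sigma> \<tau>) ` ({0..T} \<times> {0..T}))"
    using assms unfolding continuous_square_def
    by (intro compact_imp_bounded compact_continuous_image compact_Times) auto
  then obtain B where "\<forall>v\<in>(\<lambda>(\<sigma>, \<tau>). k \<sigma> \<tau>) ` ({0..T} \<times> {0..T}). norm v \<le> B"
    unfolding bounded_iff by blast
  then have "\<bar>k \<sigma> \<tau>\<bar> \<le> \<bar>B\<bar>" if "\<sigma> \<in> {0..T}" "\<tau> \<in> {0..T}" for \<sigma> \<tau>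
    using that by (auto intro: order_trans[OF _ abs_ge_self])
  then show ?thesis by (intro exI[of _ "\<bar>B\<bar>"]) auto
qed

lemma integrable_inner:
  assumes "continuous_square T k" "0 \<le> \<sigma>" "\<sigma> \<le> T" "0 \<le> t1" "t2 \<le> T"
  shows "continuous_on {t1..t2} (k \<sigma>)" "k \<sigma> integrable_on {t1..t2}"
proof -
  show "continuous_on {t1..t2} (k \<sigma>)"
    by (rule continuous_square_compose[OF assms(1)]) (use assms in \<open>auto intro: continuous_intros\<close>)
  then show "k \<sigma> integrable_on {t1..t2}" by (rule integrable_continuous_real)
qed

lemma integrable_outer:
  assumes "continuous_square T k" "0 \<le> s1" "s2 \<le> T" "0 \<le> t1" "t2 \<le> T"
  shows "continuous_on {s1..s2} (\<lambda>\<sigma>. integral {t1..t2} (k \<sigma>))" "(\<lambda>\<sigma>. integral {t1..t2} (k \<sigma>)) integrable_on {s1..s2}"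
proof -
  have "continuous_on ({s1..s2} \<times> cbox t1 t2) (\<lambda>(\<sigma>, \<tau>). k \<sigma> \<tau>)"
    using assms by (intro continuous_on_subset[OF assms(1)[unfolded continuous_square_def]]) auto
  then show "continuous_on {s1..s2} (\<lambda>\<sigma>. integral {t1..t2} (k \<sigma>))"
    using integral_continuous_on_param[of "{s1..s2}" t1 t2 k] by simp
  then show "(\<lambda>\<sigma>. integral {t1..t2} (k \<sigma>)) integrable_on {s1..s2}" by (rule integrable_continuous_real)
qed

lemma double_integral_cong:
  assumes "\<And>\<sigma> \<tau>. \<lbrakk>s1 \<le> \<sigma>; \<sigma> \<le> s2; t1 \<le> \<tau>; \<tau> \<le> t2\<rbrakk> \<Longrightarrow> k \<sigma> \<tau> = l \<sigma> \<tau>"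
  shows "double_integral k s1 s2 t1 t2 = double_integral l s1 s2 t1 t2"
  unfolding double_integral_def by (intro integral_cong) (use assms in auto)

lemma double_integral_diag [simp]:
  "double_integral k s s t1 t2 = 0" "double_integral k s1 s2 t t = 0"
  by (simp_all add: double_integral_def)

lemma double_integral_split1:
  assumes "continuous_square T k" "0 \<le> s1" "s1 \<le> s2" "s2 \<le> s3" "s3 \<le> T" "0 \<le> t1" "t2 \<le> T"
  shows "double_integral k s1 s3 t1 t2 = double_integral k s1 s2 t1 t2 + double_integral k s2 s3 t1 t2"
  unfolding double_integral_def
  using assms by (intro Henstock_Kurzweil_Integration.integral_combine[symmetric] integrable_outer(2)[OF assms(1)]) auto

lemma double_integral_add:
  assumes "continuous_square T k" "continuous_square T l" "0 \<le> s1" "s2 \<le> T" "0 \<le> t1" "t2 \<le> T"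
  shows "double_integral (\<lambda>\<sigma> \<tau>. k \<sigma> \<tau> + l \<sigma> \<tau>) s1 s2 t1 t2 = double_integral k s1 s2 t1 t2 + double_integral l s1 s2 t1 t2"
proof -
  have "double_integral (\<lambda>\<sigma> \<tau>. k \<sigma> \<tau> + l \<sigma> \<tau>) s1 s2 t1 t2 = integral {s1..s2} (\<lambda>\<sigma>. integral {t1..t2} (k \<sigma>) + integral {t1..t2} (l \<sigma>))"
    unfolding double_integral_def
    using assms by (intro integral_cong integral_add integrable_inner(2)[OF assms(1)] integrable_inner(2)[OF assms(2)]) auto
  also have "\<dots> = double_integral k s1 s2 t1 t2 + double_integral l s1 s2 t1 t2"
    unfolding double_integral_def
    using assms by (intro integral_add integrable_outer(2)) auto
  finally show ?thesis .
qed

lemma double_integral_cmult: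
  "double_integral (\<lambda>\<sigma> \<tau>. c * k \<sigma> \<tau>) s1 s2 t1 t2 = c * double_integral k s1 s2 t1 t2"
  by (simp add: double_integral_def)

lemma double_integral_split2:
  assumes "continuous_square T k" "0 \<le> s1" "s2 \<le> T" "0 \<le> t1" "t1 \<le> t2" "t2 \<le> t3" "t3 \<le> T"
  shows "double_integral k s1 s2 t1 t3 = double_integral k s1 s2 t1 t2 + double_integral k s1 s2 t2 t3"
proof -
  have "double_integral k s1 s2 t1 t3 = integral {s1..s2} (\<lambda>\<sigma>. integral {t1..t2} (k \<sigma>) + integral {t2..t3} (k \<sigma>))"
    unfolding double_integral_def
    using assms by (intro integral_cong Henstock_Kurzweil_Integration.integral_combine[symmetric] integrable_inner(2)[OF assms(1)]) auto
  also have "\<dots> = double_integral k s1 s2 t1 t2 + double_integral k s1 s2 t2 t3"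
    unfolding double_integral_def
    using assms by (intro integral_add integrable_outer(2)[OF assms(1)]) auto
  finally show ?thesis .
qed

lemma double_integral_bound:
  assumes k: "continuous_square T k" and st: "0 \<le> s1" "s1 \<le> s2" "s2 \<le> T" "0 \<le> t1" "t1 \<le> t2" "t2 \<le> T"
    and B: "\<And>\<sigma> \<tau>. \<lbrakk>s1 \<le> \<sigma>; \<sigma> \<le> s2; t1 \<le> \<tau>; \<tau> \<le> t2\<rbrakk> \<Longrightarrow> \<bar>k \<sigma> \<tau>\<bar> \<le> B"
  shows "\<bar>double_integral k s1 s2 t1 t2\<bar> \<le> B * ((s2 - s1) * (t2 - t1))"
proof -
  have inner: "norm (integral {t1..t2} (k \<sigma>)) \<le> B * (t2 - t1)" if "\<sigma> \<in> {s1..s2}" for \<sigma>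
    by (rule integral_bound) (use integrable_inner(1)[OF k] st B that in auto)
  have "norm (integral {s1..s2} (\<lambda>\<sigma>. integral {t1..t2} (k \<sigma>))) \<le> B * (t2 - t1) * (s2 - s1)"
    by (rule integral_bound[OF st(2) integrable_outer(1)[OF k]]) (use st inner in auto)
  then show ?thesis by (simp add: double_integral_def mult_ac)
qed

lemma double_integral_partition:
  fixes p q :: "nat \<Rightarrow> real"
  assumes k: "continuous_square T k"
    and p: "\<And>i. i < n \<Longrightarrow> p i \<le> p (Suc i)" "0 \<le> p 0" "p n \<le> T"
    and q: "\<And>j. j < m \<Longrightarrow> q j \<le> q (Suc j)" "0 \<le> q 0" "q m \<le> T"
  shows "(\<Sum>i<n. \<Sum>j<m. double_integral k (p i) (p (Suc i)) (q j) (q (Suc j))) = double_integral k (p 0) (p n) (q 0) (q m)"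
proof -
  have "(\<Sum>j<m. double_integral k (p i) (p (Suc i)) (q j) (q (Suc j))) = double_integral k (p i) (p (Suc i)) (q 0) (q m)"
    if "i < n" for i
    by (rule additive_sum[where T = T, OF double_integral_split2[OF k]])
      (use cell_range[of n p 0 T, OF p] q that in auto)
  then have "(\<Sum>i<n. \<Sum>j<m. double_integral k (p i) (p (Suc i)) (q j) (q (Suc j)))
      = (\<Sum>i<n. double_integral k (p i) (p (Suc i)) (q 0) (q m))" by simp
  also have "\<dots> = double_integral k (p 0) (p n) (q 0) (q m)"
    by (rule additive_sum[where T = T and f = "\<lambda>s s'. double_integral k s s' (q 0) (q m)", OF double_integral_split1[OF k]])
      (use p q in auto)
  finally show ?thesis .
qed

lemma double_integral_derivative:
  assumes st: "0 \<le> s1" "s1 \<le> s2" "s2 \<le> T" "0 \<le> t1" "t1 \<le> t2" "t2 \<le> T"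
    and H: "\<And>\<sigma> \<tau>. \<lbrakk>0 \<le> \<sigma>; \<sigma> \<le> T; 0 \<le> \<tau>; \<tau> \<le> T\<rbrakk> \<Longrightarrow> ((\<lambda>\<sigma>. H \<sigma> \<tau>) has_real_derivative H1 \<sigma> \<tau>) (at \<sigma> within {0..T})"
    and H1: "\<And>\<sigma> \<tau>. \<lbrakk>0 \<le> \<sigma>; \<sigma> \<le> T; 0 \<le> \<tau>; \<tau> \<le> T\<rbrakk> \<Longrightarrow> ((\<lambda>\<tau>. H1 \<sigma> \<tau>) has_real_derivative H12 \<sigma> \<tau>) (at \<tau> within {0..T})"
  shows "double_integral H12 s1 s2 t1 t2 = H s2 t2 - H s1 t2 - H s2 t1 + H s1 t1"
proof -
  have inner: "integral {t1..t2} (H12 \<sigma>) = H1 \<sigma> t2 - H1 \<sigma> t1" if "\<sigma> \<in> {s1..s2}" for \<sigma>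
  proof (rule integral_unique, rule fundamental_theorem_of_calculus)
    show "(H1 \<sigma> has_vector_derivative H12 \<sigma> \<tau>) (at \<tau> within {t1..t2})" if "\<tau> \<in> {t1..t2}" for \<tau>
    proof -
      have "(H1 \<sigma> has_vector_derivative H12 \<sigma> \<tau>) (at \<tau> within {0..T})"
        unfolding has_real_derivative_iff_has_vector_derivative[symmetric]
        by (rule H1) (use \<open>\<sigma> \<in> {s1..s2}\<close> that st in auto)
      then show ?thesis by (rule has_vector_derivative_within_subset) (use st in auto)
    qed
  qed (use st in simp)
  have outer: "integral {s1..s2} (\<lambda>\<sigma>. H1 \<sigma> t) = H s2 t - H s1 t \<and> (\<lambda>\<sigma>. H1 \<sigma> t) integrable_on {s1..s2}"
    if t: "t \<in> {t1, t2}" for t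
  proof -
    have "((\<lambda>\<sigma>. H1 \<sigma> t) has_integral H s2 t - H s1 t) {s1..s2}"
    proof (rule fundamental_theorem_of_calculus)
      show "((\<lambda>\<sigma>. H \<sigma> t) has_vector_derivative H1 \<sigma> t) (at \<sigma> within {s1..s2})" if "\<sigma> \<in> {s1..s2}" for \<sigma>
      proof -
        have "((\<lambda>\<sigma>. H \<sigma> t) has_vector_derivative H1 \<sigma> t) (at \<sigma> within {0..T})"
          unfolding has_real_derivative_iff_has_vector_derivative[symmetric]
          by (rule H) (use that t st in auto)
        then show ?thesis by (rule has_vector_derivative_within_subset) (use st in auto)
      qed
    qed (use st in simp)
    then show ?thesis by (auto simp: integral_unique)
  qed
  have "double_integral H12 s1 s2 t1 t2 = integral {s1..s2} (\<lambda>\<sigma>. H1 \<sigma> t2 - H1 \<sigma> t1)"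
    unfolding double_integral_def by (intro integral_cong inner)
  also have "\<dots> = (H s2 t2 - H s1 t2) - (H s2 t1 - H s1 t1)"
    using outer[of t1] outer[of t2] by (subst integral_diff) auto
  finally show ?thesis by simp
qed

lemma lift_0dot_eq:
  "lift_0dot f d [s1, s2] [t1, t2] = double_integral (\<lambda>\<sigma> \<tau>. (f [\<sigma>] [t1] - f [s1] [t1]) * d [\<sigma>] [\<tau>]) s1 s2 t1 t2"
  by (simp add: lift_0dot_def double_integral_def)

lemma lift_2dot_eq:
  "lift_2dot f d [s1, s2] [t1, t2, t3] =
    double_integral (\<lambda>\<sigma> \<tau>. (f [\<sigma>] [t2] - f [\<sigma>] [t1] - (f [s1] [t2] - f [s1] [t1])) * d [\<sigma>] [\<tau>]) s1 s2 t2 t3"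
  by (simp add: lift_2dot_def double_integral_def delta_def)

text \<open>
  The two algebraic relations of the lift: with \<open>w = \<integral>\<integral> d\<close>, \<open>z = lift_0dot f d\<close> and \<open>v = lift_2dot f d\<close>
  one has \<open>\<delta>\<^sub>1 z = \<delta>\<^sub>1 f w\<close> and \<open>\<delta>\<^sub>2 z = - v\<close>.
\<close>
lemma lift_0dot_delta1:
  assumes f: "continuous_square T (\<lambda>\<sigma> \<tau>. f [\<sigma>] [\<tau>])" and d: "continuous_square T (\<lambda>\<sigma> \<tau>. d [\<sigma>] [\<tau>])"
    and st: "0 \<le> s1" "s1 \<le> s2" "s2 \<le> s3" "s3 \<le> T" "0 \<le> t1" "t1 \<le> t2" "t2 \<le> T"
  shows "delta1 (lift_0dot f d) [s1, s2, s3] [t1, t2] =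
    delta1 f [s1, s2] [t1] * double_integral (\<lambda>\<sigma> \<tau>. d [\<sigma>] [\<tau>]) s2 s3 t1 t2"
proof -
  have t1: "0 \<le> t1" "t1 \<le> T" using st by auto
  note cont = continuous_square_intros d continuous_square_freeze[OF f t1]
  have k: "continuous_square T (\<lambda>\<sigma> \<tau>. (f [\<sigma>] [t1] - f [s] [t1]) * d [\<sigma>] [\<tau>])" for s
    by (intro cont)
  have "double_integral (\<lambda>\<sigma> \<tau>. (f [\<sigma>] [t1] - f [s1] [t1]) * d [\<sigma>] [\<tau>]) s2 s3 t1 t2
      = double_integral (\<lambda>\<sigma> \<tau>. (f [\<sigma>] [t1] - f [s2] [t1]) * d [\<sigma>] [\<tau>] + (f [s2] [t1] - f [s1] [t1]) * d [\<sigma>] [\<tau>]) s2 s3 t1 t2"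
    by (rule double_integral_cong) (simp add: algebra_simps)
  also have "\<dots> = double_integral (\<lambda>\<sigma> \<tau>. (f [\<sigma>] [t1] - f [s2] [t1]) * d [\<sigma>] [\<tau>]) s2 s3 t1 t2
      + (f [s2] [t1] - f [s1] [t1]) * double_integral (\<lambda>\<sigma> \<tau>. d [\<sigma>] [\<tau>]) s2 s3 t1 t2"
    by (subst double_integral_add[OF k continuous_square_intros(3)[OF continuous_square_intros(4) d]])
      (use st in \<open>auto simp: double_integral_cmult\<close>)
  finally show ?thesis
    using double_integral_split1[OF k, of s1 s2 s3 t1 t2] st by (simp add: lift_0dot_eq)
qed

lemma lift_0dot_delta2:
  assumes f: "continuous_square T (\<lambda>\<sigma> \<tau>. f [\<sigma>] [\<tau>])" and d: "continuous_square T (\<lambda>\<sigma> \<tau>. d [\<sigma>] [\<tau>])"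
    and st: "0 \<le> s1" "s1 \<le> s2" "s2 \<le> T" "0 \<le> t1" "t1 \<le> t2" "t2 \<le> t3" "t3 \<le> T"
  shows "delta2 (lift_0dot f d) [s1, s2] [t1, t2, t3] = - lift_2dot f d [s1, s2] [t1, t2, t3]"
proof -
  have t: "0 \<le> t1" "t1 \<le> T" "0 \<le> t2" "t2 \<le> T" using st by auto
  note cont = continuous_square_intros d continuous_square_freeze[OF f t(1,2)] continuous_square_freeze[OF f t(3,4)]
  have k: "continuous_square T (\<lambda>\<sigma> \<tau>. (f [\<sigma>] [t1] - f [s1] [t1]) * d [\<sigma>] [\<tau>])"
    by (intro cont)
  have l: "continuous_square T (\<lambda>\<sigma> \<tau>. (f [\<sigma>] [t2] - f [\<sigma>] [t1] - (f [s1] [t2] - f [s1] [t1])) * d [\<sigma>] [\<tau>])"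
    by (intro cont)
  have "lift_0dot f d [s1, s2] [t2, t3] = double_integral (\<lambda>\<sigma> \<tau>. (f [\<sigma>] [t1] - f [s1] [t1]) * d [\<sigma>] [\<tau>]
      + (f [\<sigma>] [t2] - f [\<sigma>] [t1] - (f [s1] [t2] - f [s1] [t1])) * d [\<sigma>] [\<tau>]) s1 s2 t2 t3"
    unfolding lift_0dot_eq by (rule double_integral_cong) (simp add: algebra_simps)
  also have "\<dots> = double_integral (\<lambda>\<sigma> \<tau>. (f [\<sigma>] [t1] - f [s1] [t1]) * d [\<sigma>] [\<tau>]) s1 s2 t2 t3
      + lift_2dot f d [s1, s2] [t1, t2, t3]"
    unfolding lift_2dot_eq by (subst double_integral_add[OF k l]) (use st in auto)
  finally show ?thesis
    using double_integral_split2[OF k, of s1 s2 t1 t2 t3] st by (simp add: lift_0dot_eq)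
qed

section \<open>Riemann sums of smooth fields\<close>

lemma sewable_uniform_limit:
  assumes g: "sewable T a b K g" and st: "0 \<le> s1" "s1 \<le> s2" "s2 \<le> T" "0 \<le> t1" "t1 \<le> t2" "t2 \<le> T"
  shows "(\<lambda>n. riemann_sum g (uniform_partition s1 s2 n) (Suc n) (uniform_partition t1 t2 n) (Suc n))
    \<longlonglongrightarrow> rough_integral T g [s1, s2] [t1, t2]"
proof -
  note u = uniform_partition[OF st(2)] uniform_partition[OF st(5)]
  have a: "a > 1" "b > 1" using g by (auto simp: sewable_def)
  define \<epsilon> where "\<epsilon> n = K * riemann_const T a b *
      (((s2 - s1) / real (Suc n)) powr (a - 1) + ((t2 - t1) / real (Suc n)) powr (b - 1))" for n
  have bnd: "\<bar>riemann_sum g (uniform_partition s1 s2 n) (Suc n) (uniform_partition t1 t2 n) (Suc n)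
      - rough_integral T g [s1, s2] [t1, t2]\<bar> \<le> \<epsilon> n" for n
    using riemann_sum_rough_integral[OF g, of "Suc n" "uniform_partition s1 s2 n" "(s2 - s1) / real (Suc n)"
        "Suc n" "uniform_partition t1 t2 n" "(t2 - t1) / real (Suc n)"] u st by (simp add: \<epsilon>_def)
  have gap: "(\<lambda>n. (d / real (Suc n)) powr e) \<longlonglongrightarrow> 0" if "d \<ge> 0" "e > 0" for d e :: real
  proof -
    have "(\<lambda>n. (d / real (Suc n)) powr e) \<longlonglongrightarrow> 0 powr e"
      by (intro tendsto_powr2 LIMSEQ_Suc[OF lim_const_over_n] tendsto_const) (use that in auto)
    then show ?thesis by simp
  qed
  have "\<epsilon> \<longlonglongrightarrow> K * riemann_const T a b * (0 + 0)"
    unfolding \<epsilon>_def by (intro tendsto_mult tendsto_add tendsto_const gap) (use st a in auto)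
  then have "\<epsilon> \<longlonglongrightarrow> 0" by simp
  then have "(\<lambda>n. riemann_sum g (uniform_partition s1 s2 n) (Suc n) (uniform_partition t1 t2 n) (Suc n)
      - rough_integral T g [s1, s2] [t1, t2]) \<longlonglongrightarrow> 0"
    by (rule Lim_null_comparison[rotated]) (simp only: real_norm_def bnd eventually_True)
  then show ?thesis by (rule LIM_zero_cancel)
qed

lemma grid_rescale:
  fixes N :: real
  assumes "N \<noteq> 0"
  shows "N * (N * (c * (d / N + d' / N) * ((d / N) * (d' / N)))) = c * (d + d') * (d * d') / N"
proof -
  have "N * (N * (c * (d / N + d' / N) * ((d / N) * (d' / N))))
      = c * (N * (d / N) + N * (d' / N)) * ((N * (d / N)) * (d' / N))"
    by (simp only: distrib_left distrib_right mult_ac)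
  also have "\<dots> = c * (d + d') * (d * (d' / N))" using assms by simp
  finally show ?thesis by simp
qed

text \<open>
  For a Lipschitz field the second order term \<open>\<psi>'(x) z\<close> does not contribute to the limit, and the
  rough integral is an ordinary one.
\<close>
lemma smooth_rough_integral:
  assumes f: "continuous_square T (\<lambda>\<sigma> \<tau>. f [\<sigma>] [\<tau>])" and d: "continuous_square T (\<lambda>\<sigma> \<tau>. d [\<sigma>] [\<tau>])"
    and lip: "\<And>\<sigma> \<sigma>' \<tau> \<tau>'. \<lbrakk>0 \<le> \<sigma>; \<sigma> \<le> \<sigma>'; \<sigma>' \<le> T; 0 \<le> \<tau>; \<tau> \<le> \<tau>'; \<tau>' \<le> T\<rbrakk> \<Longrightarrow>
      \<bar>f [\<sigma>'] [\<tau>'] - f [\<sigma>] [\<tau>]\<bar> \<le> L * ((\<sigma>' - \<sigma>) + (\<tau>' - \<tau>))"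
    and \<psi>: "bounded_derivs M \<psi> (Suc N)"
    and w: "\<And>s1 s2 t1 t2. \<lbrakk>0 \<le> s1; s1 \<le> s2; s2 \<le> T; 0 \<le> t1; t1 \<le> t2; t2 \<le> T\<rbrakk> \<Longrightarrow>
      w [s1, s2] [t1, t2] = double_integral (\<lambda>\<sigma> \<tau>. d [\<sigma>] [\<tau>]) s1 s2 t1 t2"
    and sew: "sewable T a b K (controlled_integrand \<psi> f w (lift_0dot f d))"
    and st: "0 \<le> s1" "s1 \<le> s2" "s2 \<le> T" "0 \<le> t1" "t1 \<le> t2" "t2 \<le> T"
  shows "rough_integral T (controlled_integrand \<psi> f w (lift_0dot f d)) [s1, s2] [t1, t2]
    = double_integral (\<lambda>\<sigma> \<tau>. \<psi> 0 (f [\<sigma>] [\<tau>]) * d [\<sigma>] [\<tau>]) s1 s2 t1 t2"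
proof -
  let ?g = "controlled_integrand \<psi> f w (lift_0dot f d)"
  let ?k = "\<lambda>\<sigma> \<tau>. \<psi> 0 (f [\<sigma>] [\<tau>]) * d [\<sigma>] [\<tau>]"
  obtain B where B: "B \<ge> 0" "\<And>\<sigma> \<tau>. \<lbrakk>0 \<le> \<sigma>; \<sigma> \<le> T; 0 \<le> \<tau>; \<tau> \<le> T\<rbrakk> \<Longrightarrow> \<bar>d [\<sigma>] [\<tau>]\<bar> \<le> B"
    using continuous_square_bounded[OF d] by auto
  have M: "M \<ge> 0" "\<And>u. \<bar>\<psi> 1 u\<bar> \<le> M" using bounded_derivs_nonneg[OF \<psi>] \<psi> by (auto simp: bounded_derivs_def)
  have "continuous_on UNIV (\<psi> 0)"
    using \<psi> by (intro continuous_at_imp_continuous_on) (auto simp: bounded_derivs_def intro: DERIV_isCont)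
  then have \<psi>f: "continuous_square T (\<lambda>\<sigma> \<tau>. \<psi> 0 (f [\<sigma>] [\<tau>]))" by (rule continuous_square_fun[OF f])
  then have k: "continuous_square T ?k" by (intro continuous_square_intros d)
  have cell: "\<bar>?g [a, b] [t, t'] - double_integral ?k a b t t'\<bar> \<le> 2 * M * \<bar>L\<bar> * B * ((b - a) + (t' - t)) * ((b - a) * (t' - t))"
    if ab: "0 \<le> a" "a \<le> b" "b \<le> T" and t: "0 \<le> t" "t \<le> t'" "t' \<le> T" for a b t t'
  proof -
    have tT: "0 \<le> t" "t \<le> T" using t by auto
    note cont = continuous_square_intros \<psi>f d continuous_square_freeze[OF f tT]
    have c1: "continuous_square T (\<lambda>\<sigma> \<tau>. \<psi> 0 (f [a] [t]) * d [\<sigma>] [\<tau>])"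
      and c2: "continuous_square T (\<lambda>\<sigma> \<tau>. \<psi> 1 (f [a] [t]) * ((f [\<sigma>] [t] - f [a] [t]) * d [\<sigma>] [\<tau>]))"
      and c3: "continuous_square T (\<lambda>\<sigma> \<tau>. (- 1) * ?k \<sigma> \<tau>)"
      by (intro cont)+
    have "?g [a, b] [t, t'] - double_integral ?k a b t t' =
        \<psi> 0 (f [a] [t]) * double_integral (\<lambda>\<sigma> \<tau>. d [\<sigma>] [\<tau>]) a b t t'
        + \<psi> 1 (f [a] [t]) * double_integral (\<lambda>\<sigma> \<tau>. (f [\<sigma>] [t] - f [a] [t]) * d [\<sigma>] [\<tau>]) a b t t'
        + (- 1) * double_integral ?k a b t t'"
      using w[OF ab t] by (simp add: lift_0dot_eq)
    also have "\<dots> = double_integral (\<lambda>\<sigma> \<tau>. \<psi> 0 (f [a] [t]) * d [\<sigma>] [\<tau>]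
        + \<psi> 1 (f [a] [t]) * ((f [\<sigma>] [t] - f [a] [t]) * d [\<sigma>] [\<tau>]) + (- 1) * ?k \<sigma> \<tau>) a b t t'"
      unfolding double_integral_cmult[symmetric]
        double_integral_add[OF continuous_square_intros(1)[OF c1 c2] c3 ab(1,3) t(1,3)]
        double_integral_add[OF c1 c2 ab(1,3) t(1,3)] ..
    also have "\<dots> = double_integral (\<lambda>\<sigma> \<tau>. (\<psi> 0 (f [a] [t]) - \<psi> 0 (f [\<sigma>] [\<tau>]) + \<psi> 1 (f [a] [t]) * (f [\<sigma>] [t] - f [a] [t])) * d [\<sigma>] [\<tau>]) a b t t'"
      by (rule double_integral_cong) (simp add: algebra_simps)
    also have "\<bar>\<dots>\<bar> \<le> (M * (\<bar>L\<bar> * ((b - a) + (t' - t))) + M * (\<bar>L\<bar> * ((b - a) + (t' - t)))) * B * ((b - a) * (t' - t))"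
    proof (rule double_integral_bound[OF _ ab t])
      show "continuous_square T (\<lambda>\<sigma> \<tau>. (\<psi> 0 (f [a] [t]) - \<psi> 0 (f [\<sigma>] [\<tau>]) + \<psi> 1 (f [a] [t]) * (f [\<sigma>] [t] - f [a] [t])) * d [\<sigma>] [\<tau>])"
        by (intro cont)
      fix \<sigma> \<tau> assume \<sigma>\<tau>: "a \<le> \<sigma>" "\<sigma> \<le> b" "t \<le> \<tau>" "\<tau> \<le> t'"
      have L: "\<bar>f [\<sigma>] [\<tau>'] - f [a] [t]\<bar> \<le> \<bar>L\<bar> * ((b - a) + (t' - t))" if "t \<le> \<tau>'" "\<tau>' \<le> t'" for \<tau>'
      proof -
        have "\<bar>f [\<sigma>] [\<tau>'] - f [a] [t]\<bar> \<le> L * ((\<sigma> - a) + (\<tau>' - t))"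
          using ab t \<sigma>\<tau> that by (intro lip) auto
        also have "\<dots> \<le> \<bar>L\<bar> * ((b - a) + (t' - t))"
          using \<sigma>\<tau> that by (intro mult_mono) auto
        finally show ?thesis .
      qed
      have "\<bar>\<psi> 0 (f [a] [t]) - \<psi> 0 (f [\<sigma>] [\<tau>])\<bar> \<le> M * (\<bar>L\<bar> * ((b - a) + (t' - t)))"
        using lipschitz_bound[OF \<psi>, of "f [a] [t]" "f [\<sigma>] [\<tau>]"] mult_left_mono[OF L[OF \<sigma>\<tau>(3,4)] M(1)]
        by (simp add: abs_minus_commute)
      moreover have "\<bar>d [\<sigma>] [\<tau>]\<bar> \<le> B" using B(2) ab t \<sigma>\<tau> by simp
      ultimately show "\<bar>(\<psi> 0 (f [a] [t]) - \<psi> 0 (f [\<sigma>] [\<tau>]) + \<psi> 1 (f [a] [t]) * (f [\<sigma>] [t] - f [a] [t])) * d [\<sigma>] [\<tau>]\<bar>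
          \<le> (M * (\<bar>L\<bar> * ((b - a) + (t' - t))) + M * (\<bar>L\<bar> * ((b - a) + (t' - t)))) * B"
        using L[of t] t M(2) by (intro abs_mult_le abs_add_le) auto
    qed
    finally show ?thesis by (simp add: algebra_simps)
  qed
  let ?p = "uniform_partition s1 s2" and ?q = "uniform_partition t1 t2"
  note u = uniform_partition[OF st(2)] and v = uniform_partition[OF st(5)]
  have pr: "0 \<le> ?p n i" "?p n (Suc i) \<le> T" if "i < Suc n" for i n
    using cell_range[of "Suc n" "?p n" 0 T, OF u(4)] that u(1,2)[of n] st by auto
  have qr: "0 \<le> ?q n i" "?q n (Suc i) \<le> T" if "i < Suc n" for i n
    using cell_range[of "Suc n" "?q n" 0 T, OF v(4)] that v(1,2)[of n] st by auto
  define \<epsilon> where "\<epsilon> n = 2 * M * \<bar>L\<bar> * B * ((s2 - s1) + (t2 - t1)) * ((s2 - s1) * (t2 - t1)) / real (Suc n)" for n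
  have bnd: "\<bar>riemann_sum ?g (?p n) (Suc n) (?q n) (Suc n) - double_integral ?k s1 s2 t1 t2\<bar> \<le> \<epsilon> n" for n
  proof -
    let ?r = "(s2 - s1) / real (Suc n)" and ?r' = "(t2 - t1) / real (Suc n)"
    have "double_integral ?k s1 s2 t1 t2 = (\<Sum>i<Suc n. \<Sum>j<Suc n. double_integral ?k (?p n i) (?p n (Suc i)) (?q n j) (?q n (Suc j)))"
      using double_integral_partition[OF k, of "Suc n" "?p n" "Suc n" "?q n"] u v st by simp
    then have eq: "riemann_sum ?g (?p n) (Suc n) (?q n) (Suc n) - double_integral ?k s1 s2 t1 t2 =
        (\<Sum>i<Suc n. \<Sum>j<Suc n. ?g [?p n i, ?p n (Suc i)] [?q n j, ?q n (Suc j)] - double_integral ?k (?p n i) (?p n (Suc i)) (?q n j) (?q n (Suc j)))"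
      by (simp only: riemann_sum_def sum_subtractf)
    have "\<bar>riemann_sum ?g (?p n) (Suc n) (?q n) (Suc n) - double_integral ?k s1 s2 t1 t2\<bar>
        \<le> (\<Sum>i<Suc n. \<Sum>j<Suc n. 2 * M * \<bar>L\<bar> * B * (?r + ?r') * (?r * ?r'))"
      unfolding eq
    proof (rule order_trans[OF sum_abs], rule sum_mono, rule order_trans[OF sum_abs], rule sum_mono)
      fix i j assume "i \<in> {..<Suc n}" "j \<in> {..<Suc n}"
      then show "\<bar>?g [?p n i, ?p n (Suc i)] [?q n j, ?q n (Suc j)] - double_integral ?k (?p n i) (?p n (Suc i)) (?q n j) (?q n (Suc j))\<bar>
          \<le> 2 * M * \<bar>L\<bar> * B * (?r + ?r') * (?r * ?r')"
        using cell[of "?p n i" "?p n (Suc i)" "?q n j" "?q n (Suc j)"] pr[of i n] qr[of j n] u(4)[of n i] v(4)[of n j]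
        unfolding u(3) v(3) by simp
    qed
    also have "\<dots> = real (Suc n) * (real (Suc n) * (2 * M * \<bar>L\<bar> * B * (?r + ?r') * (?r * ?r')))"
      by (simp only: sum_constant card_lessThan)
    also have "\<dots> = \<epsilon> n" unfolding \<epsilon>_def by (rule grid_rescale) simp
    finally show ?thesis .
  qed
  have "\<epsilon> \<longlonglongrightarrow> 0"
    using LIMSEQ_Suc[OF lim_const_over_n[of "2 * M * \<bar>L\<bar> * B * ((s2 - s1) + (t2 - t1)) * ((s2 - s1) * (t2 - t1))"]]
    unfolding \<epsilon>_def[abs_def] .
  then have "(\<lambda>n. riemann_sum ?g (?p n) (Suc n) (?q n) (Suc n) - double_integral ?k s1 s2 t1 t2) \<longlonglongrightarrow> 0"
    by (rule Lim_null_comparison[rotated]) (simp only: real_norm_def bnd eventually_True)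
  then have "(\<lambda>n. riemann_sum ?g (?p n) (Suc n) (?q n) (Suc n)) \<longlonglongrightarrow> double_integral ?k s1 s2 t1 t2"
    by (rule LIM_zero_cancel)
  then show ?thesis using sewable_uniform_limit[OF sew st] LIMSEQ_unique by blast
qed

section \<open>Smooth fields\<close>

lemma smooth_field_derivatives:
  assumes "smooth_field T f" and T: "T > 0"
  shows "continuous_square T (\<lambda>\<sigma> \<tau>. f [\<sigma>] [\<tau>])"
    and "continuous_square T (\<lambda>\<sigma> \<tau>. partial1 T f [\<sigma>] [\<tau>])"
    and "continuous_square T (\<lambda>\<sigma> \<tau>. partial2 T f [\<sigma>] [\<tau>])"
    and "continuous_square T (\<lambda>\<sigma> \<tau>. D12 T f [\<sigma>] [\<tau>])"
    and "\<And>\<sigma> \<tau>. \<lbrakk>0 \<le> \<sigma>; \<sigma> \<le> T; 0 \<le> \<tau>; \<tau> \<le> T\<rbrakk> \<Longrightarrow>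
      ((\<lambda>\<sigma>. f [\<sigma>] [\<tau>]) has_real_derivative partial1 T f [\<sigma>] [\<tau>]) (at \<sigma> within {0..T})"
    and "\<And>\<sigma> \<tau>. \<lbrakk>0 \<le> \<sigma>; \<sigma> \<le> T; 0 \<le> \<tau>; \<tau> \<le> T\<rbrakk> \<Longrightarrow>
      ((\<lambda>\<tau>. f [\<sigma>] [\<tau>]) has_real_derivative partial2 T f [\<sigma>] [\<tau>]) (at \<tau> within {0..T})"
    and "\<And>\<sigma> \<tau>. \<lbrakk>0 \<le> \<sigma>; \<sigma> \<le> T; 0 \<le> \<tau>; \<tau> \<le> T\<rbrakk> \<Longrightarrow>
      ((\<lambda>\<tau>. partial1 T f [\<sigma>] [\<tau>]) has_real_derivative D12 T f [\<sigma>] [\<tau>]) (at \<tau> within {0..T})"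
proof -
  obtain D :: "nat \<Rightarrow> nat \<Rightarrow> real \<Rightarrow> real \<Rightarrow> real" where D0: "\<forall>s\<in>{0..T}. \<forall>t\<in>{0..T}. D 0 0 s t = f [s] [t]"
    and Dc: "\<forall>i j. continuous_on ({0..T} \<times> {0..T}) (\<lambda>(s, t). D i j s t)"
    and Dd: "\<forall>i j. \<forall>s\<in>{0..T}. \<forall>t\<in>{0..T}.
           ((\<lambda>\<sigma>. D i j \<sigma> t) has_real_derivative D (Suc i) j s t) (at s within {0..T}) \<and>
           ((\<lambda>\<tau>. D i j s \<tau>) has_real_derivative D i (Suc j) s t) (at t within {0..T})"
    using assms(1) unfolding smooth_field_def by blast
  have transfer: "(F has_real_derivative r') (at r within {0..T})"
    if "(G has_real_derivative r') (at r within {0..T})" "0 \<le> r" "r \<le> T" "\<And>v. \<lbrakk>0 \<le> v; v \<le> T\<rbrakk> \<Longrightarrow> F v = G v"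
    for F G :: "real \<Rightarrow> real" and r r'
    by (rule has_field_derivative_transform_within[OF that(1) zero_less_one]) (use that in auto)
  have vd: "vector_derivative F (at r within {0..T}) = r'"
    if "(G has_real_derivative r') (at r within {0..T})" "0 \<le> r" "r \<le> T" "\<And>v. \<lbrakk>0 \<le> v; v \<le> T\<rbrakk> \<Longrightarrow> F v = G v"
    for F G :: "real \<Rightarrow> real" and r r'
    using transfer[OF that] that(2,3)
    by (intro vector_derivative_within_closed_interval[OF T]) (auto simp: has_real_derivative_iff_has_vector_derivative)
  have d1: "((\<lambda>\<sigma>. D i j \<sigma> \<tau>) has_real_derivative D (Suc i) j \<sigma> \<tau>) (at \<sigma> within {0..T})"
    and d2: "((\<lambda>\<tau>. D i j \<sigma> \<tau>) has_real_derivative D i (Suc j) \<sigma> \<tau>) (at \<tau> within {0..T})"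
    if "0 \<le> \<sigma>" "\<sigma> \<le> T" "0 \<le> \<tau>" "\<tau> \<le> T" for i j \<sigma> \<tau>
    using Dd that by auto
  have p1: "partial1 T f [\<sigma>] [\<tau>] = D 1 0 \<sigma> \<tau>" and p2: "partial2 T f [\<sigma>] [\<tau>] = D 0 1 \<sigma> \<tau>"
    if "0 \<le> \<sigma>" "\<sigma> \<le> T" "0 \<le> \<tau>" "\<tau> \<le> T" for \<sigma> \<tau>
    unfolding partial1_def partial2_def using vd[OF d1[OF that, of 0 0]] vd[OF d2[OF that, of 0 0]] D0 that by simp_all
  have p12: "D12 T f [\<sigma>] [\<tau>] = D 1 1 \<sigma> \<tau>" if "0 \<le> \<sigma>" "\<sigma> \<le> T" "0 \<le> \<tau>" "\<tau> \<le> T" for \<sigma> \<tau>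
    unfolding D12_def partial1_def using vd[OF d1[OF that, of 0 1]] p2 that by simp
  have c: "continuous_square T (D i j)" for i j using Dc by (simp add: continuous_square_def)
  show "continuous_square T (\<lambda>\<sigma> \<tau>. f [\<sigma>] [\<tau>])"
    using continuous_square_cong[of T "D 0 0" "\<lambda>\<sigma> \<tau>. f [\<sigma>] [\<tau>]"] c D0 by simp
  show "continuous_square T (\<lambda>\<sigma> \<tau>. partial1 T f [\<sigma>] [\<tau>])" "continuous_square T (\<lambda>\<sigma> \<tau>. partial2 T f [\<sigma>] [\<tau>])"
    "continuous_square T (\<lambda>\<sigma> \<tau>. D12 T f [\<sigma>] [\<tau>])"
    using continuous_square_cong[of T "\<lambda>\<sigma> \<tau>. partial1 T f [\<sigma>] [\<tau>]" "D 1 0", OF p1]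
      continuous_square_cong[of T "\<lambda>\<sigma> \<tau>. partial2 T f [\<sigma>] [\<tau>]" "D 0 1", OF p2]
      continuous_square_cong[of T "\<lambda>\<sigma> \<tau>. D12 T f [\<sigma>] [\<tau>]" "D 1 1", OF p12] c by simp_all
  fix \<sigma> \<tau> assume r: "0 \<le> \<sigma>" "\<sigma> \<le> T" "0 \<le> \<tau>" "\<tau> \<le> T"
  show "((\<lambda>\<sigma>. f [\<sigma>] [\<tau>]) has_real_derivative partial1 T f [\<sigma>] [\<tau>]) (at \<sigma> within {0..T})"
    unfolding p1[OF r] by (rule transfer[OF d1[OF r, of 0 0, folded One_nat_def]]) (use r D0 in auto)
  show "((\<lambda>\<tau>. f [\<sigma>] [\<tau>]) has_real_derivative partial2 T f [\<sigma>] [\<tau>]) (at \<tau> within {0..T})"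
    unfolding p2[OF r] by (rule transfer[OF d2[OF r, of 0 0, folded One_nat_def]]) (use r D0 in auto)
  show "((\<lambda>\<tau>. partial1 T f [\<sigma>] [\<tau>]) has_real_derivative D12 T f [\<sigma>] [\<tau>]) (at \<tau> within {0..T})"
    unfolding p12[OF r] by (rule transfer[OF d2[OF r, of 1 0, folded One_nat_def]]) (use r p1 in auto)
qed

lemma smooth_field_continuous:
  assumes "smooth_field T f" "T > 0"
  shows "continuous_square T (\<lambda>\<sigma> \<tau>. f [\<sigma>] [\<tau>])" "continuous_square T (\<lambda>\<sigma> \<tau>. D12 T f [\<sigma>] [\<tau>])"
    "continuous_square T (\<lambda>\<sigma> \<tau>. Dhat12 T f [\<sigma>] [\<tau>])"
  unfolding Dhat12_def
  by (rule smooth_field_derivatives[OF assms] continuous_square_intros(3)[OF smooth_field_derivatives(2,3)[OF assms]])+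

lemma smooth_field_lipschitz:
  assumes "smooth_field T f" "T > 0"
  shows "\<exists>L. \<forall>\<sigma> \<sigma>' \<tau> \<tau>'. 0 \<le> \<sigma> \<longrightarrow> \<sigma> \<le> \<sigma>' \<longrightarrow> \<sigma>' \<le> T \<longrightarrow> 0 \<le> \<tau> \<longrightarrow> \<tau> \<le> \<tau>' \<longrightarrow> \<tau>' \<le> T \<longrightarrow>
    \<bar>f [\<sigma>'] [\<tau>'] - f [\<sigma>] [\<tau>]\<bar> \<le> L * ((\<sigma>' - \<sigma>) + (\<tau>' - \<tau>))"
proof -
  note D = smooth_field_derivatives[OF assms]
  obtain A where A: "A \<ge> 0" "\<forall>\<sigma>\<in>{0..T}. \<forall>\<tau>\<in>{0..T}. \<bar>partial1 T f [\<sigma>] [\<tau>]\<bar> \<le> A"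
    using continuous_square_bounded[OF D(2)] by blast
  obtain B where B: "B \<ge> 0" "\<forall>\<sigma>\<in>{0..T}. \<forall>\<tau>\<in>{0..T}. \<bar>partial2 T f [\<sigma>] [\<tau>]\<bar> \<le> B"
    using continuous_square_bounded[OF D(3)] by blast
  have "\<bar>f [\<sigma>'] [\<tau>'] - f [\<sigma>] [\<tau>]\<bar> \<le> (A + B) * ((\<sigma>' - \<sigma>) + (\<tau>' - \<tau>))"
    if r: "0 \<le> \<sigma>" "\<sigma> \<le> \<sigma>'" "\<sigma>' \<le> T" "0 \<le> \<tau>" "\<tau> \<le> \<tau>'" "\<tau>' \<le> T" for \<sigma> \<sigma>' \<tau> \<tau>'
  proof -
    have "norm (f [\<sigma>'] [\<tau>'] - f [\<sigma>] [\<tau>']) \<le> A * norm (\<sigma>' - \<sigma>)"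
      by (rule field_differentiable_bound[of "{0..T}" "\<lambda>\<sigma>. f [\<sigma>] [\<tau>']" "\<lambda>\<sigma>. partial1 T f [\<sigma>] [\<tau>']"]) (use D(5) A r in auto)
    moreover have "norm (f [\<sigma>] [\<tau>'] - f [\<sigma>] [\<tau>]) \<le> B * norm (\<tau>' - \<tau>)"
      by (rule field_differentiable_bound[of "{0..T}" "\<lambda>\<tau>. f [\<sigma>] [\<tau>]" "\<lambda>\<tau>. partial2 T f [\<sigma>] [\<tau>]"]) (use D(6) B r in auto)
    moreover have "A * (\<tau>' - \<tau>) \<ge> 0" "B * (\<sigma>' - \<sigma>) \<ge> 0" using A B r by auto
    ultimately show ?thesis using r by (simp add: algebra_simps)
  qed
  then show ?thesis by blast
qed

text \<open>The chain rule for the mixed derivative of \<open>\<phi>(f)\<close>, in integrated form.\<close>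
lemma smooth_change_of_variables:
  assumes "smooth_field T f" "T > 0" and \<phi>: "bounded_derivs M \<phi> (Suc (Suc (Suc N)))"
    and st: "0 \<le> s1" "s1 \<le> s2" "s2 \<le> T" "0 \<le> t1" "t1 \<le> t2" "t2 \<le> T"
  shows "delta (\<lambda>s t. \<phi> 0 (f s t)) [s1, s2] [t1, t2] =
    double_integral (\<lambda>\<sigma> \<tau>. \<phi> 1 (f [\<sigma>] [\<tau>]) * D12 T f [\<sigma>] [\<tau>]) s1 s2 t1 t2
    + double_integral (\<lambda>\<sigma> \<tau>. \<phi> 2 (f [\<sigma>] [\<tau>]) * Dhat12 T f [\<sigma>] [\<tau>]) s1 s2 t1 t2"
proof -
  note D = smooth_field_derivatives[OF assms(1,2)]
  have d\<phi>: "(\<phi> 0 has_real_derivative \<phi> 1 u) (at u)" "(\<phi> 1 has_real_derivative \<phi> 2 u) (at u)" for u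
    using \<phi> by (auto simp: bounded_derivs_def numeral_2_eq_2)
  have "(\<phi> 2 has_real_derivative \<phi> 3 u) (at u)" for u
    using \<phi> by (auto simp: bounded_derivs_def numeral_2_eq_2 numeral_3_eq_3)
  then have "continuous_on UNIV (\<phi> 1)" "continuous_on UNIV (\<phi> 2)"
    using d\<phi>(2) by (auto intro!: continuous_at_imp_continuous_on DERIV_isCont simp del: One_nat_def)
  then have \<phi>c: "continuous_square T (\<lambda>\<sigma> \<tau>. \<phi> 1 (f [\<sigma>] [\<tau>]))" "continuous_square T (\<lambda>\<sigma> \<tau>. \<phi> 2 (f [\<sigma>] [\<tau>]))"
    using continuous_square_fun[OF D(1)] by auto
  note c = smooth_field_continuous[OF assms(1,2)]
  have "double_integral (\<lambda>\<sigma> \<tau>. \<phi> 1 (f [\<sigma>] [\<tau>]) * D12 T f [\<sigma>] [\<tau>] + \<phi> 2 (f [\<sigma>] [\<tau>]) * Dhat12 T f [\<sigma>] [\<tau>]) s1 s2 t1 t2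
      = double_integral (\<lambda>\<sigma> \<tau>. \<phi> 2 (f [\<sigma>] [\<tau>]) * partial2 T f [\<sigma>] [\<tau>] * partial1 T f [\<sigma>] [\<tau>]
          + D12 T f [\<sigma>] [\<tau>] * \<phi> 1 (f [\<sigma>] [\<tau>])) s1 s2 t1 t2"
    by (rule double_integral_cong) (simp add: Dhat12_def)
  also have "\<dots> = \<phi> 0 (f [s2] [t2]) - \<phi> 0 (f [s1] [t2]) - \<phi> 0 (f [s2] [t1]) + \<phi> 0 (f [s1] [t1])"
    by (rule double_integral_derivative[OF st DERIV_chain2[OF d\<phi>(1) D(5)] DERIV_mult[OF DERIV_chain2[OF d\<phi>(2) D(6)] D(7)]])
  finally have eq: "double_integral (\<lambda>\<sigma> \<tau>. \<phi> 1 (f [\<sigma>] [\<tau>]) * D12 T f [\<sigma>] [\<tau>] + \<phi> 2 (f [\<sigma>] [\<tau>]) * Dhat12 T f [\<sigma>] [\<tau>]) s1 s2 t1 t2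
      = \<phi> 0 (f [s2] [t2]) - \<phi> 0 (f [s1] [t2]) - \<phi> 0 (f [s2] [t1]) + \<phi> 0 (f [s1] [t1])" .
  show ?thesis
    using eq double_integral_add[OF continuous_square_intros(3)[OF \<phi>c(1) c(2)] continuous_square_intros(3)[OF \<phi>c(2) c(3)] st(1,3,4,6)]
    by (simp add: delta_def)
qed

lemma smooth_delta:
  assumes "smooth_field T f" "T > 0"
    and st: "0 \<le> s1" "s1 \<le> s2" "s2 \<le> T" "0 \<le> t1" "t1 \<le> t2" "t2 \<le> T"
  shows "delta f [s1, s2] [t1, t2] = double_integral (\<lambda>\<sigma> \<tau>. D12 T f [\<sigma>] [\<tau>]) s1 s2 t1 t2"
  using double_integral_derivative[OF st smooth_field_derivatives(5,7)[OF assms(1,2)]] by (simp add: delta_def)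

lemma smooth_lift_component_integrals:
  assumes "smooth_field T f" "T > 0"
    and st: "0 \<le> s1" "s1 \<le> s2" "s2 \<le> T" "0 \<le> t1" "t1 \<le> t2" "t2 \<le> T"
  shows "x_1_2 (smooth_lift T f) [s1, s2] [t1, t2] = double_integral (\<lambda>\<sigma> \<tau>. D12 T f [\<sigma>] [\<tau>]) s1 s2 t1 t2"
    and "x_h1_h2 (smooth_lift T f) [s1, s2] [t1, t2] = double_integral (\<lambda>\<sigma> \<tau>. Dhat12 T f [\<sigma>] [\<tau>]) s1 s2 t1 t2"
  using smooth_delta[OF assms] by (simp_all add: smooth_lift_def double_integral_def Dhat12_def)

text \<open>
  For a smooth field both rough integrals are ordinary integrals, and the theorem is the chain rule.
\<close>
lemma smooth_rough_decomposition:
  assumes f: "smooth_field T f" and T: "T > 0" and \<phi>: "bounded_derivs M \<phi> 5"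
    and sew: "sewable T a b K (controlled_integrand (\<lambda>i. \<phi> (Suc i)) f (x_1_2 (smooth_lift T f)) (x_11_0d2 (smooth_lift T f)))"
    and sew': "sewable T a b K (controlled_integrand (\<lambda>i. \<phi> (Suc (Suc i))) f (x_h1_h2 (smooth_lift T f)) (x_1h1_0dh2 (smooth_lift T f)))"
    and st: "0 \<le> s1" "s1 \<le> s2" "s2 \<le> T" "0 \<le> t1" "t1 \<le> t2" "t2 \<le> T"
  shows "delta (\<lambda>s t. \<phi> 0 (f s t)) [s1, s2] [t1, t2] =
    rough_integral T (controlled_integrand (\<lambda>i. \<phi> (Suc i)) f (x_1_2 (smooth_lift T f)) (x_11_0d2 (smooth_lift T f))) [s1, s2] [t1, t2]
    + rough_integral T (controlled_integrand (\<lambda>i. \<phi> (Suc (Suc i))) f (x_h1_h2 (smooth_lift T f)) (x_1h1_0dh2 (smooth_lift T f))) [s1, s2] [t1, t2]"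
proof -
  have l: "x_11_0d2 (smooth_lift T f) = lift_0dot f (D12 T f)" "x_1h1_0dh2 (smooth_lift T f) = lift_0dot f (Dhat12 T f)"
    by (simp_all add: smooth_lift_def)
  obtain L where L: "\<bar>f [\<sigma>'] [\<tau>'] - f [\<sigma>] [\<tau>]\<bar> \<le> L * ((\<sigma>' - \<sigma>) + (\<tau>' - \<tau>))"
    if "0 \<le> \<sigma>" "\<sigma> \<le> \<sigma>'" "\<sigma>' \<le> T" "0 \<le> \<tau>" "\<tau> \<le> \<tau>'" "\<tau>' \<le> T" for \<sigma> \<sigma>' \<tau> \<tau>'
    using smooth_field_lipschitz[OF f T] by blast
  note c = smooth_field_continuous[OF f T]
  have b: "bounded_derivs M \<phi> (Suc (Suc (Suc (Suc (Suc 0)))))" using \<phi> by (simp add: eval_nat_numeral)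
  note b1 = bounded_derivs_Suc[OF b] and b2 = bounded_derivs_Suc[OF bounded_derivs_Suc[OF b]]
  note i1 = smooth_rough_integral[OF c(1,2) L b1 smooth_lift_component_integrals(1)[OF f T] sew[unfolded l] st]
  note i2 = smooth_rough_integral[OF c(1,3) L b2 smooth_lift_component_integrals(2)[OF f T] sew'[unfolded l] st]
  show ?thesis
    using i1 i2 smooth_change_of_variables[OF f T b st] unfolding l by (simp only: One_nat_def numeral_2_eq_2)
qed

section \<open>Spaces of increments\<close>

lemma incr_space_vanishes: "f \<in> incr_space T k l \<Longrightarrow> vanishes_on_diagonals T k l f"
  by (simp add: incr_space_def vanishes_on_diagonals_def)

text \<open>The pairs of sequences whose first \<open>k\<close>, respectively \<open>l\<close>, coordinates form ordered tuples.\<close>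
definition tuple_points :: "real \<Rightarrow> nat \<Rightarrow> nat \<Rightarrow> ((nat \<Rightarrow> real) \<times> (nat \<Rightarrow> real)) set" where
  "tuple_points T k l = {p. map (fst p) [0..<k] \<in> ordered_tuples T k \<and> map (snd p) [0..<l] \<in> ordered_tuples T l}"

lemma incr_spaceI:
  assumes "continuous_on (tuple_points T k l) (\<lambda>p. f (map (fst p) [0..<k]) (map (snd p) [0..<l]))"
    and "vanishes_on_diagonals T k l f"
  shows "f \<in> incr_space T k l"
  using assms unfolding incr_space_def tuple_points_def vanishes_on_diagonals_def mem_Collect_eq
  by (rule conjI)

text \<open>An increment evaluated at selected coordinates of a larger tuple depends continuously on the tuple.\<close>
lemma incr_space_select:
  fixes A :: "((nat \<Rightarrow> real) \<times> (nat \<Rightarrow> real)) set"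
  assumes f: "f \<in> incr_space T (length J) (length K)"
    and "\<And>p. p \<in> A \<Longrightarrow> map (fst p) J \<in> ordered_tuples T (length J) \<and> map (snd p) K \<in> ordered_tuples T (length K)"
  shows "continuous_on A (\<lambda>p. f (map (fst p) J) (map (snd p) K))"
proof -
  have nth: "map (\<lambda>i. h (L ! i)) [0..<length L] = map h L" for h :: "nat \<Rightarrow> real" and L
    by (rule nth_equalityI) auto
  have coord: "continuous_on A (\<lambda>p. fst p i)" "continuous_on A (\<lambda>p. snd p i)" for i
    by (rule continuous_on_compose2[OF continuous_on_product_coordinates]; auto intro: continuous_intros)+
  have fc: "continuous_on (tuple_points T (length J) (length K)) (\<lambda>p. f (map (fst p) [0..<length J]) (map (snd p) [0..<length K]))"
    using f unfolding incr_space_def tuple_points_def by (elim CollectE conjE)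
  have "continuous_on A (\<lambda>p. f (map (fst (\<lambda>i. fst p (J ! i), \<lambda>i. snd p (K ! i))) [0..<length J])
      (map (snd (\<lambda>i. fst p (J ! i), \<lambda>i. snd p (K ! i))) [0..<length K]))"
  proof (rule continuous_on_compose2[OF fc])
    show "continuous_on A (\<lambda>p. (\<lambda>i. fst p (J ! i), \<lambda>i. snd p (K ! i)))"
      by (intro continuous_on_Pair continuous_on_coordinatewise_then_product coord)
    show "(\<lambda>p. (\<lambda>i. fst p (J ! i), \<lambda>i. snd p (K ! i))) ` A \<subseteq> tuple_points T (length J) (length K)"
      using assms(2) by (auto simp: tuple_points_def nth)
  qed
  then show ?thesis by (simp add: nth)
qed

lemma upt_simps: "[0..<Suc 0] = [0]" "[0..<2] = [0, 1]" "[0..<3] = [0, 1, 2]"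
  by (simp_all add: numeral_2_eq_2 numeral_3_eq_3)

lemma tuple_index_simps:
  "(\<exists>i. Suc i < 2 \<and> P i) \<longleftrightarrow> P 0" "(\<exists>i. Suc i < 3 \<and> P i) \<longleftrightarrow> P 0 \<or> P 1"
  by (auto simp: numeral_2_eq_2 numeral_3_eq_3 less_Suc_eq)

lemma ball_tuples:
  "(\<forall>s\<in>ordered_tuples T (Suc 0). Q s) \<longleftrightarrow> (\<forall>s. 0 \<le> s \<longrightarrow> s \<le> T \<longrightarrow> Q [s])"
  "(\<forall>s\<in>ordered_tuples T 2. Q s) \<longleftrightarrow> (\<forall>s1 s2. 0 \<le> s1 \<longrightarrow> s1 \<le> s2 \<longrightarrow> s2 \<le> T \<longrightarrow> Q [s1, s2])"
  "(\<forall>s\<in>ordered_tuples T 3. Q s) \<longleftrightarrow>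
    (\<forall>s1 s2 s3. 0 \<le> s1 \<longrightarrow> s1 \<le> s2 \<longrightarrow> s2 \<le> s3 \<longrightarrow> s3 \<le> T \<longrightarrow> Q [s1, s2, s3])"
  using tuple_cases tuple_simps by metis+

lemma vanishes_simps:
  "vanishes_on_diagonals T 2 (Suc 0) f \<longleftrightarrow> (\<forall>s t. 0 \<le> s \<longrightarrow> s \<le> T \<longrightarrow> 0 \<le> t \<longrightarrow> t \<le> T \<longrightarrow> f [s, s] [t] = 0)"
  "vanishes_on_diagonals T (Suc 0) 2 f \<longleftrightarrow> (\<forall>s t. 0 \<le> s \<longrightarrow> s \<le> T \<longrightarrow> 0 \<le> t \<longrightarrow> t \<le> T \<longrightarrow> f [s] [t, t] = 0)"
  "vanishes_on_diagonals T 2 2 f \<longleftrightarrow> (\<forall>s1 s2 t1 t2. 0 \<le> s1 \<longrightarrow> s1 \<le> s2 \<longrightarrow> s2 \<le> T \<longrightarrow> 0 \<le> t1 \<longrightarrow> t1 \<le> t2 \<longrightarrow> t2 \<le> T \<longrightarrow>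
     s1 = s2 \<or> t1 = t2 \<longrightarrow> f [s1, s2] [t1, t2] = 0)"
  "vanishes_on_diagonals T 2 3 f \<longleftrightarrow> (\<forall>s1 s2 t1 t2 t3. 0 \<le> s1 \<longrightarrow> s1 \<le> s2 \<longrightarrow> s2 \<le> T \<longrightarrow> 0 \<le> t1 \<longrightarrow> t1 \<le> t2 \<longrightarrow> t2 \<le> t3 \<longrightarrow> t3 \<le> T \<longrightarrow>
     s1 = s2 \<or> t1 = t2 \<or> t2 = t3 \<longrightarrow> f [s1, s2] [t1, t2, t3] = 0)"
  "vanishes_on_diagonals T 3 2 f \<longleftrightarrow> (\<forall>s1 s2 s3 t1 t2. 0 \<le> s1 \<longrightarrow> s1 \<le> s2 \<longrightarrow> s2 \<le> s3 \<longrightarrow> s3 \<le> T \<longrightarrow> 0 \<le> t1 \<longrightarrow> t1 \<le> t2 \<longrightarrow> t2 \<le> T \<longrightarrow>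
     s1 = s2 \<or> s2 = s3 \<or> t1 = t2 \<longrightarrow> f [s1, s2, s3] [t1, t2] = 0)"
  "vanishes_on_diagonals T 3 3 f \<longleftrightarrow> (\<forall>s1 s2 s3 t1 t2 t3. 0 \<le> s1 \<longrightarrow> s1 \<le> s2 \<longrightarrow> s2 \<le> s3 \<longrightarrow> s3 \<le> T \<longrightarrow> 0 \<le> t1 \<longrightarrow> t1 \<le> t2 \<longrightarrow> t2 \<le> t3 \<longrightarrow> t3 \<le> T \<longrightarrow>
     s1 = s2 \<or> s2 = s3 \<or> t1 = t2 \<or> t2 = t3 \<longrightarrow> f [s1, s2, s3] [t1, t2, t3] = 0)"
  unfolding vanishes_on_diagonals_def tuple_index_simps ball_tuples by auto

lemma incr_space_delta:
  assumes f: "f \<in> incr_space T 2 2"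
  shows "delta1 f \<in> incr_space T 3 2" "delta2 f \<in> incr_space T 2 3" "delta f \<in> incr_space T 3 3"
proof -
  have v: "\<And>s1 s2 t1 t2. \<lbrakk>0 \<le> s1; s1 \<le> s2; s2 \<le> T; 0 \<le> t1; t1 \<le> t2; t2 \<le> T; s1 = s2 \<or> t1 = t2\<rbrakk> \<Longrightarrow> f [s1, s2] [t1, t2] = 0"
    using incr_space_vanishes[OF f] unfolding vanishes_simps by blast
  have sel: "continuous_on (tuple_points T k l) (\<lambda>p. f [fst p i, fst p i'] [snd p j, snd p j'])"
    if "\<And>p. p \<in> tuple_points T k l \<Longrightarrow> 0 \<le> fst p i \<and> fst p i \<le> fst p i' \<and> fst p i' \<le> T \<and> 0 \<le> snd p j \<and> snd p j \<le> snd p j' \<and> snd p j' \<le> T"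
    for k l i i' j j'
    using incr_space_select[of f T "[i, i']" "[j, j']" "tuple_points T k l"] f that by (simp add: numeral_2_eq_2[symmetric])
  show "delta1 f \<in> incr_space T 3 2"
  proof (rule incr_spaceI)
    show "continuous_on (tuple_points T 3 2) (\<lambda>p. delta1 f (map (fst p) [0..<3]) (map (snd p) [0..<2]))"
      unfolding upt_simps list.map delta1.simps
      by (intro continuous_on_diff sel) (auto simp: tuple_points_def upt_simps)
    show "vanishes_on_diagonals T 3 2 (delta1 f)" unfolding vanishes_simps by (auto simp: v)
  qed
  show "delta2 f \<in> incr_space T 2 3"
  proof (rule incr_spaceI)
    show "continuous_on (tuple_points T 2 3) (\<lambda>p. delta2 f (map (fst p) [0..<2]) (map (snd p) [0..<3]))"
      unfolding upt_simps list.map delta2_eqs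
      by (intro continuous_on_diff sel) (auto simp: tuple_points_def upt_simps)
    show "vanishes_on_diagonals T 2 3 (delta2 f)" unfolding vanishes_simps by (auto simp: v)
  qed
  show "delta f \<in> incr_space T 3 3"
  proof (rule incr_spaceI)
    show "continuous_on (tuple_points T 3 3) (\<lambda>p. delta f (map (fst p) [0..<3]) (map (snd p) [0..<3]))"
      unfolding upt_simps list.map delta_def delta1.simps delta2_eqs
      by (intro continuous_on_diff sel) (auto simp: tuple_points_def upt_simps)
    show "vanishes_on_diagonals T 3 3 (delta f)" unfolding vanishes_simps by (auto simp: v delta_def)
  qed
qed

lemma controlled_integrand_incr_space:
  assumes x: "x \<in> incr_space T 1 1" and w: "w \<in> incr_space T 2 2" and z: "z \<in> incr_space T 2 2"
    and \<psi>: "bounded_derivs M \<psi> (Suc (Suc N))"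
  shows "controlled_integrand \<psi> x w z \<in> incr_space T 2 2"
proof (rule incr_spaceI)
  have vw: "\<And>s1 s2 t1 t2. \<lbrakk>0 \<le> s1; s1 \<le> s2; s2 \<le> T; 0 \<le> t1; t1 \<le> t2; t2 \<le> T; s1 = s2 \<or> t1 = t2\<rbrakk> \<Longrightarrow> w [s1, s2] [t1, t2] = 0"
    using incr_space_vanishes[OF w] unfolding vanishes_simps by blast
  have vz: "\<And>s1 s2 t1 t2. \<lbrakk>0 \<le> s1; s1 \<le> s2; s2 \<le> T; 0 \<le> t1; t1 \<le> t2; t2 \<le> T; s1 = s2 \<or> t1 = t2\<rbrakk> \<Longrightarrow> z [s1, s2] [t1, t2] = 0"
    using incr_space_vanishes[OF z] unfolding vanishes_simps by blast
  show "vanishes_on_diagonals T 2 2 (controlled_integrand \<psi> x w z)"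
    unfolding vanishes_simps by (auto simp: vw vz)
  have "(\<psi> 0 has_real_derivative \<psi> 1 u) (at u)" "(\<psi> 1 has_real_derivative \<psi> 2 u) (at u)" for u
    using \<psi> by (auto simp: bounded_derivs_def numeral_2_eq_2)
  then have \<psi>c: "continuous_on UNIV (\<psi> 0)" "continuous_on UNIV (\<psi> 1)"
    by (auto intro!: continuous_at_imp_continuous_on DERIV_isCont simp del: One_nat_def)
  have cx: "continuous_on (tuple_points T 2 2) (\<lambda>p. x [fst p 0] [snd p 0])"
    using incr_space_select[of x T "[0]" "[0]" "tuple_points T 2 2"] x by (auto simp: tuple_points_def upt_simps)
  have cwz: "continuous_on (tuple_points T 2 2) (\<lambda>p. h [fst p 0, fst p 1] [snd p 0, snd p 1])" if "h \<in> incr_space T 2 2" for h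
    using incr_space_select[of h T "[0, 1]" "[0, 1]" "tuple_points T 2 2"] that
    by (auto simp: tuple_points_def upt_simps numeral_2_eq_2[symmetric])
  show "continuous_on (tuple_points T 2 2) (\<lambda>p. controlled_integrand \<psi> x w z (map (fst p) [0..<2]) (map (snd p) [0..<2]))"
    unfolding upt_simps list.map controlled_integrand_eq
    by (intro continuous_on_add continuous_on_mult cwz w z
        continuous_on_compose2[OF \<psi>c(1) cx] continuous_on_compose2[OF \<psi>c(2) cx]) auto
qed

lemma holder_spaceI:
  assumes "f \<in> incr_space T k l" "C \<ge> 0" "holder_bounded T k l a b C f"
  shows "f \<in> holder_space T k l a b"
  unfolding holder_space_def using assms holder_norm_finite[OF assms(3,2)] by auto

lemma (in sheet_component) integrand_rough_integrable:
  assumes x: "x \<in> incr_space T 1 1" and w: "w \<in> incr_space T 2 2" and z: "z \<in> incr_space T 2 2"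
    and \<psi>: "bounded_derivs M \<psi> 3" and \<gamma>: "\<gamma>1 < 1" "\<gamma>2 < 1"
  shows "rough_integrable T (controlled_integrand \<psi> x w z)"
proof -
  let ?g = "controlled_integrand \<psi> x w z"
  have g: "?g \<in> incr_space T 2 2"
    using controlled_integrand_incr_space[OF x w z psi_derivs(1)[OF \<psi>]] .
  have "delta1 ?g \<in> holder_space T 3 2 (3 * \<gamma>1) \<gamma>2"
  proof (rule holder_spaceI[OF incr_space_delta(1)[OF g]])
    show "0 \<le> 2 * M ^ 4" using M by simp
    show "holder_bounded T 3 2 (3 * \<gamma>1) \<gamma>2 (2 * M ^ 4) (delta1 ?g)"
      unfolding holder_bounded_def using integrand_delta1_bound[OF \<psi>] by (auto dest!: tuple_cases)
  qed
  moreover have "delta2 ?g \<in> holder_space T 2 3 \<gamma>1 (2 * \<gamma>2)"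
  proof (rule holder_spaceI[OF incr_space_delta(2)[OF g]])
    show "0 \<le> 2 * M ^ 3 * (1 + T powr \<gamma>1)" using M by simp
    show "holder_bounded T 2 3 \<gamma>1 (2 * \<gamma>2) (2 * M ^ 3 * (1 + T powr \<gamma>1)) (delta2 ?g)"
      unfolding holder_bounded_def using integrand_delta2_bound[OF \<psi>] by (auto dest!: tuple_cases)
  qed
  moreover have "delta ?g \<in> holder_space T 3 3 (3 * \<gamma>1) (2 * \<gamma>2)"
  proof (rule holder_spaceI[OF incr_space_delta(3)[OF g]])
    show "0 \<le> 5 * M ^ 5" using M by simp
    show "holder_bounded T 3 3 (3 * \<gamma>1) (2 * \<gamma>2) (5 * M ^ 5) (delta ?g)"
      unfolding holder_bounded_def using integrand_delta_bound[OF \<psi>] by (auto dest!: tuple_cases)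
  qed
  ultimately show ?thesis
    unfolding rough_integrable_def using g \<gamma> \<gamma>1 \<gamma>2
    by (intro conjI exI[of _ "3 * \<gamma>1"] exI[of _ "2 * \<gamma>2"] exI[of _ \<gamma>1] exI[of _ \<gamma>2]) auto
qed

section \<open>Passing to the limit in the rough sheet\<close>

lemma holder_limit_pointwise:
  assumes "holder_limit T k l a b C F f" "s \<in> ordered_tuples T k" "t \<in> ordered_tuples T l"
  shows "(\<lambda>n. F n s t) \<longlonglongrightarrow> f s t"
  using assms by (simp add: holder_limit_def)

lemma holder_tendsto_limit:
  assumes "holder_tendsto T k l a b F f" and "\<And>n. vanishes_on_diagonals T k l (F n)"
    and "k \<ge> 1" "l \<ge> 1" "a' \<le> a" "b' \<le> b"
  shows "\<exists>C. holder_limit T k l a' b' C F f"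
  using assms holder_convergence[of T k l a b f F a' b'] incr_space_vanishes[of f T k l]
  by (auto simp: holder_tendsto_def holder_space_def)

lemma field_limits:
  assumes x: "x \<in> field_space T \<gamma>1 \<gamma>2"
    and lim: "(\<lambda>n. field_norm T \<gamma>1 \<gamma>2 (\<lambda>s t. x s t - xn n s t)) \<longlonglongrightarrow> 0"
    and g: "g1 \<le> \<gamma>1" "g2 \<le> \<gamma>2"
  shows "\<exists>C. holder_limit T 2 1 g1 0 C (\<lambda>n. delta1 (xn n)) (delta1 x)"
    and "\<exists>C. holder_limit T 1 2 0 g2 C (\<lambda>n. delta2 (xn n)) (delta2 x)"
    and "\<exists>C. holder_limit T 2 2 g1 g2 C (\<lambda>n. delta (xn n)) (delta x)"
proof -
  have fin: "field_norm T \<gamma>1 \<gamma>2 x < \<infinity>" using x by (simp add: field_space_def)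
  have e1: "holder_norm T 2 1 \<gamma>1 0 (\<lambda>s t. delta1 (xn n) s t - delta1 x s t) = holder_norm T 2 1 \<gamma>1 0 (delta1 (\<lambda>s t. x s t - xn n s t))" for n
    by (rule holder_norm_cong) (auto dest!: tuple_cases)
  have e2: "holder_norm T 1 2 0 \<gamma>2 (\<lambda>s t. delta2 (xn n) s t - delta2 x s t) = holder_norm T 1 2 0 \<gamma>2 (delta2 (\<lambda>s t. x s t - xn n s t))" for n
    by (rule holder_norm_cong) (auto dest!: tuple_cases)
  have e12: "holder_norm T 2 2 \<gamma>1 \<gamma>2 (\<lambda>s t. delta (xn n) s t - delta x s t) = holder_norm T 2 2 \<gamma>1 \<gamma>2 (delta (\<lambda>s t. x s t - xn n s t))" for n
    by (rule holder_norm_cong) (auto dest!: tuple_cases simp: delta_def)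
  have le: "holder_norm T 2 1 \<gamma>1 0 (delta1 f) \<le> field_norm T \<gamma>1 \<gamma>2 f" "holder_norm T 1 2 0 \<gamma>2 (delta2 f) \<le> field_norm T \<gamma>1 \<gamma>2 f"
    "holder_norm T 2 2 \<gamma>1 \<gamma>2 (delta f) \<le> field_norm T \<gamma>1 \<gamma>2 f" for f
    unfolding field_norm_def by (auto intro: add_increasing add_increasing2)
  have small: "(\<lambda>n. h n) \<longlonglongrightarrow> 0" if "\<And>n. h n \<le> field_norm T \<gamma>1 \<gamma>2 (\<lambda>s t. x s t - xn n s t)" for h :: "nat \<Rightarrow> ennreal"
    by (rule tendsto_sandwich[OF _ _ tendsto_const lim]) (use that in auto)
  show "\<exists>C. holder_limit T 2 1 g1 0 C (\<lambda>n. delta1 (xn n)) (delta1 x)"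
  proof (rule holder_convergence)
    show "holder_norm T 2 1 \<gamma>1 0 (delta1 x) < \<infinity>" using le(1) fin by (rule le_less_trans)
    show "(\<lambda>n. holder_norm T 2 1 \<gamma>1 0 (\<lambda>s t. delta1 (xn n) s t - delta1 x s t)) \<longlonglongrightarrow> 0"
      unfolding e1 by (rule small) (rule le)
  qed (use g in \<open>auto simp: vanishes_simps\<close>)
  show "\<exists>C. holder_limit T 1 2 0 g2 C (\<lambda>n. delta2 (xn n)) (delta2 x)"
  proof (rule holder_convergence)
    show "holder_norm T 1 2 0 \<gamma>2 (delta2 x) < \<infinity>" using le(2) fin by (rule le_less_trans)
    show "(\<lambda>n. holder_norm T 1 2 0 \<gamma>2 (\<lambda>s t. delta2 (xn n) s t - delta2 x s t)) \<longlonglongrightarrow> 0"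
      unfolding e2 by (rule small) (rule le)
  qed (use g in \<open>auto simp: vanishes_simps\<close>)
  show "\<exists>C. holder_limit T 2 2 g1 g2 C (\<lambda>n. delta (xn n)) (delta x)"
  proof (rule holder_convergence)
    show "holder_norm T 2 2 \<gamma>1 \<gamma>2 (delta x) < \<infinity>" using le(3) fin by (rule le_less_trans)
    show "(\<lambda>n. holder_norm T 2 2 \<gamma>1 \<gamma>2 (\<lambda>s t. delta (xn n) s t - delta x s t)) \<longlonglongrightarrow> 0"
      unfolding e12 by (rule small) (rule le)
  qed (use g in \<open>auto simp: vanishes_simps delta_def\<close>)
qed

text \<open>
  The norm on fields only sees increments, so that \<open>x\<^sub>n\<close> converges to \<open>x\<close> up to the constants
  \<open>x\<^sub>n(0, 0) - x(0, 0)\<close>, which need not converge.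
\<close>
lemma field_pointwise_limit:
  assumes "x \<in> field_space T \<gamma>1 \<gamma>2"
    and "(\<lambda>n. field_norm T \<gamma>1 \<gamma>2 (\<lambda>s t. x s t - xn n s t)) \<longlonglongrightarrow> 0"
    and st: "0 \<le> s" "s \<le> T" "0 \<le> t" "t \<le> T"
  shows "(\<lambda>n. xn n [s] [t] - (xn n [0] [0] - x [0] [0])) \<longlonglongrightarrow> x [s] [t]"
proof -
  have "(\<lambda>n. delta1 (xn n) [0, s] [0]) \<longlonglongrightarrow> delta1 x [0, s] [0]"
  proof -
    obtain C where "holder_limit T 2 1 \<gamma>1 0 C (\<lambda>n. delta1 (xn n)) (delta1 x)"
      using field_limits(1)[OF assms(1,2) order_refl order_refl] by blast
    then show ?thesis by (rule holder_limit_pointwise) (use st in auto)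
  qed
  moreover have "(\<lambda>n. delta2 (xn n) [s] [0, t]) \<longlonglongrightarrow> delta2 x [s] [0, t]"
  proof -
    obtain C where "holder_limit T 1 2 0 \<gamma>2 C (\<lambda>n. delta2 (xn n)) (delta2 x)"
      using field_limits(2)[OF assms(1,2) order_refl order_refl] by blast
    then show ?thesis by (rule holder_limit_pointwise) (use st in auto)
  qed
  ultimately have "(\<lambda>n. delta1 (xn n) [0, s] [0] + delta2 (xn n) [s] [0, t] + x [0] [0])
      \<longlonglongrightarrow> delta1 x [0, s] [0] + delta2 x [s] [0, t] + x [0] [0]"
    by (intro tendsto_add tendsto_const)
  then show ?thesis by (simp add: algebra_simps)
qed

text \<open>
  A sheet component together with approximating ones: the bounds hold with the common constant \<open>M\<close> for
  the limit and for almost all approximations, and \<open>w\<close>, \<open>z\<close> are limits at every pair of ordered tuples.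
\<close>
definition approximated_component where
  "approximated_component T \<gamma>1 \<gamma>2 M xn W Z V x w z v \<longleftrightarrow>
     sheet_component T \<gamma>1 \<gamma>2 M x w z v \<and>
     (\<forall>\<^sub>F n in sequentially. sheet_component T \<gamma>1 \<gamma>2 M (xn n) (W n) (Z n) (V n)) \<and>
     (\<forall>s\<in>ordered_tuples T 2. \<forall>t\<in>ordered_tuples T 2.
        ((\<lambda>n. W n s t) \<longlonglongrightarrow> w s t) \<and> ((\<lambda>n. Z n s t) \<longlonglongrightarrow> z s t))"

text \<open>
  The relations between \<open>w\<close>, \<open>z\<close> and \<open>v\<close> hold for smooth fields and pass to the limit.  Any constant
  from some \<open>M0\<close> on serves for the bounds, so that several components can share one.
\<close>
lemma component_limit:
  assumes x: "x \<in> field_space T \<gamma>1 \<gamma>2" and xn: "\<And>n. smooth_field T (xn n)" and T: "T > 0"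
    and lim: "(\<lambda>n. field_norm T \<gamma>1 \<gamma>2 (\<lambda>s t. x s t - xn n s t)) \<longlonglongrightarrow> 0"
    and g: "1 / 3 < g1" "g1 \<le> \<gamma>1" "1 / 2 < g2" "g2 \<le> \<gamma>2"
    and W: "holder_tendsto T 2 2 \<gamma>1 \<gamma>2 W w"
    and Z: "holder_tendsto T 2 2 (2 * \<gamma>1) \<gamma>2 (\<lambda>n. lift_0dot (xn n) (d n)) z"
    and V: "holder_tendsto T 2 3 (2 * \<gamma>1) (2 * \<gamma>2) (\<lambda>n. lift_2dot (xn n) (d n)) v"
    and d: "\<And>n. continuous_square T (\<lambda>\<sigma> \<tau>. d n [\<sigma>] [\<tau>])"
    and Wd: "\<And>n s1 s2 t1 t2. \<lbrakk>0 \<le> s1; s1 \<le> s2; s2 \<le> T; 0 \<le> t1; t1 \<le> t2; t2 \<le> T\<rbrakk> \<Longrightarrow>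
      W n [s1, s2] [t1, t2] = double_integral (\<lambda>\<sigma> \<tau>. d n [\<sigma>] [\<tau>]) s1 s2 t1 t2"
  shows "\<exists>M0. \<forall>M\<ge>M0. approximated_component T g1 g2 M xn W (\<lambda>n. lift_0dot (xn n) (d n)) (\<lambda>n. lift_2dot (xn n) (d n)) x w z v"
proof -
  let ?Z = "\<lambda>n. lift_0dot (xn n) (d n)" and ?V = "\<lambda>n. lift_2dot (xn n) (d n)"
  note cont = smooth_field_continuous(1)[OF xn T]
  have zero: "double_integral (\<lambda>\<sigma> \<tau>. 0) s1 s2 t1 t2 = 0" for s1 s2 t1 t2
    by (simp add: double_integral_def)
  obtain C1 where C1: "holder_limit T 2 1 g1 0 C1 (\<lambda>n. delta1 (xn n)) (delta1 x)"
    using field_limits(1)[OF x lim g(2,4)] by blast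
  obtain C2 where C2: "holder_limit T 1 2 0 g2 C2 (\<lambda>n. delta2 (xn n)) (delta2 x)"
    using field_limits(2)[OF x lim g(2,4)] by blast
  obtain C3 where C3: "holder_limit T 2 2 g1 g2 C3 (\<lambda>n. delta (xn n)) (delta x)"
    using field_limits(3)[OF x lim g(2,4)] by blast
  obtain C4 where C4: "holder_limit T 2 2 g1 g2 C4 W w"
    using holder_tendsto_limit[OF W, of g1 g2] g by (auto simp: vanishes_simps Wd)
  obtain C5 where C5: "holder_limit T 2 2 (2 * g1) g2 C5 ?Z z"
    using holder_tendsto_limit[OF Z, of "2 * g1" g2] g by (auto simp: vanishes_simps lift_0dot_eq)
  obtain C6 where C6: "holder_limit T 2 3 (2 * g1) (2 * g2) C6 ?V v"
    using holder_tendsto_limit[OF V, of "2 * g1" "2 * g2"] g by (auto simp: vanishes_simps lift_2dot_eq zero)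
  define M0 where "M0 = Max {1, C1, C2, C3, C4, C5, C6}"
  have "C \<le> M0" if "C \<in> {1, C1, C2, C3, C4, C5, C6}" for C
    unfolding M0_def using that by (intro Max_ge) auto
  then have M0: "1 \<le> M0" "C1 \<le> M0" "C2 \<le> M0" "C3 \<le> M0" "C4 \<le> M0" "C5 \<le> M0" "C6 \<le> M0"
    by blast+
  have x1: "(\<lambda>n. delta1 (xn n) [s1, s2] [t]) \<longlonglongrightarrow> delta1 x [s1, s2] [t]"
    if "0 \<le> s1" "s1 \<le> s2" "s2 \<le> T" "0 \<le> t" "t \<le> T" for s1 s2 t
    by (rule holder_limit_pointwise[OF C1]) (use that in auto)
  have w: "(\<lambda>n. W n [s1, s2] [t1, t2]) \<longlonglongrightarrow> w [s1, s2] [t1, t2]"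
    and z: "(\<lambda>n. ?Z n [s1, s2] [t1, t2]) \<longlonglongrightarrow> z [s1, s2] [t1, t2]"
    if "0 \<le> s1" "s1 \<le> s2" "s2 \<le> T" "0 \<le> t1" "t1 \<le> t2" "t2 \<le> T" for s1 s2 t1 t2
    by (rule holder_limit_pointwise[OF C4] holder_limit_pointwise[OF C5]; use that in simp)+
  have v: "(\<lambda>n. ?V n [s1, s2] [t1, t2, t3]) \<longlonglongrightarrow> v [s1, s2] [t1, t2, t3]"
    if "0 \<le> s1" "s1 \<le> s2" "s2 \<le> T" "0 \<le> t1" "t1 \<le> t2" "t2 \<le> t3" "t3 \<le> T" for s1 s2 t1 t2 t3
    by (rule holder_limit_pointwise[OF C6]) (use that in auto)
  have W1: "delta1 (W n) [s1, s2, s3] [t1, t2] = 0"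
    if "0 \<le> s1" "s1 \<le> s2" "s2 \<le> s3" "s3 \<le> T" "0 \<le> t1" "t1 \<le> t2" "t2 \<le> T" for n s1 s2 s3 t1 t2
    using double_integral_split1[OF d[of n], of s1 s2 s3 t1 t2] that by (simp add: Wd)
  have W2: "delta2 (W n) [s1, s2] [t1, t2, t3] = 0"
    if "0 \<le> s1" "s1 \<le> s2" "s2 \<le> T" "0 \<le> t1" "t1 \<le> t2" "t2 \<le> t3" "t3 \<le> T" for n s1 s2 t1 t2 t3
    using double_integral_split2[OF d[of n], of s1 s2 t1 t2 t3] that by (simp add: Wd)
  have Z1: "delta1 (?Z n) [s1, s2, s3] [t1, t2] = delta1 (xn n) [s1, s2] [t1] * W n [s2, s3] [t1, t2]"
    if "0 \<le> s1" "s1 \<le> s2" "s2 \<le> s3" "s3 \<le> T" "0 \<le> t1" "t1 \<le> t2" "t2 \<le> T" for n s1 s2 s3 t1 t2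
    using lift_0dot_delta1[OF cont d that] Wd[of s2 s3 t1 t2 n] that by simp
  have Z2: "delta2 (?Z n) [s1, s2] [t1, t2, t3] = - ?V n [s1, s2] [t1, t2, t3]"
    if "0 \<le> s1" "s1 \<le> s2" "s2 \<le> T" "0 \<le> t1" "t1 \<le> t2" "t2 \<le> t3" "t3 \<le> T" for n s1 s2 t1 t2 t3
    by (rule lift_0dot_delta2[OF cont d that])
  have limit: "sheet_component T g1 g2 M x w z v" if M: "M0 \<le> M" for M
  proof (rule sheet_component.intro[OF order_trans[OF M0(1) M] g(1,3)])
    have bd: "holder_bounded T k l a b M f" if "holder_limit T k l a b C F f" "C \<le> M0" for k l a b C F f
      using that holder_bounded_mono[of T k l a b C f M] M by (auto simp: holder_limit_def)
    show "holder_bounded T 2 1 g1 0 M (delta1 x)" "holder_bounded T 1 2 0 g2 M (delta2 x)"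
      "holder_bounded T 2 2 g1 g2 M (delta x)" "holder_bounded T 2 2 g1 g2 M w"
      "holder_bounded T 2 2 (2 * g1) g2 M z" "holder_bounded T 2 3 (2 * g1) (2 * g2) M v"
      using bd[OF C1 M0(2)] bd[OF C2 M0(3)] bd[OF C3 M0(4)] bd[OF C4 M0(5)] bd[OF C5 M0(6)] bd[OF C6 M0(7)] by blast+
  next
    fix s1 s2 s3 t1 t2 :: real assume st: "0 \<le> s1" "s1 \<le> s2" "s2 \<le> s3" "s3 \<le> T" "0 \<le> t1" "t1 \<le> t2" "t2 \<le> T"
    have "(\<lambda>n. delta1 (W n) [s1, s2, s3] [t1, t2]) \<longlonglongrightarrow> delta1 w [s1, s2, s3] [t1, t2]"
      unfolding delta1.simps by (intro tendsto_diff w) (use st in auto)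
    then show "delta1 w [s1, s2, s3] [t1, t2] = 0"
      unfolding W1[OF st] by (simp add: LIMSEQ_const_iff)
    have "(\<lambda>n. delta1 (?Z n) [s1, s2, s3] [t1, t2]) \<longlonglongrightarrow> delta1 z [s1, s2, s3] [t1, t2]"
      unfolding delta1.simps by (intro tendsto_diff z) (use st in auto)
    moreover have "(\<lambda>n. delta1 (?Z n) [s1, s2, s3] [t1, t2]) \<longlonglongrightarrow> delta1 x [s1, s2] [t1] * w [s2, s3] [t1, t2]"
      unfolding Z1[OF st] by (intro tendsto_mult x1 w) (use st in auto)
    ultimately show "delta1 z [s1, s2, s3] [t1, t2] = delta1 x [s1, s2] [t1] * w [s2, s3] [t1, t2]"
      by (rule LIMSEQ_unique)
  next
    fix s1 s2 t1 t2 t3 :: real assume st: "0 \<le> s1" "s1 \<le> s2" "s2 \<le> T" "0 \<le> t1" "t1 \<le> t2" "t2 \<le> t3" "t3 \<le> T"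
    have "(\<lambda>n. delta2 (W n) [s1, s2] [t1, t2, t3]) \<longlonglongrightarrow> delta2 w [s1, s2] [t1, t2, t3]"
      unfolding delta2_eqs by (intro tendsto_diff w) (use st in auto)
    then show "delta2 w [s1, s2] [t1, t2, t3] = 0"
      unfolding W2[OF st] by (simp add: LIMSEQ_const_iff)
    have "(\<lambda>n. delta2 (?Z n) [s1, s2] [t1, t2, t3]) \<longlonglongrightarrow> delta2 z [s1, s2] [t1, t2, t3]"
      unfolding delta2_eqs by (intro tendsto_diff z) (use st in auto)
    moreover have "(\<lambda>n. delta2 (?Z n) [s1, s2] [t1, t2, t3]) \<longlonglongrightarrow> - v [s1, s2] [t1, t2, t3]"
      unfolding Z2[OF st] by (intro tendsto_minus v st)
    ultimately show "delta2 z [s1, s2] [t1, t2, t3] = - v [s1, s2] [t1, t2, t3]"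
      by (rule LIMSEQ_unique)
  qed
  have approx: "\<forall>\<^sub>F n in sequentially. sheet_component T g1 g2 M (xn n) (W n) (?Z n) (?V n)" if M: "M0 \<le> M" for M
  proof -
    have ev: "\<forall>\<^sub>F n in sequentially. holder_bounded T k l a b M (F n)" if "holder_limit T k l a b C F f" "C \<le> M0" for k l a b C F f
      using that holder_bounded_mono[of T k l a b C _ M] M by (auto simp: holder_limit_def elim: eventually_mono)
    show ?thesis
      using ev[OF C1 M0(2)] ev[OF C2 M0(3)] ev[OF C3 M0(4)] ev[OF C4 M0(5)] ev[OF C5 M0(6)] ev[OF C6 M0(7)]
    proof eventually_elim
      case (elim n)
      show ?case by (rule sheet_component.intro[OF order_trans[OF M0(1) M] g(1,3) W1 W2 Z1 Z2 elim])
    qed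
  qed
  show ?thesis
    unfolding approximated_component_def using limit approx holder_limit_pointwise[OF C4] holder_limit_pointwise[OF C5]
    by (intro exI[of _ M0] allI impI conjI ballI) auto
qed

section \<open>The change of variables formula\<close>

lemma Cb_bounded_derivs:
  assumes "Cb N \<phi>"
  shows "\<exists>M. bounded_derivs M (\<lambda>i. (deriv ^^ i) \<phi>) N"
proof -
  have "\<exists>B. \<forall>u. \<bar>(deriv ^^ i) \<phi> u\<bar> \<le> B" if "i \<le> N" for i
  proof -
    have "bounded (range ((deriv ^^ i) \<phi>))" using assms that by (simp add: Cb_def)
    then show ?thesis by (auto simp: bounded_iff)
  qed
  then obtain B where B: "\<And>i u. i \<le> N \<Longrightarrow> \<bar>(deriv ^^ i) \<phi> u\<bar> \<le> B i" by metis
  have "bounded_derivs (Max (B ` {..N})) (\<lambda>i. (deriv ^^ i) \<phi>) N"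
    unfolding bounded_derivs_def
  proof (intro conjI allI impI)
    fix i u assume "i < N"
    then have "(deriv ^^ i) \<phi> field_differentiable at u" using assms by (simp add: Cb_def)
    then show "((deriv ^^ i) \<phi> has_real_derivative (deriv ^^ Suc i) \<phi> u) (at u)"
      by (simp add: DERIV_deriv_iff_field_differentiable)
  next
    fix i u assume "i \<le> N"
    then show "\<bar>(deriv ^^ i) \<phi> u\<bar> \<le> Max (B ` {..N})"
      by (intro order_trans[OF B Max_ge]) auto
  qed
  then show ?thesis by blast
qed

lemma bounded_derivs_bound_mono:
  "\<lbrakk>bounded_derivs M \<psi> N; M \<le> M'\<rbrakk> \<Longrightarrow> bounded_derivs M' \<psi> N"
  unfolding bounded_derivs_def by (blast intro: order_trans)

lemma bounded_derivs_shift: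
  assumes "bounded_derivs M \<psi> N"
  shows "bounded_derivs M (\<lambda>i u. \<psi> i (u - c)) N"
proof -
  have "((\<lambda>u. \<psi> i (u - c)) has_real_derivative \<psi> (Suc i) (u - c) * 1) (at u)" if "i < N" for i u
  proof (rule DERIV_chain2[where f = "\<psi> i" and g = "\<lambda>u. u - c"])
    show "(\<psi> i has_real_derivative \<psi> (Suc i) (u - c)) (at (u - c))"
      using assms that by (simp add: bounded_derivs_def)
  qed (auto intro!: derivative_eq_intros)
  then show ?thesis using assms by (simp add: bounded_derivs_def)
qed

text \<open>
  The estimate that carries both parts of the theorem: along smooth approximations the bound of
  \<open>riemann_sum_rough_integral\<close> is uniform, and it survives the limit because for a fixed pair of
  partitions the Riemann sums converge.
\<close>
lemma rough_riemann_sum_estimate: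
  assumes T: "T > 0" and x: "x \<in> field_space T \<gamma>1 \<gamma>2" and xn: "\<And>n. smooth_field T (xn n)"
    and lim: "(\<lambda>n. field_norm T \<gamma>1 \<gamma>2 (\<lambda>s t. x s t - xn n s t)) \<longlonglongrightarrow> 0"
    and \<phi>: "bounded_derivs M \<phi> 5"
    and A: "approximated_component T g1 g2 M xn (\<lambda>n. x_1_2 (smooth_lift T (xn n))) (\<lambda>n. x_11_0d2 (smooth_lift T (xn n))) V x w z v"
    and A': "approximated_component T g1 g2 M xn (\<lambda>n. x_h1_h2 (smooth_lift T (xn n))) (\<lambda>n. x_1h1_0dh2 (smooth_lift T (xn n))) V' x w' z' v'"
    and p: "\<And>k. k < n \<Longrightarrow> p k \<le> p (Suc k)" "0 \<le> p 0" "p n \<le> T" "\<And>k. k < n \<Longrightarrow> p (Suc k) - p k \<le> r"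
    and q: "\<And>k. k < m \<Longrightarrow> q k \<le> q (Suc k)" "0 \<le> q 0" "q m \<le> T" "\<And>k. k < m \<Longrightarrow> q (Suc k) - q k \<le> r'"
  defines "g \<equiv> controlled_integrand (\<lambda>i. \<phi> (Suc i)) x w z" and "g' \<equiv> controlled_integrand (\<lambda>i. \<phi> (Suc (Suc i))) x w' z'"
    and "K \<equiv> 5 * M ^ 5 * ((1 + T powr g1)\<^sup>2 * (1 + T powr g2))"
  shows "\<bar>riemann_sum g p n q m + riemann_sum g' p n q m - delta (\<lambda>s t. \<phi> 0 (x s t)) [p 0, p n] [q 0, q m]\<bar>
    \<le> 2 * (K * riemann_const T (3 * g1) (2 * g2) * (r powr (3 * g1 - 1) + r' powr (2 * g2 - 1)))"
proof -
  \<comment> \<open>Shifting \<open>\<phi>\<close> by the constants absorbs the missing convergence of \<open>x\<^sub>n(0, 0)\<close> without touching the lift.\<close>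
  define c where "c N = xn N [0] [0] - x [0] [0]" for N
  define \<psi> where "\<psi> N = (\<lambda>i u. \<phi> i (u - c N))" for N
  have \<psi>: "bounded_derivs M (\<psi> N) 5" for N unfolding \<psi>_def by (rule bounded_derivs_shift[OF \<phi>])
  have \<psi>1: "bounded_derivs M (\<lambda>i. \<psi> N (Suc i)) 3" "bounded_derivs M (\<lambda>i. \<psi> N (Suc (Suc i))) 3" for N
    using bounded_derivs_mono[OF \<psi>, of 4 N] bounded_derivs_Suc[of M "\<psi> N" 3] bounded_derivs_Suc[of M "\<psi> N" 4] \<psi>
      bounded_derivs_Suc[of M "\<lambda>i. \<psi> N (Suc i)" 3] by (simp_all add: eval_nat_numeral)
  have \<phi>c: "isCont (\<phi> i) u" if "i < 5" for i u
    using \<phi> that by (auto simp: bounded_derivs_def intro: DERIV_isCont)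
  have \<psi>lim: "(\<lambda>N. \<psi> N i (xn N [s] [t])) \<longlonglongrightarrow> \<phi> i (x [s] [t])" if "i < 5" "0 \<le> s" "s \<le> T" "0 \<le> t" "t \<le> T" for i s t
    unfolding \<psi>_def c_def using that by (intro isCont_tendsto_compose[OF \<phi>c] field_pointwise_limit[OF x lim]) auto
  have pr: "0 \<le> p i" "p i \<le> p (Suc i)" "p (Suc i) \<le> T" if "i < n" for i
    using cell_range(1-3)[of n p 0 T] p(1-3) that by auto
  have qr: "0 \<le> q i" "q i \<le> q (Suc i)" "q (Suc i) \<le> T" if "i < m" for i
    using cell_range(1-3)[of m q 0 T] q(1-3) that by auto
  have pe: "p 0 \<le> p n" and qe: "q 0 \<le> q m"
    using cell_range(4)[of n p 0 T, OF p(1-3)] cell_range(4)[of m q 0 T, OF q(1-3)] by auto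
  define G where "G N = controlled_integrand (\<lambda>i. \<psi> N (Suc i)) (xn N) (x_1_2 (smooth_lift T (xn N))) (x_11_0d2 (smooth_lift T (xn N)))" for N
  define G' where "G' N = controlled_integrand (\<lambda>i. \<psi> N (Suc (Suc i))) (xn N) (x_h1_h2 (smooth_lift T (xn N))) (x_1h1_0dh2 (smooth_lift T (xn N)))" for N
  let ?e = "K * riemann_const T (3 * g1) (2 * g2) * (r powr (3 * g1 - 1) + r' powr (2 * g2 - 1))"
  let ?D = "\<lambda>N. riemann_sum (G N) p n q m + riemann_sum (G' N) p n q m - delta (\<lambda>s t. \<psi> N 0 (xn N s t)) [p 0, p n] [q 0, q m]"
  have bound: "\<forall>\<^sub>F N in sequentially. \<bar>?D N\<bar> \<le> 2 * ?e"
    using conjunct1[OF conjunct2[OF A[unfolded approximated_component_def]]]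
      conjunct1[OF conjunct2[OF A'[unfolded approximated_component_def]]]
  proof eventually_elim
    case (elim N)
    have s: "sewable T (3 * g1) (2 * g2) K (G N)" "sewable T (3 * g1) (2 * g2) K (G' N)"
      unfolding G_def G'_def K_def
      using sheet_component.integrand_sewable[OF elim(1) \<psi>1(1)] sheet_component.integrand_sewable[OF elim(2) \<psi>1(2)] by auto
    have "delta (\<lambda>s t. \<psi> N 0 (xn N s t)) [p 0, p n] [q 0, q m]
        = rough_integral T (G N) [p 0, p n] [q 0, q m] + rough_integral T (G' N) [p 0, p n] [q 0, q m]"
      unfolding G_def G'_def
      by (rule smooth_rough_decomposition[OF xn T \<psi> s(1)[unfolded G_def] s(2)[unfolded G'_def]]) (use p q pe qe in auto)
    moreover have "\<bar>riemann_sum (G N) p n q m - rough_integral T (G N) [p 0, p n] [q 0, q m]\<bar> \<le> ?e"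
      by (rule riemann_sum_rough_integral[OF s(1) p q])
    moreover have "\<bar>riemann_sum (G' N) p n q m - rough_integral T (G' N) [p 0, p n] [q 0, q m]\<bar> \<le> ?e"
      by (rule riemann_sum_rough_integral[OF s(2) p q])
    ultimately show ?case by linarith
  qed
  have conv: "?D \<longlonglongrightarrow> riemann_sum g p n q m + riemann_sum g' p n q m - delta (\<lambda>s t. \<phi> 0 (x s t)) [p 0, p n] [q 0, q m]"
  proof (intro tendsto_add tendsto_diff)
    have lims: "(\<lambda>N. x_1_2 (smooth_lift T (xn N)) [s1, s2] [t1, t2]) \<longlonglongrightarrow> w [s1, s2] [t1, t2]"
      "(\<lambda>N. x_11_0d2 (smooth_lift T (xn N)) [s1, s2] [t1, t2]) \<longlonglongrightarrow> z [s1, s2] [t1, t2]"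
      "(\<lambda>N. x_h1_h2 (smooth_lift T (xn N)) [s1, s2] [t1, t2]) \<longlonglongrightarrow> w' [s1, s2] [t1, t2]"
      "(\<lambda>N. x_1h1_0dh2 (smooth_lift T (xn N)) [s1, s2] [t1, t2]) \<longlonglongrightarrow> z' [s1, s2] [t1, t2]"
      if "0 \<le> s1" "s1 \<le> s2" "s2 \<le> T" "0 \<le> t1" "t1 \<le> t2" "t2 \<le> T" for s1 s2 t1 t2
      using A A' that by (simp_all add: approximated_component_def)
    show "(\<lambda>N. riemann_sum (G N) p n q m) \<longlonglongrightarrow> riemann_sum g p n q m"
      unfolding riemann_sum_def G_def g_def controlled_integrand_eq
      by (intro tendsto_sum tendsto_add tendsto_mult \<psi>lim lims) (use pr qr in \<open>force+\<close>)
    show "(\<lambda>N. riemann_sum (G' N) p n q m) \<longlonglongrightarrow> riemann_sum g' p n q m"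
      unfolding riemann_sum_def G'_def g'_def controlled_integrand_eq
      by (intro tendsto_sum tendsto_add tendsto_mult \<psi>lim lims) (use pr qr in \<open>force+\<close>)
    show "(\<lambda>N. delta (\<lambda>s t. \<psi> N 0 (xn N s t)) [p 0, p n] [q 0, q m]) \<longlonglongrightarrow> delta (\<lambda>s t. \<phi> 0 (x s t)) [p 0, p n] [q 0, q m]"
      unfolding delta_def delta1.simps delta2_eqs
      by (intro tendsto_diff \<psi>lim) (use p q pe qe in auto)
  qed
  show ?thesis by (rule tendsto_upperbound[OF tendsto_rabs[OF conv] bound]) simp
qed

lemma partition_list:
  assumes "is_partition a b p" "a < b"
  shows "p ! 0 = a" "p ! (length p - 1) = b" "0 \<le> mesh p"
    "\<And>k. k < length p - 1 \<Longrightarrow> p ! k \<le> p ! Suc k"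
    "\<And>k. k < length p - 1 \<Longrightarrow> p ! Suc k - p ! k \<le> mesh p"
proof -
  have p: "p \<noteq> []" "sorted_wrt (<) p" "hd p = a" "last p = b" using assms(1) by (auto simp: is_partition_def)
  show "p ! 0 = a" "p ! (length p - 1) = b" using p by (auto simp: hd_conv_nth last_conv_nth)
  show le: "p ! k \<le> p ! Suc k" if "k < length p - 1" for k
    using sorted_wrt_nth_less[OF p(2), of k "Suc k"] that by (simp add: less_diff_conv less_imp_le)
  show m: "p ! Suc k - p ! k \<le> mesh p" if "k < length p - 1" for k
    unfolding mesh_def using that by (intro Max_ge) auto
  have "0 < length p - 1"
    using \<open>p ! 0 = a\<close> \<open>p ! (length p - 1) = b\<close> assms(2) by (cases "length p - 1") auto
  then show "0 \<le> mesh p" using le[of 0] m[of 0] by linarith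
qed

theorem proposition4p14:
  fixes T \<gamma>1 \<gamma>2 :: real and x :: incr and X :: rough_sheet
    and \<phi> :: "real \<Rightarrow> real" and y :: "nat \<Rightarrow> incr"
  assumes "T > 0" and "\<gamma>1 > 1 / 3" and "\<gamma>2 > 1 / 2"
    and "x \<in> field_space T \<gamma>1 \<gamma>2"
    and "geometric_rough_sheet T \<gamma>1 \<gamma>2 x X"
    and "Cb 5 \<phi>"
    and y: "y = (\<lambda>i s t. (deriv ^^ i) \<phi> (x s t))"
  shows
    "(let g = (\<lambda>s t. incr_mult 1 1 (y 1) (x_1_2 X) s t + incr_mult 1 1 (y 2) (x_11_0d2 X) s t);
         g' = (\<lambda>s t. incr_mult 1 1 (y 2) (x_h1_h2 X) s t + incr_mult 1 1 (y 3) (x_1h1_0dh2 X) s t)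
     in rough_integrable T g \<and> rough_integrable T g' \<and>
        (\<forall>s\<in>ordered_tuples T 2. \<forall>t\<in>ordered_tuples T 2.
           delta (y 0) s t = rough_integral T g s t + rough_integral T g' s t)) \<and>
     (\<forall>s1 s2 t1 t2 \<pi>1 \<pi>2.
       0 \<le> s1 \<and> s1 < s2 \<and> s2 \<le> T \<and> 0 \<le> t1 \<and> t1 < t2 \<and> t2 \<le> T \<and>
       (\<forall>n. is_partition s1 s2 (\<pi>1 n)) \<and> (\<lambda>n. mesh (\<pi>1 n)) \<longlonglongrightarrow> 0 \<and>
       (\<forall>n. is_partition t1 t2 (\<pi>2 n)) \<and> (\<lambda>n. mesh (\<pi>2 n)) \<longlonglongrightarrow> 0 \<longrightarrow>
       (\<lambda>n. let \<sigma> = (\<lambda>i. \<pi>1 n ! i); \<tau> = (\<lambda>j. \<pi>2 n ! j) in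
          (\<Sum>i<length (\<pi>1 n) - 1. \<Sum>j<length (\<pi>2 n) - 1.
             y 1 [\<sigma> i] [\<tau> j] * x_1_2 X [\<sigma> i, \<sigma> (i + 1)] [\<tau> j, \<tau> (j + 1)]
             + y 2 [\<sigma> i] [\<tau> j] * x_11_0d2 X [\<sigma> i, \<sigma> (i + 1)] [\<tau> j, \<tau> (j + 1)])
          + (\<Sum>i<length (\<pi>1 n) - 1. \<Sum>j<length (\<pi>2 n) - 1.
             y 2 [\<sigma> i] [\<tau> j] * x_h1_h2 X [\<sigma> i, \<sigma> (i + 1)] [\<tau> j, \<tau> (j + 1)]
             + y 3 [\<sigma> i] [\<tau> j] * x_1h1_0dh2 X [\<sigma> i, \<sigma> (i + 1)] [\<tau> j, \<tau> (j + 1)]))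
       \<longlonglongrightarrow> delta (y 0) [s1, s2] [t1, t2])"
proof -
  note T = \<open>T > 0\<close> and x = \<open>x \<in> field_space T \<gamma>1 \<gamma>2\<close>
  obtain xn where xn: "\<And>n. smooth_field T (xn n)"
    and lim: "(\<lambda>n. field_norm T \<gamma>1 \<gamma>2 (\<lambda>s t. x s t - xn n s t)) \<longlonglongrightarrow> 0"
    and X: "sheet_tendsto T \<gamma>1 \<gamma>2 (\<lambda>n. smooth_lift T (xn n)) X"
    using assms(5) unfolding geometric_rough_sheet_def by blast
  \<comment> \<open>Smaller exponents lose nothing, and exponents below 1 are needed for \<open>\<delta>\<^sub>1 g\<close> and \<open>\<delta>\<^sub>2 g\<close>.\<close>
  define g1 where "g1 = min \<gamma>1 (2 / 5)"
  define g2 where "g2 = min \<gamma>2 (3 / 4)"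
  have g: "1 / 3 < g1" "g1 \<le> \<gamma>1" "1 / 2 < g2" "g2 \<le> \<gamma>2" "g1 < 1" "g2 < 1"
    using assms(2,3) by (auto simp: g1_def g2_def)
  have lifts: "x_11_0d2 (smooth_lift T f) = lift_0dot f (D12 T f)" "x_11_2d2 (smooth_lift T f) = lift_2dot f (D12 T f)"
    "x_1h1_0dh2 (smooth_lift T f) = lift_0dot f (Dhat12 T f)" "x_1h1_2dh2 (smooth_lift T f) = lift_2dot f (Dhat12 T f)" for f
    by (simp_all add: smooth_lift_def)
  have H: "holder_tendsto T 2 2 \<gamma>1 \<gamma>2 (\<lambda>n. x_1_2 (smooth_lift T (xn n))) (x_1_2 X)"
    "holder_tendsto T 2 2 (2 * \<gamma>1) \<gamma>2 (\<lambda>n. lift_0dot (xn n) (D12 T (xn n))) (x_11_0d2 X)"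
    "holder_tendsto T 2 3 (2 * \<gamma>1) (2 * \<gamma>2) (\<lambda>n. lift_2dot (xn n) (D12 T (xn n))) (x_11_2d2 X)"
    and H': "holder_tendsto T 2 2 \<gamma>1 \<gamma>2 (\<lambda>n. x_h1_h2 (smooth_lift T (xn n))) (x_h1_h2 X)"
    "holder_tendsto T 2 2 (2 * \<gamma>1) \<gamma>2 (\<lambda>n. lift_0dot (xn n) (Dhat12 T (xn n))) (x_1h1_0dh2 X)"
    "holder_tendsto T 2 3 (2 * \<gamma>1) (2 * \<gamma>2) (\<lambda>n. lift_2dot (xn n) (Dhat12 T (xn n))) (x_1h1_2dh2 X)"
    using X unfolding sheet_tendsto_def lifts by blast+
  obtain M1 where M1: "\<And>M. M1 \<le> M \<Longrightarrow> approximated_component T g1 g2 M xn (\<lambda>n. x_1_2 (smooth_lift T (xn n)))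
      (\<lambda>n. lift_0dot (xn n) (D12 T (xn n))) (\<lambda>n. lift_2dot (xn n) (D12 T (xn n))) x (x_1_2 X) (x_11_0d2 X) (x_11_2d2 X)"
    using component_limit[OF x xn T lim g(1-4) H smooth_field_continuous(2)[OF xn T]
        smooth_lift_component_integrals(1)[OF xn T]] by blast
  obtain M2 where M2: "\<And>M. M2 \<le> M \<Longrightarrow> approximated_component T g1 g2 M xn (\<lambda>n. x_h1_h2 (smooth_lift T (xn n)))
      (\<lambda>n. lift_0dot (xn n) (Dhat12 T (xn n))) (\<lambda>n. lift_2dot (xn n) (Dhat12 T (xn n))) x (x_h1_h2 X) (x_1h1_0dh2 X) (x_1h1_2dh2 X)"
    using component_limit[OF x xn T lim g(1-4) H' smooth_field_continuous(3)[OF xn T]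
        smooth_lift_component_integrals(2)[OF xn T]] by blast
  define \<psi> where "\<psi> = (\<lambda>i. (deriv ^^ i) \<phi>)"
  obtain M3 where M3: "bounded_derivs M3 \<psi> 5"
    using Cb_bounded_derivs[OF assms(6)] unfolding \<psi>_def by blast
  define M where "M = max M1 (max M2 M3)"
  have M: "M1 \<le> M" "M2 \<le> M" "M3 \<le> M" by (auto simp: M_def)
  note AC = M1[OF M(1)] M2[OF M(2)]
  have A: "sheet_component T g1 g2 M x (x_1_2 X) (x_11_0d2 X) (x_11_2d2 X)"
    and A': "sheet_component T g1 g2 M x (x_h1_h2 X) (x_1h1_0dh2 X) (x_1h1_2dh2 X)"
    using AC by (simp_all add: approximated_component_def)
  have \<psi>: "bounded_derivs M \<psi> 5" by (rule bounded_derivs_bound_mono[OF M3 M(3)])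
  have \<psi>5: "bounded_derivs M \<psi> (Suc (Suc 3))" using \<psi> by (simp add: eval_nat_numeral)
  have \<psi>1: "bounded_derivs M (\<lambda>i. \<psi> (Suc i)) 3" "bounded_derivs M (\<lambda>i. \<psi> (Suc (Suc i))) 3"
    using bounded_derivs_mono[OF bounded_derivs_Suc[OF \<psi>5], of 3] bounded_derivs_Suc[OF bounded_derivs_Suc[OF \<psi>5]] by auto
  define G where "G = controlled_integrand (\<lambda>i. \<psi> (Suc i)) x (x_1_2 X) (x_11_0d2 X)"
  define G' where "G' = controlled_integrand (\<lambda>i. \<psi> (Suc (Suc i))) x (x_h1_h2 X) (x_1h1_0dh2 X)"
  have y\<psi>: "y = (\<lambda>i s t. \<psi> i (x s t))" by (simp add: y \<psi>_def)
  have G: "(\<lambda>s t. incr_mult 1 1 (y 1) (x_1_2 X) s t + incr_mult 1 1 (y 2) (x_11_0d2 X) s t) = G"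
    and G': "(\<lambda>s t. incr_mult 1 1 (y 2) (x_h1_h2 X) s t + incr_mult 1 1 (y 3) (x_1h1_0dh2 X) s t) = G'"
    unfolding G_def G'_def controlled_integrand_def y\<psi> by (simp_all add: eval_nat_numeral)
  define K where "K = 5 * M ^ 5 * ((1 + T powr g1)\<^sup>2 * (1 + T powr g2))"
  define \<epsilon> where "\<epsilon> r r' = 2 * (K * riemann_const T (3 * g1) (2 * g2) * (r powr (3 * g1 - 1) + r' powr (2 * g2 - 1)))" for r r'
  have est: "\<bar>riemann_sum G p n q m + riemann_sum G' p n q m - delta (y 0) [p 0, p n] [q 0, q m]\<bar> \<le> \<epsilon> r r'"
    if "\<And>k. k < n \<Longrightarrow> p k \<le> p (Suc k)" "0 \<le> p 0" "p n \<le> T" "\<And>k. k < n \<Longrightarrow> p (Suc k) - p k \<le> r"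
      "\<And>k. k < m \<Longrightarrow> q k \<le> q (Suc k)" "0 \<le> q 0" "q m \<le> T" "\<And>k. k < m \<Longrightarrow> q (Suc k) - q k \<le> r'"
    for p q n m r r'
    unfolding G_def G'_def \<epsilon>_def K_def y\<psi>
    by (rule rough_riemann_sum_estimate[OF T x xn lim \<psi> AC[folded lifts] that])
  have \<epsilon>: "(\<lambda>n. \<epsilon> (r n) (r' n)) \<longlonglongrightarrow> 0"
    if r: "r \<longlonglongrightarrow> 0" "r' \<longlonglongrightarrow> 0" "\<And>n. 0 \<le> r n" "\<And>n. 0 \<le> r' n" for r r'
  proof -
    have pow: "(\<lambda>n. h n powr e) \<longlonglongrightarrow> 0" if "h \<longlonglongrightarrow> 0" "\<And>n. 0 \<le> h n" "e > 0" for h :: "nat \<Rightarrow> real" and e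
    proof -
      have "(\<lambda>n. h n powr e) \<longlonglongrightarrow> 0 powr e"
        by (rule tendsto_powr2[OF that(1) tendsto_const]) (use that in auto)
      then show ?thesis by simp
    qed
    have "(\<lambda>n. \<epsilon> (r n) (r' n)) \<longlonglongrightarrow> 2 * (K * riemann_const T (3 * g1) (2 * g2) * (0 + 0))"
      unfolding \<epsilon>_def by (intro tendsto_mult tendsto_add tendsto_const pow r) (use g in auto)
    then show ?thesis by simp
  qed
  have space: "x \<in> incr_space T 1 1" "x_1_2 X \<in> incr_space T 2 2" "x_11_0d2 X \<in> incr_space T 2 2"
    "x_h1_h2 X \<in> incr_space T 2 2" "x_1h1_0dh2 X \<in> incr_space T 2 2"
    using x H H' by (auto simp: field_space_def holder_tendsto_def holder_space_def)
  have int: "rough_integrable T G" "rough_integrable T G'"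
    unfolding G_def G'_def
    by (rule sheet_component.integrand_rough_integrable[OF A space(1-3) \<psi>1(1) g(5,6)]
          sheet_component.integrand_rough_integrable[OF A' space(1,4,5) \<psi>1(2) g(5,6)])+
  have sew: "sewable T (3 * g1) (2 * g2) K G" "sewable T (3 * g1) (2 * g2) K G'"
    unfolding G_def G'_def K_def
    by (rule sheet_component.integrand_sewable[OF A \<psi>1(1)] sheet_component.integrand_sewable[OF A' \<psi>1(2)])+
  have decomposition: "delta (y 0) [s1, s2] [t1, t2] = rough_integral T G [s1, s2] [t1, t2] + rough_integral T G' [s1, s2] [t1, t2]"
    if st: "0 \<le> s1" "s1 \<le> s2" "s2 \<le> T" "0 \<le> t1" "t1 \<le> t2" "t2 \<le> T" for s1 s2 t1 t2
  proof -
    let ?S = "\<lambda>G n. riemann_sum G (uniform_partition s1 s2 n) (Suc n) (uniform_partition t1 t2 n) (Suc n)"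
    note u = uniform_partition[OF st(2)] uniform_partition[OF st(5)]
    have bnd: "\<bar>?S G n + ?S G' n - delta (y 0) [s1, s2] [t1, t2]\<bar> \<le> \<epsilon> ((s2 - s1) / real (Suc n)) ((t2 - t1) / real (Suc n))" for n
      using est[of "Suc n" "uniform_partition s1 s2 n" "(s2 - s1) / real (Suc n)" "Suc n" "uniform_partition t1 t2 n" "(t2 - t1) / real (Suc n)"]
        u st by (simp del: of_nat_Suc)
    have "(\<lambda>n. \<epsilon> ((s2 - s1) / real (Suc n)) ((t2 - t1) / real (Suc n))) \<longlonglongrightarrow> 0"
      by (intro \<epsilon> LIMSEQ_Suc[OF lim_const_over_n]) (use st in auto)
    then have "(\<lambda>n. ?S G n + ?S G' n - delta (y 0) [s1, s2] [t1, t2]) \<longlonglongrightarrow> 0"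
      by (rule Lim_null_comparison[rotated]) (simp only: real_norm_def bnd eventually_True)
    then have "(\<lambda>n. ?S G n + ?S G' n) \<longlonglongrightarrow> delta (y 0) [s1, s2] [t1, t2]"
      by (rule LIM_zero_cancel)
    moreover have "(\<lambda>n. ?S G n + ?S G' n) \<longlonglongrightarrow> rough_integral T G [s1, s2] [t1, t2] + rough_integral T G' [s1, s2] [t1, t2]"
      by (intro tendsto_add sewable_uniform_limit[OF sew(1) st] sewable_uniform_limit[OF sew(2) st])
    ultimately show ?thesis by (rule LIMSEQ_unique)
  qed
  have riemann: "(\<lambda>n. riemann_sum G (\<lambda>i. \<pi>1 n ! i) (length (\<pi>1 n) - 1) (\<lambda>j. \<pi>2 n ! j) (length (\<pi>2 n) - 1)
      + riemann_sum G' (\<lambda>i. \<pi>1 n ! i) (length (\<pi>1 n) - 1) (\<lambda>j. \<pi>2 n ! j) (length (\<pi>2 n) - 1))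
      \<longlonglongrightarrow> delta (y 0) [s1, s2] [t1, t2]"
    if st: "0 \<le> s1" "s1 < s2" "s2 \<le> T" "0 \<le> t1" "t1 < t2" "t2 \<le> T"
      and p: "\<And>n. is_partition s1 s2 (\<pi>1 n)" "(\<lambda>n. mesh (\<pi>1 n)) \<longlonglongrightarrow> 0"
      and q: "\<And>n. is_partition t1 t2 (\<pi>2 n)" "(\<lambda>n. mesh (\<pi>2 n)) \<longlonglongrightarrow> 0"
    for s1 s2 t1 t2 \<pi>1 \<pi>2
  proof -
    let ?S = "\<lambda>G n. riemann_sum G (\<lambda>i. \<pi>1 n ! i) (length (\<pi>1 n) - 1) (\<lambda>j. \<pi>2 n ! j) (length (\<pi>2 n) - 1)"
    note pl = partition_list[OF p(1) st(2)] and ql = partition_list[OF q(1) st(5)]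
    have bnd: "\<bar>?S G n + ?S G' n - delta (y 0) [s1, s2] [t1, t2]\<bar> \<le> \<epsilon> (mesh (\<pi>1 n)) (mesh (\<pi>2 n))" for n
      using est[of "length (\<pi>1 n) - 1" "\<lambda>i. \<pi>1 n ! i" "mesh (\<pi>1 n)" "length (\<pi>2 n) - 1" "\<lambda>j. \<pi>2 n ! j" "mesh (\<pi>2 n)",
          OF pl(4) _ _ pl(5) ql(4) _ _ ql(5)] st
      unfolding pl(1,2) ql(1,2) by simp
    have "(\<lambda>n. \<epsilon> (mesh (\<pi>1 n)) (mesh (\<pi>2 n))) \<longlonglongrightarrow> 0"
      by (intro \<epsilon> p q pl ql)
    then have "(\<lambda>n. ?S G n + ?S G' n - delta (y 0) [s1, s2] [t1, t2]) \<longlonglongrightarrow> 0"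
      by (rule Lim_null_comparison[rotated]) (simp only: real_norm_def bnd eventually_True)
    then show ?thesis by (rule LIM_zero_cancel)
  qed
  show ?thesis
  proof (intro conjI allI impI)
    show "let g = (\<lambda>s t. incr_mult 1 1 (y 1) (x_1_2 X) s t + incr_mult 1 1 (y 2) (x_11_0d2 X) s t);
         g' = (\<lambda>s t. incr_mult 1 1 (y 2) (x_h1_h2 X) s t + incr_mult 1 1 (y 3) (x_1h1_0dh2 X) s t)
      in rough_integrable T g \<and> rough_integrable T g' \<and>
        (\<forall>s\<in>ordered_tuples T 2. \<forall>t\<in>ordered_tuples T 2.
           delta (y 0) s t = rough_integral T g s t + rough_integral T g' s t)"
      unfolding Let_def G G' using int decomposition by (auto dest!: tuple_cases(2))
    fix s1 s2 t1 t2 \<pi>1 \<pi>2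
    assume a: "0 \<le> s1 \<and> s1 < s2 \<and> s2 \<le> T \<and> 0 \<le> t1 \<and> t1 < t2 \<and> t2 \<le> T \<and>
       (\<forall>n. is_partition s1 s2 (\<pi>1 n)) \<and> (\<lambda>n. mesh (\<pi>1 n)) \<longlonglongrightarrow> 0 \<and>
       (\<forall>n. is_partition t1 t2 (\<pi>2 n)) \<and> (\<lambda>n. mesh (\<pi>2 n)) \<longlonglongrightarrow> 0"
    have c: "G [a, b] [c, d] = y 1 [a] [c] * x_1_2 X [a, b] [c, d] + y 2 [a] [c] * x_11_0d2 X [a, b] [c, d]"
      "G' [a, b] [c, d] = y 2 [a] [c] * x_h1_h2 X [a, b] [c, d] + y 3 [a] [c] * x_1h1_0dh2 X [a, b] [c, d]" for a b c d
      by (simp_all add: G_def G'_def y\<psi> eval_nat_numeral)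
    show "(\<lambda>n. let \<sigma> = (\<lambda>i. \<pi>1 n ! i); \<tau> = (\<lambda>j. \<pi>2 n ! j) in
          (\<Sum>i<length (\<pi>1 n) - 1. \<Sum>j<length (\<pi>2 n) - 1.
             y 1 [\<sigma> i] [\<tau> j] * x_1_2 X [\<sigma> i, \<sigma> (i + 1)] [\<tau> j, \<tau> (j + 1)]
             + y 2 [\<sigma> i] [\<tau> j] * x_11_0d2 X [\<sigma> i, \<sigma> (i + 1)] [\<tau> j, \<tau> (j + 1)])
          + (\<Sum>i<length (\<pi>1 n) - 1. \<Sum>j<length (\<pi>2 n) - 1.
             y 2 [\<sigma> i] [\<tau> j] * x_h1_h2 X [\<sigma> i, \<sigma> (i + 1)] [\<tau> j, \<tau> (j + 1)]
             + y 3 [\<sigma> i] [\<tau> j] * x_1h1_0dh2 X [\<sigma> i, \<sigma> (i + 1)] [\<tau> j, \<tau> (j + 1)]))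
       \<longlonglongrightarrow> delta (y 0) [s1, s2] [t1, t2]"
      using riemann[of s1 s2 t1 t2 \<pi>1 \<pi>2] a
      unfolding riemann_sum_def c Let_def Suc_eq_plus1 by blast
  qed
qed

end
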